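(* For every $\epsilon>0$ and every function $f:\mathbb N\to\mathbb R$ with $f(q)\to\infty$, there exists a weakly mixing rank-one transformation on a probability space whose associated subshift has word complexity $p$ satisfying $$\limsup_{q\to\infty}\frac{p(q)}{q}<1.5+\epsilon\quad\text{and}\quad p(q)<q+f(q)\ \text{for infinitely many } q.$$
   Context: Rank-one transformations: a rank-one transformation $T$ is specified by a cut sequence $(r_n)_{n\ge1}$ of positive integers and a spacer sequence $(s_{n,i})_{n\ge 1,\,0\le i\le r_n}$ of nonnegative integers via cutting and stacking: $C_1=[0,1)$ is a column of height $h_1=1$; $C_{n+1}$ is obtained by cutting $C_n$ into $r_n+1$ subcolumns of equal width, putting $s_{n,i}$ spacer intervals on top of subcolumn $i$ ($i=0$ leftmost), and stacking the subcolumns left to right. The associated subshift $X(T)\subseteq\{0,1\}^{\mathbb Z}$ is given by $B_1=0$, $B_{n+1}=B_n1^{s_{n,0}}B_n1^{s_{n,1}}\cdots B_n1^{s_{n,r_n}}$: the set of biinfinite sequences all of whose finite subwords are subwords of some $B_n$; $p(q)$ is the number of distinct words of length $q$ occurring in $X(T)$. Weak mixing refers to the transformation $T$ with its invariant probability measure (equivalently $X(T)$ with its empirical measure, to which it is isomorphic). *)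

theory Defs
  imports "HOL-Probability.Probability" "HOL-Library.Sublist"
begin

text \<open>Conventions.  Stages are indexed from 0 here: r n and s n i play the roles of
  the paper's r_(n+1) and s_(n+1,i).  Cut sequence r, spacer sequence s.\<close>

primrec rk_word :: "(nat \<Rightarrow> nat) \<Rightarrow> (nat \<Rightarrow> nat \<Rightarrow> nat) \<Rightarrow> nat \<Rightarrow> nat list" where
  "rk_word r s 0 = [0]"
| "rk_word r s (Suc n) = concat (map (\<lambda>i. rk_word r s n @ replicate (s n i) 1) [0..<Suc (r n)])"

definition window :: "(int \<Rightarrow> nat) \<Rightarrow> int \<Rightarrow> nat \<Rightarrow> nat list" where
  "window x k q = map (\<lambda>i. x (k + int i)) [0..<q]"

definition rk_subshift :: "(nat \<Rightarrow> nat) \<Rightarrow> (nat \<Rightarrow> nat \<Rightarrow> nat) \<Rightarrow> (int \<Rightarrow> nat) set" where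
  "rk_subshift r s = {x. (\<forall>k. x k \<in> {0,1}) \<and>
      (\<forall>k q. \<exists>n. sublist (window x k q) (rk_word r s n))}"

definition rk_complexity :: "(nat \<Rightarrow> nat) \<Rightarrow> (nat \<Rightarrow> nat \<Rightarrow> nat) \<Rightarrow> nat \<Rightarrow> nat" where
  "rk_complexity r s q = card {w. \<exists>x\<in>rk_subshift r s. \<exists>k. w = window x k q}"

definition rk_width :: "(nat \<Rightarrow> nat) \<Rightarrow> nat \<Rightarrow> real" where
  "rk_width r n = 1 / (\<Prod>k<n. real (r k + 1))"

text \<open>Total length of [0, L_n) used by the intervals up to column C_n; new spacer
  intervals are placed consecutively to the right of it.\<close>
primrec rk_used :: "(nat \<Rightarrow> nat) \<Rightarrow> (nat \<Rightarrow> nat \<Rightarrow> nat) \<Rightarrow> nat \<Rightarrow> real" where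
  "rk_used r s 0 = 1"
| "rk_used r s (Suc n) = rk_used r s n + real (\<Sum>i\<le>r n. s n i) * rk_width r (Suc n)"

text \<open>Column C_n as the list (bottom to top) of left endpoints of its levels; each
  level is [a, a + rk_width r n).\<close>
primrec rk_column :: "(nat \<Rightarrow> nat) \<Rightarrow> (nat \<Rightarrow> nat \<Rightarrow> nat) \<Rightarrow> nat \<Rightarrow> real list" where
  "rk_column r s 0 = [0]"
| "rk_column r s (Suc n) = concat (map (\<lambda>i.
      map (\<lambda>a. a + real i * rk_width r (Suc n)) (rk_column r s n) @
      map (\<lambda>t. rk_used r s n + real ((\<Sum>j<i. s n j) + t) * rk_width r (Suc n)) [0..<s n i])
    [0..<Suc (r n)])"

definition rk_space :: "(nat \<Rightarrow> nat) \<Rightarrow> (nat \<Rightarrow> nat \<Rightarrow> nat) \<Rightarrow> real set" where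
  "rk_space r s = (\<Union>n. \<Union>a\<in>set (rk_column r s n). {a..<a + rk_width r n})"

text \<open>T maps each non-top level of C_n by translation onto the level above it
  (consistent across n); it is the identity on the null set of points that are never
  in a non-top level.\<close>
definition rk_map :: "(nat \<Rightarrow> nat) \<Rightarrow> (nat \<Rightarrow> nat \<Rightarrow> nat) \<Rightarrow> real \<Rightarrow> real" where
  "rk_map r s x =
    (if \<exists>n j. Suc j < length (rk_column r s n) \<and> rk_column r s n ! j \<le> x \<and>
               x < rk_column r s n ! j + rk_width r n
     then (SOME y. \<exists>n j. Suc j < length (rk_column r s n) \<and> rk_column r s n ! j \<le> x \<and>
               x < rk_column r s n ! j + rk_width r n \<and>
               y = x - rk_column r s n ! j + rk_column r s n ! Suc j)
     else x)"

definition rk_measure :: "(nat \<Rightarrow> nat) \<Rightarrow> (nat \<Rightarrow> nat \<Rightarrow> nat) \<Rightarrow> real measure" where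
  "rk_measure r s = uniform_measure (restrict_space lborel (rk_space r s)) (rk_space r s)"

definition measure_preserving_map :: "'a measure \<Rightarrow> ('a \<Rightarrow> 'a) \<Rightarrow> bool" where
  "measure_preserving_map M T \<longleftrightarrow> T \<in> M \<rightarrow>\<^sub>M M \<and>
     (\<forall>A\<in>sets M. emeasure M (T -` A \<inter> space M) = emeasure M A)"

definition weakly_mixing :: "'a measure \<Rightarrow> ('a \<Rightarrow> 'a) \<Rightarrow> bool" where
  "weakly_mixing M T \<longleftrightarrow> prob_space M \<and> measure_preserving_map M T \<and>
     (\<forall>A\<in>sets M. \<forall>B\<in>sets M.
        (\<lambda>N. (\<Sum>n<N. \<bar>measure M ((T ^^ n) -` A \<inter> space M \<inter> B) - measure M A * measure M B\<bar>)
              / real N) \<longlonglongrightarrow> 0)"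

end

theory Submission
  imports Defs "HOL-Real_Asymp.Real_Asymp"
begin

text \<open>
  The construction is \<open>B' = (B\<^sup>c 1)\<^sup>c\<^sup>-\<^sup>1 B\<^sup>c\<close> with an even \<open>c = c\<^sub>n\<close> growing fast.

  Complexity. Seen at the scale of \<open>B\<^sup>c\<close>, the subshift consists of copies of \<open>B\<^sup>c\<close> separated by \<open>1\<close>, where
  isolated separators are missing; at the scale of \<open>B'\<close> it consists of copies of \<open>B'\<close> separated by nothing,
  with isolated separators \<open>1\<close>. In both cases a separator of the second kind keeps the sequence periodic (with
  period \<open>|B|\<close>, respectively \<open>|B\<^sup>c 1|\<close>), so a word of length at most \<open>2\<ell>\<close>, where \<open>\<ell>\<close> is the length of the copied
  block, is either periodic, or determined by the position of one separator of the first kind, or of two of them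
  at distance about \<open>\<ell>\<close>. This gives about \<open>p + q + (q - \<ell>)\<^sup>+\<close> words with \<open>p\<close> the period, and hence \<open>3/2\<close>. At
  \<open>q = |B\<^sup>c|\<close> there are only \<open>q + |B| + 2\<close> words, and \<open>c\<close> may be chosen after \<open>|B|\<close>.

  Weak mixing. Let \<open>h = |B|\<close>. The power \<open>(c/2) h + 1\<close> of the transformation crosses a spacer for half of the
  points, uniformly in every level of the column, so these powers converge weakly to \<open>(I + T)/2\<close>; and averages
  over \<open>h\<close> steps are nearly constant. For \<open>H = F \<otimes> F\<close> with \<open>F\<close> of mean zero, let \<open>K\<close> be an average of the
  \<open>(T \<times> T)\<^sup>u H\<close> whose norm is nearly minimal. By the parallelogram law \<open>K\<close> is nearly invariant under all powers
  of \<open>T \<times> T\<close>, and by the weak limit nearly invariant under \<open>T \<times> 1\<close>; averaging in the first coordinate makes \<open>K\<close> small.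
\<close>

section \<open>A criterion for weak mixing\<close>


locale mpt = prob_space M for M :: "'a measure" +
  fixes T :: "'a \<Rightarrow> 'a"
  assumes mpt: "measure_preserving_map M T"
begin

lemma T_pow_measurable [measurable]: "(T ^^ t) \<in> M \<rightarrow>\<^sub>M M"
proof (induction t)
  case (Suc t)
  have "T \<in> M \<rightarrow>\<^sub>M M" using mpt by (simp add: measure_preserving_map_def)
  then show ?case using Suc by (simp add: measurable_comp)
qed simp

lemma distr_T: "distr M M T = M"
  using mpt unfolding measure_preserving_map_def
  by (intro measure_eqI) (auto simp: emeasure_distr)

lemma distr_T_pow: "distr M M (T ^^ t) = M"
proof (induction t)
  case 0 show ?case by (simp add: id_def)
next
  case (Suc t)
  have "T \<in> M \<rightarrow>\<^sub>M M" using mpt by (simp add: measure_preserving_map_def)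
  then have "distr M M (T \<circ> (T ^^ t)) = distr (distr M M (T ^^ t)) M T"
    by (subst distr_distr) auto
  also have "\<dots> = M" using Suc distr_T by simp
  finally show ?case by (simp only: funpow.simps)
qed

lemma integral_T_pow:
  fixes g :: "'a \<Rightarrow> real"
  assumes [measurable]: "g \<in> borel_measurable M"
  shows "(\<integral>x. g ((T ^^ t) x) \<partial>M) = (\<integral>x. g x \<partial>M)"
proof -
  have "(\<integral>x. g ((T ^^ t) x) \<partial>M) = integral\<^sup>L (distr M M (T ^^ t)) g"
    by (subst integral_distr) auto
  then show ?thesis by (simp add: distr_T_pow)
qed

lemma prob_T_pow:
  assumes "A \<in> sets M"
  shows "prob ((T ^^ t) -` A \<inter> space M) = prob A"
proof -
  have "prob ((T ^^ t) -` A \<inter> space M) = measure (distr M M (T ^^ t)) A"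
    using assms by (simp add: measure_distr)
  then show ?thesis by (simp add: distr_T_pow)
qed

end

lemma integral_pair_mult:
  fixes g h :: "'a \<Rightarrow> real"
  assumes "prob_space M" and [measurable]: "g \<in> borel_measurable M" "h \<in> borel_measurable M"
    and "\<And>x. \<bar>g x\<bar> \<le> 1" "\<And>x. \<bar>h x\<bar> \<le> 1"
  shows "(\<integral>z. g (fst z) * h (snd z) \<partial>(M \<Otimes>\<^sub>M M)) = (\<integral>x. g x \<partial>M) * (\<integral>x. h x \<partial>M)"
proof -
  interpret prob_space M by fact
  interpret P: pair_prob_space M M ..
  have "integrable (M \<Otimes>\<^sub>M M) (\<lambda>(x, y). g x * h y)"
  proof (rule P.P.integrable_const_bound[where B = 1])
    show "AE z in M \<Otimes>\<^sub>M M. norm (case z of (x, y) \<Rightarrow> g x * h y) \<le> 1"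
      using assms(4,5) by (intro AE_I2) (auto simp: abs_mult intro!: mult_le_one)
  qed simp
  from P.integral_fst[OF this]
  have "(\<integral>x. \<integral>y. g x * h y \<partial>M \<partial>M) = (\<integral>z. (case z of (x, y) \<Rightarrow> g x * h y) \<partial>(M \<Otimes>\<^sub>M M))"
    by simp
  then show ?thesis by (simp add: case_prod_beta)
qed

section \<open>Correlations of a centred indicator and of its tensor square\<close>

locale mpt_set = mpt M T for M :: "'a measure" and T +
  fixes A :: "'a set"
  assumes A [measurable]: "A \<in> sets M"
begin

sublocale P: pair_prob_space M M ..

abbreviation MM :: "('a \<times> 'a) measure" where "MM \<equiv> M \<Otimes>\<^sub>M M"

definition F :: "'a \<Rightarrow> real" where "F x = indicator A x - prob A"

lemma F_measurable [measurable]: "F \<in> borel_measurable M"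
  unfolding F_def by measurable

lemma F_bound: "\<bar>F x\<bar> \<le> 1"
  using prob_le_1[of A] measure_nonneg[of M A]
  by (auto simp: F_def indicator_def abs_le_iff simp del: prob_le_1 measure_nonneg)

text \<open>The autocorrelation of \<open>F\<close>; by \<open>psi_shift\<close> it depends only on
  \<open>a - b\<close>. Two natural indices are kept because \<open>T\<close> is not assumed
  invertible, so negative shifts have no direct meaning.\<close>

definition psi :: "nat \<Rightarrow> nat \<Rightarrow> real" where
  "psi a b = (\<integral>x. F ((T ^^ a) x) * F ((T ^^ b) x) \<partial>M)"

lemma psi_shift: "psi (a + k) (b + k) = psi a b"
  using integral_T_pow[of "\<lambda>x. F ((T ^^ a) x) * F ((T ^^ b) x)" k]
  by (simp add: psi_def funpow_add)

lemma psi_eq: "psi a b = prob ((T ^^ a) -` A \<inter> space M \<inter> ((T ^^ b) -` A \<inter> space M)) - (prob A)\<^sup>2"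
proof -
  define A' B' where "A' = (T ^^ a) -` A \<inter> space M" and "B' = (T ^^ b) -` A \<inter> space M"
  have [measurable]: "A' \<in> sets M" "B' \<in> sets M" unfolding A'_def B'_def by measurable
  have p: "prob A' = prob A" "prob B' = prob A" unfolding A'_def B'_def by (simp_all add: prob_T_pow)
  have "psi a b = (\<integral>x. indicator (A' \<inter> B') x - prob A * indicator A' x - prob A * indicator B' x + (prob A)\<^sup>2 \<partial>M)"
    unfolding psi_def
    by (rule Bochner_Integration.integral_cong)
       (auto simp: F_def A'_def B'_def indicator_def power2_eq_square algebra_simps)
  also have "\<dots> = prob (A' \<inter> B') - prob A * prob A' - prob A * prob B' + (prob A)\<^sup>2"
    by (simp add: prob_space emeasure_eq_measure)
  finally show ?thesis using p by (simp add: A'_def B'_def power2_eq_square)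
qed

text \<open>The exponents are independent so that one coordinate can be moved alone.\<close>

definition G :: "nat \<Rightarrow> nat \<Rightarrow> 'a \<times> 'a \<Rightarrow> real" where
  "G a b z = F ((T ^^ a) (fst z)) * F ((T ^^ b) (snd z))"

lemma G_measurable [measurable]: "G a b \<in> borel_measurable MM"
  unfolding G_def by measurable

lemma G_bound: "\<bar>G a b z\<bar> \<le> 1"
  unfolding G_def using F_bound by (simp add: abs_mult mult_le_one)

lemma integrable_bounded:
  fixes g :: "'a \<times> 'a \<Rightarrow> real"
  assumes "g \<in> borel_measurable MM" "\<And>z. \<bar>g z\<bar> \<le> c"
  shows "integrable MM g"
  by (rule P.P.integrable_const_bound[where B = c]) (use assms in auto)

lemma integrable_GG [simp]: "integrable MM (\<lambda>z. G a b z * G a' b' z)"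
  by (rule integrable_bounded[where c = 1]) (auto simp: abs_mult G_bound intro!: mult_le_one)

lemma integral_GG: "(\<integral>z. G a b z * G a' b' z \<partial>MM) = psi a a' * psi b b'"
proof -
  have "(\<integral>z. G a b z * G a' b' z \<partial>MM)
      = (\<integral>z. (F ((T ^^ a) (fst z)) * F ((T ^^ a') (fst z))) *
             (F ((T ^^ b) (snd z)) * F ((T ^^ b') (snd z))) \<partial>MM)"
    by (simp add: G_def mult_ac)
  also have "\<dots> = psi a a' * psi b b'"
    unfolding psi_def
    by (rule integral_pair_mult)
       (auto simp: abs_mult F_bound intro!: mult_le_one prob_space_axioms)
  finally show ?thesis .
qed

text \<open>Arbitrary weights are allowed, not only uniform ones, because the midpoint of two
  averages must again be of this form.\<close>

definition V :: "(nat \<Rightarrow> real) \<Rightarrow> nat \<Rightarrow> nat \<Rightarrow> nat \<Rightarrow> 'a \<times> 'a \<Rightarrow> real" where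
  "V w R a b z = (\<Sum>u<R. w u * G (u + a) (u + b) z)"

lemma V_measurable [measurable]: "V w R a b \<in> borel_measurable MM"
  unfolding V_def by measurable

lemma V_prod: "V w R a b z * V w' R' a' b' z =
    (\<Sum>u<R. \<Sum>v<R'. w u * w' v * (G (u + a) (u + b) z * G (v + a') (v + b') z))"
  unfolding V_def sum_product by (simp add: mult_ac)

lemma integrable_VV [simp]: "integrable MM (\<lambda>z. V w R a b z * V w' R' a' b' z)"
  unfolding V_prod by simp

lemma integrable_V2 [simp]: "integrable MM (\<lambda>z. (V w R a b z)\<^sup>2)"
  unfolding power2_eq_square by simp

lemma integral_VV: "(\<integral>z. V w R a b z * V w' R' a' b' z \<partial>MM) =
    (\<Sum>u<R. \<Sum>v<R'. w u * w' v * (psi (u + a) (v + a') * psi (u + b) (v + b')))"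
  unfolding V_prod by (simp add: integral_GG)

text \<open>By \<open>integral_VV\<close> only products of two values of \<open>psi\<close> enter,
  one per coordinate, and each is stationary by itself. Hence the coordinates may be shifted by
  different amounts.\<close>

lemma integral_VV_shift:
  "(\<integral>z. V w R (a + k) (b + l) z * V w' R' (a' + k) (b' + l) z \<partial>MM)
   = (\<integral>z. V w R a b z * V w' R' a' b' z \<partial>MM)"
  unfolding integral_VV using psi_shift by (simp flip: add.assoc)

lemma V_bound:
  assumes "\<And>u. w u \<ge> 0" "(\<Sum>u<R. w u) = 1"
  shows "\<bar>V w R a b z\<bar> \<le> 1"
proof -
  have "\<bar>V w R a b z\<bar> \<le> (\<Sum>u<R. \<bar>w u * G (u + a) (u + b) z\<bar>)"
    unfolding V_def by (rule sum_abs)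
  also have "\<dots> \<le> (\<Sum>u<R. w u)"
    using assms(1) G_bound by (intro sum_mono) (simp add: abs_mult mult_left_le)
  finally show ?thesis using assms by simp
qed

abbreviation K :: "nat \<Rightarrow> nat \<Rightarrow> nat \<Rightarrow> 'a \<times> 'a \<Rightarrow> real" where
  "K N \<equiv> V (\<lambda>_. 1 / real N) N"

text \<open>Squared norm of the ergodic average of \<open>F \<otimes> F\<close> under
  \<open>T \<times> T\<close>. Weak mixing will follow from its convergence to 0.\<close>

definition q :: "nat \<Rightarrow> real" where "q N = (\<integral>z. (K N 0 0 z)\<^sup>2 \<partial>MM)"

lemma q_nonneg: "q N \<ge> 0" unfolding q_def by simp

lemma K_bound: "N > 0 \<Longrightarrow> \<bar>K N a b z\<bar> \<le> 1"
  by (rule V_bound) auto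

lemma sum_shift_diff:
  fixes g :: "nat \<Rightarrow> real"
  assumes "\<And>i. \<bar>g i\<bar> \<le> 1"
  shows "\<bar>(\<Sum>s<m. g (s + k)) - (\<Sum>s<m. g s)\<bar> \<le> 2 * real k"
proof (induction k)
  case (Suc k)
  have "(\<Sum>s<m. g (s + Suc k)) = (\<Sum>s<m. g (s + k)) + g (m + k) - g k"
    using sum.lessThan_Suc_shift[of "\<lambda>s. g (s + k)" m] by (simp add: algebra_simps)
  then show ?case using Suc assms[of "m + k"] assms[of k] by (simp add: abs_le_iff)
qed simp

text \<open>Averaging a convex combination of shifts of \<open>F \<otimes> F\<close> over long times gives nearly the same
  function as averaging \<open>F \<otimes> F\<close> itself, and averaging does not increase the norm.\<close>

lemma q_le_convex:
  assumes w: "\<And>u. w u \<ge> 0" "(\<Sum>u<R. w u) = 1" and "m > 0"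
  shows "q m \<le> (\<integral>z. (V w R 0 0 z)\<^sup>2 \<partial>MM) + 4 * real R / real m"
proof -
  \<comment> \<open>\<open>W\<close> links the two sides: it is uniformly close to
    \<open>K m 0 0\<close>, and by stationarity its norm does not exceed that of
    \<open>V w R 0 0\<close>.\<close>
  define W where "W z = (\<Sum>s<m. V w R s s z) / real m" for z
  have W_meas [measurable]: "W \<in> borel_measurable MM" unfolding W_def by measurable
  have W_bound: "\<bar>W z\<bar> \<le> 1" for z
  proof -
    have "\<bar>\<Sum>s<m. V w R s s z\<bar> \<le> (\<Sum>s<m. \<bar>V w R s s z\<bar>)" by (rule sum_abs)
    also have "\<dots> \<le> (\<Sum>s<m. 1)" by (rule sum_mono) (rule V_bound[OF w])
    finally show ?thesis using \<open>m > 0\<close> by (simp add: W_def)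
  qed
  have diff: "\<bar>W z - K m 0 0 z\<bar> \<le> 2 * real R / real m" for z
  proof -
    \<comment> \<open>After exchanging the sums, each \<open>u\<close> contributes a window of
      length \<open>m\<close> displaced by \<open>u < R\<close>, which differs from the undisplaced
      one in boundary terms only.\<close>
    have "W z = (\<Sum>u<R. w u * (\<Sum>s<m. G (s + u) (s + u) z)) / real m"
      unfolding W_def V_def by (subst sum.swap) (simp add: sum_distrib_left add.commute)
    moreover have "K m 0 0 z = (\<Sum>u<R. w u * (\<Sum>s<m. G s s z)) / real m"
      using w(2) by (simp add: V_def sum_divide_distrib flip: sum_distrib_right)
    ultimately have "\<bar>W z - K m 0 0 z\<bar>
        = \<bar>\<Sum>u<R. w u * ((\<Sum>s<m. G (s + u) (s + u) z) - (\<Sum>s<m. G s s z))\<bar> / real m"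
      by (simp add: diff_divide_distrib[symmetric] sum_subtractf right_diff_distrib)
    also have "\<bar>\<Sum>u<R. w u * ((\<Sum>s<m. G (s + u) (s + u) z) - (\<Sum>s<m. G s s z))\<bar>
        \<le> (\<Sum>u<R. \<bar>w u * ((\<Sum>s<m. G (s + u) (s + u) z) - (\<Sum>s<m. G s s z))\<bar>)"
      by (rule sum_abs)
    also have "\<dots> \<le> (\<Sum>u<R. w u * (2 * real R))"
    proof (rule sum_mono)
      fix u assume "u \<in> {..<R}"
      have "\<bar>(\<Sum>s<m. G (s + u) (s + u) z) - (\<Sum>s<m. G s s z)\<bar> \<le> 2 * real u"
        using sum_shift_diff[of "\<lambda>s. G s s z" u m] G_bound by simp
      also have "\<dots> \<le> 2 * real R" using \<open>u \<in> {..<R}\<close> by simp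
      finally show "\<bar>w u * ((\<Sum>s<m. G (s + u) (s + u) z) - (\<Sum>s<m. G s s z))\<bar> \<le> w u * (2 * real R)"
        using w(1)[of u] by (simp add: abs_mult mult_left_mono)
    qed
    also have "\<dots> = 2 * real R" using w(2) by (simp flip: sum_distrib_right)
    finally show ?thesis using \<open>m > 0\<close> by (simp add: divide_right_mono)
  qed
  have sq: "(K m 0 0 z)\<^sup>2 \<le> (\<Sum>s<m. (V w R s s z)\<^sup>2) / real m + 4 * real R / real m" for z
  proof -
    have "(K m 0 0 z)\<^sup>2 - (W z)\<^sup>2 = (K m 0 0 z - W z) * (K m 0 0 z + W z)"
      by (simp add: power2_eq_square algebra_simps)
    also have "\<dots> \<le> \<bar>K m 0 0 z - W z\<bar> * \<bar>K m 0 0 z + W z\<bar>"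
      by (metis abs_ge_self abs_mult)
    also have "\<dots> \<le> (2 * real R / real m) * 2"
      using diff[of z] W_bound[of z] K_bound[OF \<open>m > 0\<close>, of 0 0 z]
      by (intro mult_mono) auto
    finally have 1: "(K m 0 0 z)\<^sup>2 \<le> (W z)\<^sup>2 + 4 * real R / real m" by simp
    \<comment> \<open>Cauchy-Schwarz for the mean over \<open>s\<close>.\<close>
    have "(\<Sum>s<m. V w R s s z)\<^sup>2 \<le> real m * (\<Sum>s<m. (V w R s s z)\<^sup>2)"
      using sum_squared_le_sum_of_squares[of "\<lambda>s. V w R s s z" "{..<m}"] by (simp add: mult.commute)
    then have "(W z)\<^sup>2 \<le> (\<Sum>s<m. (V w R s s z)\<^sup>2) / real m"
      using \<open>m > 0\<close> by (simp add: W_def power_divide power2_eq_square[of "real m"] field_simps)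
    then show ?thesis using 1 by simp
  qed
  define D where "D = (\<integral>z. (V w R 0 0 z)\<^sup>2 \<partial>MM)"
  have shift: "(\<integral>z. (V w R s s z)\<^sup>2 \<partial>MM) = D" for s
    unfolding D_def using integral_VV_shift[of w R 0 s 0 s w R 0 0] by (simp add: power2_eq_square)
  have "q m \<le> (\<integral>z. (\<Sum>s<m. (V w R s s z)\<^sup>2) / real m + 4 * real R / real m \<partial>MM)"
    unfolding q_def by (rule integral_mono) (use sq in auto)
  also have "\<dots> = (\<Sum>s<m. \<integral>z. (V w R s s z)\<^sup>2 \<partial>MM) / real m + 4 * real R / real m"
    by (simp add: P.P.prob_space)
  also have "\<dots> = D + 4 * real R / real m"
    using \<open>m > 0\<close> by (simp add: shift)
  finally show ?thesis unfolding D_def .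
qed


text \<open>The index 0 is excluded because \<open>q 0 = 0\<close>, an empty sum, would trivialise
  the infimum.\<close>

definition rho :: real where "rho = Inf (q ` {0<..})"

lemma rho_le_q: "N > 0 \<Longrightarrow> rho \<le> q N"
  unfolding rho_def by (intro cINF_lower bdd_belowI[where m = 0]) (auto simp: q_nonneg)

text \<open>Letting \<open>m\<close> tend to infinity in \<open>q_le_convex\<close> removes the
  error term, so uniform averages are asymptotically optimal among all convex combinations.\<close>

lemma rho_le_convex:
  assumes w: "\<And>u. w u \<ge> 0" "(\<Sum>u<R. w u) = 1"
  shows "rho \<le> (\<integral>z. (V w R 0 0 z)\<^sup>2 \<partial>MM)"
proof -
  have "(\<lambda>m. (\<integral>z. (V w R 0 0 z)\<^sup>2 \<partial>MM) + 4 * real R / real m) \<longlonglongrightarrow> (\<integral>z. (V w R 0 0 z)\<^sup>2 \<partial>MM) + 0"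
    by (intro tendsto_add tendsto_const) real_asymp
  moreover have "rho \<le> (\<integral>z. (V w R 0 0 z)\<^sup>2 \<partial>MM) + 4 * real R / real m" if "m \<ge> 1" for m
    using q_le_convex[OF w, of m] rho_le_q[of m] that by simp
  ultimately show ?thesis by (intro LIMSEQ_le_const) auto
qed

text \<open>Parallelogram argument: the midpoint of \<open>K N 0 0\<close> and
  \<open>K N t t\<close> is a convex combination, so its squared norm is at least
  \<open>rho\<close>. Expanding the square leaves a bound for the correlation that is uniform in
  \<open>t\<close>.\<close>

lemma rho_le_corr:
  assumes "N > 0"
  shows "2 * rho - q N \<le> (\<integral>z. K N t t z * K N 0 0 z \<partial>MM)"
proof -
  \<comment> \<open>The weights of the midpoint over the single range \<open>u < N + t\<close>. The
    windows \<open>u < N\<close> and \<open>t \<le> u\<close> may overlap, hence two separate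
    contributions.\<close>
  define w where "w u = (if u < N then 1 / (2 * real N) else 0) + (if t \<le> u then 1 / (2 * real N) else 0)" for u
  have 1: "(\<Sum>u<N + k. (if u < N then g u else 0)) = (\<Sum>u<N. g u)" for g :: "nat \<Rightarrow> real" and k
    by (induction k) auto
  have 2: "(\<Sum>u<k + t. (if t \<le> u then g u else 0)) = (\<Sum>u<k. g (u + t))" for g :: "nat \<Rightarrow> real" and k
    by (induction k) auto
  have eq: "(\<Sum>u<N + t. w u * g u) = (\<Sum>u<N. 1 / (2 * real N) * g u) + (\<Sum>u<N. 1 / (2 * real N) * g (u + t))" for g
  proof -
    have "(\<Sum>u<N + t. w u * g u) = (\<Sum>u<N + t. (if u < N then 1 / (2 * real N) * g u else 0))
        + (\<Sum>u<N + t. (if t \<le> u then 1 / (2 * real N) * g u else 0))"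
      unfolding sum.distrib[symmetric] by (rule sum.cong) (auto simp: w_def algebra_simps)
    then show ?thesis unfolding 1 2 by simp
  qed
  have V: "V w (N + t) 0 0 z = (K N 0 0 z + K N t t z) / 2" for z
    unfolding V_def using eq[of "\<lambda>u. G u u z"]
    by (simp add: sum_distrib_left[symmetric] sum_divide_distrib[symmetric] field_simps)
  have sq: "((K N 0 0 z + K N t t z) / 2)\<^sup>2 = ((K N 0 0 z)\<^sup>2 + 2 * (K N t t z * K N 0 0 z) + (K N t t z)\<^sup>2) / 4" for z
    by (simp add: power2_eq_square field_simps)
  have "rho \<le> (\<integral>z. (V w (N + t) 0 0 z)\<^sup>2 \<partial>MM)"
  proof (rule rho_le_convex)
    show "(\<Sum>u<N + t. w u) = 1" using eq[of "\<lambda>_. 1"] assms by simp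
  qed (simp add: w_def)
  also have "\<dots> = (q N + 2 * (\<integral>z. K N t t z * K N 0 0 z \<partial>MM) + (\<integral>z. (K N t t z)\<^sup>2 \<partial>MM)) / 4"
    unfolding V sq q_def by simp
  also have "(\<integral>z. (K N t t z)\<^sup>2 \<partial>MM) = q N"
    unfolding q_def power2_eq_square using integral_VV_shift[of _ N 0 t 0 t _ N 0 0] by simp
  finally show ?thesis by simp
qed

text \<open>The power \<open>\<tau> n\<close> acts on both coordinates, so the weak limit is
  \<open>(I + T)/2 \<otimes> (I + T)/2\<close>, which contains the mixed terms
  \<open>T \<otimes> I\<close> and \<open>I \<otimes> T\<close>. The uniform bound of
  \<open>rho_le_corr\<close> survives the limit and forces the mixed correlation \<open>d\<close>
  close to \<open>q N\<close> once \<open>q N\<close> is close to \<open>rho\<close>.\<close>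

lemma near_invariant:
  assumes "N > 0"
    and lim: "\<And>u v. (\<lambda>n. psi (u + \<tau> n) v) \<longlonglongrightarrow> (psi u v + psi (u + 1) v) / 2"
  shows "(\<integral>z. (K N 1 0 z - K N 0 0 z)\<^sup>2 \<partial>MM) \<le> 8 * (q N - rho)"
proof -
  define d where "d = (\<integral>z. K N 1 0 z * K N 0 0 z \<partial>MM)"
  define e where "e = (\<integral>z. K N 1 1 z * K N 0 0 z \<partial>MM)"
  define c where "c t = (\<integral>z. K N t t z * K N 0 0 z \<partial>MM)" for t
  define w where "w = 1 / real N * (1 / real N)"
  have "(\<lambda>n. \<Sum>u<N. \<Sum>v<N. w * (psi (u + \<tau> n) v * psi (u + \<tau> n) v))
     \<longlonglongrightarrow> (\<Sum>u<N. \<Sum>v<N. w * ((psi u v + psi (u + 1) v) / 2 * ((psi u v + psi (u + 1) v) / 2)))"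
    by (intro tendsto_intros lim)
  also have "(\<lambda>n. \<Sum>u<N. \<Sum>v<N. w * (psi (u + \<tau> n) v * psi (u + \<tau> n) v)) = (\<lambda>n. c (\<tau> n))"
    unfolding c_def integral_VV w_def by simp
  \<comment> \<open>Of the four terms of the expanded square, \<open>I \<otimes> I\<close> gives
    \<open>q N\<close>, \<open>T \<otimes> T\<close> gives \<open>e\<close>, and the two mixed ones
    agree by symmetry of the coordinates and give \<open>d\<close> each.\<close>
  also have "(\<Sum>u<N. \<Sum>v<N. w * ((psi u v + psi (u + 1) v) / 2 * ((psi u v + psi (u + 1) v) / 2)))
      = (q N + 2 * d + e) / 4"
    unfolding q_def d_def e_def power2_eq_square integral_VV w_def[symmetric]
    by (simp add: sum_distrib_left sum_divide_distrib field_simps flip: sum.distrib)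
  finally have "2 * rho - q N \<le> (q N + 2 * d + e) / 4"
    using rho_le_corr[OF assms(1)] by (intro LIMSEQ_le_const) (auto simp: c_def)
  moreover have "e \<le> q N"
  proof -
    have "e \<le> (\<integral>z. ((K N 1 1 z)\<^sup>2 + (K N 0 0 z)\<^sup>2) / 2 \<partial>MM)"
      unfolding e_def
    proof (rule integral_mono)
      show "K N 1 1 z * K N 0 0 z \<le> ((K N 1 1 z)\<^sup>2 + (K N 0 0 z)\<^sup>2) / 2" for z
        using sum_squares_bound[of "K N 1 1 z" "K N 0 0 z"] by simp
    qed simp_all
    also have "\<dots> = ((\<integral>z. (K N 1 1 z)\<^sup>2 \<partial>MM) + q N) / 2" by (simp add: q_def)
    also have "(\<integral>z. (K N 1 1 z)\<^sup>2 \<partial>MM) = q N"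
      unfolding q_def power2_eq_square using integral_VV_shift[of _ N 0 1 0 1 _ N 0 0] by simp
    finally show ?thesis by simp
  qed
  ultimately have "d \<ge> 4 * rho - 3 * q N" by simp
  have "(\<integral>z. (K N 1 0 z - K N 0 0 z)\<^sup>2 \<partial>MM)
      = (\<integral>z. (K N 1 0 z)\<^sup>2 - 2 * (K N 1 0 z * K N 0 0 z) + (K N 0 0 z)\<^sup>2 \<partial>MM)"
    by (simp add: power2_eq_square algebra_simps)
  also have "\<dots> = (\<integral>z. (K N 1 0 z)\<^sup>2 \<partial>MM) - 2 * d + q N"
    by (simp add: d_def q_def)
  also have "(\<integral>z. (K N 1 0 z)\<^sup>2 \<partial>MM) = q N"
    unfolding q_def power2_eq_square using integral_VV_shift[of _ N 0 1 0 0 _ N 0 0] by simp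
  finally show ?thesis using \<open>d \<ge> 4 * rho - 3 * q N\<close> by simp
qed

lemma integrable_Vdiff2 [simp]: "integrable MM (\<lambda>z. (V w R a b z - V w' R' a' b' z)\<^sup>2)"
proof -
  have "(\<lambda>z. (V w R a b z - V w' R' a' b' z)\<^sup>2) =
     (\<lambda>z. (V w R a b z)\<^sup>2 - 2 * (V w R a b z * V w' R' a' b' z) + (V w' R' a' b' z)\<^sup>2)"
    by (simp add: power2_eq_square algebra_simps fun_eq_iff)
  then show ?thesis by simp
qed

text \<open>Telescope through \<open>s\<close> single steps in the first coordinate, all of the same
  norm; Cauchy-Schwarz supplies the second factor \<open>s\<close>.\<close>

lemma near_invariant_pow:
  assumes "N > 0"
    and lim: "\<And>u v. (\<lambda>n. psi (u + \<tau> n) v) \<longlonglongrightarrow> (psi u v + psi (u + 1) v) / 2"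
  shows "(\<integral>z. (K N s 0 z - K N 0 0 z)\<^sup>2 \<partial>MM) \<le> (real s)\<^sup>2 * (8 * (q N - rho))"
proof -
  define D where "D = (\<integral>z. (K N 1 0 z - K N 0 0 z)\<^sup>2 \<partial>MM)"
  have shift: "(\<integral>z. (K N (Suc i) 0 z - K N i 0 z)\<^sup>2 \<partial>MM) = D" for i
  proof -
    have ex: "(K N a 0 z - K N b 0 z)\<^sup>2 = K N a 0 z * K N a 0 z - 2 * (K N a 0 z * K N b 0 z) + K N b 0 z * K N b 0 z" for a b z
      by (simp add: power2_eq_square algebra_simps)
    show ?thesis unfolding D_def ex
      using integral_VV_shift[of _ N 1 i 0 0 _ N 1 0] integral_VV_shift[of _ N 1 i 0 0 _ N 0 0]
        integral_VV_shift[of _ N 0 i 0 0 _ N 0 0] by simp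
  qed
  have "(K N s 0 z - K N 0 0 z)\<^sup>2 \<le> real s * (\<Sum>i<s. (K N (Suc i) 0 z - K N i 0 z)\<^sup>2)" for z
    using sum_squared_le_sum_of_squares[of "\<lambda>i. K N (Suc i) 0 z - K N i 0 z" "{..<s}"]
    by (simp add: sum_lessThan_telescope[of "\<lambda>i. K N i 0 z"] mult.commute)
  then have "(\<integral>z. (K N s 0 z - K N 0 0 z)\<^sup>2 \<partial>MM) \<le> (\<integral>z. real s * (\<Sum>i<s. (K N (Suc i) 0 z - K N i 0 z)\<^sup>2) \<partial>MM)"
    by (intro integral_mono) auto
  also have "\<dots> = (real s)\<^sup>2 * D"
    by (simp add: shift power2_eq_square[of "real s"])
  also have "\<dots> \<le> (real s)\<^sup>2 * (8 * (q N - rho))"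
    unfolding D_def by (intro mult_left_mono near_invariant[OF assms(1) lim]) auto
  finally show ?thesis .
qed

text \<open>The first term is the price of replacing \<open>K N 0 0\<close> by its average over
  \<open>S\<close> steps of the first coordinate alone. That average contains the ergodic averages
  of \<open>F\<close>, which give the second term.\<close>

lemma q_le_ergodic:
  assumes "N > 0" "S > 0"
    and lim: "\<And>u v. (\<lambda>n. psi (u + \<tau> n) v) \<longlonglongrightarrow> (psi u v + psi (u + 1) v) / 2"
  shows "q N \<le> 16 * (real S)\<^sup>2 * (q N - rho)
     + 2 * (\<integral>x. \<bar>(\<Sum>s<S. F ((T ^^ s) x)) / real S\<bar> \<partial>M)"
proof -
  define a where "a x = (\<Sum>s<S. F ((T ^^ s) x)) / real S" for x
  have [measurable]: "a \<in> borel_measurable M" unfolding a_def by measurable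
  have a_bound: "\<bar>a x\<bar> \<le> 1" for x
  proof -
    have "\<bar>\<Sum>s<S. F ((T ^^ s) x)\<bar> \<le> (\<Sum>s<S. \<bar>F ((T ^^ s) x)\<bar>)" by (rule sum_abs)
    also have "\<dots> \<le> (\<Sum>s<S. 1)" by (rule sum_mono) (rule F_bound)
    finally show ?thesis using assms(2) by (simp add: a_def)
  qed
  define L where "L z = (\<Sum>s<S. K N s 0 z) / real S" for z
  have [measurable]: "L \<in> borel_measurable MM" unfolding L_def by measurable
  define B where "B z = (\<Sum>u<N. \<bar>a ((T ^^ u) (fst z))\<bar>) / real N" for z :: "'a \<times> 'a"
  have [measurable]: "B \<in> borel_measurable MM" unfolding B_def by measurable
  have L_eq: "L z = (\<Sum>u<N. a ((T ^^ u) (fst z)) * F ((T ^^ u) (snd z))) / real N" for z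
  proof -
    have G: "G (u + s) (u + 0) z = F ((T ^^ s) ((T ^^ u) (fst z))) * F ((T ^^ u) (snd z))" for u s
      by (simp add: G_def add.commute[of u s] funpow_add)
    have "L z = (\<Sum>u<N. \<Sum>s<S. 1 / real N * G (u + s) (u + 0) z) / real S"
      unfolding L_def V_def by (subst sum.swap) simp
    also have "\<dots> = (\<Sum>u<N. a ((T ^^ u) (fst z)) * F ((T ^^ u) (snd z))) / real N"
      unfolding G a_def by (simp add: sum_divide_distrib sum_distrib_left sum_distrib_right mult_ac)
    finally show ?thesis .
  qed
  have LB: "\<bar>L z\<bar> \<le> B z" for z
  proof -
    have "\<bar>\<Sum>u<N. a ((T ^^ u) (fst z)) * F ((T ^^ u) (snd z))\<bar> \<le> (\<Sum>u<N. \<bar>a ((T ^^ u) (fst z)) * F ((T ^^ u) (snd z))\<bar>)"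
      by (rule sum_abs)
    also have "\<dots> \<le> (\<Sum>u<N. \<bar>a ((T ^^ u) (fst z))\<bar>)"
      by (intro sum_mono) (simp add: abs_mult mult_left_le F_bound)
    finally show ?thesis unfolding L_eq B_def by (simp add: divide_right_mono)
  qed
  have B1: "B z \<le> 1" for z
  proof -
    have "(\<Sum>u<N. \<bar>a ((T ^^ u) (fst z))\<bar>) \<le> (\<Sum>u<N. 1)" by (rule sum_mono) (rule a_bound)
    then show ?thesis using assms(1) by (simp add: B_def)
  qed
  have B0: "B z \<ge> 0" for z unfolding B_def by (simp add: sum_nonneg)
  have [simp]: "integrable MM B" using B0 B1 by (intro integrable_bounded[where c = 1]) auto
  \<comment> \<open>All values are at most 1, so the square is dominated by the first power, and an
    L1 bound on the ergodic averages suffices.\<close>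
  have L2: "(L z)\<^sup>2 \<le> B z" for z
  proof -
    have "(L z)\<^sup>2 \<le> (B z)\<^sup>2" using LB[of z] B0[of z] by (simp add: abs_le_square_iff[symmetric])
    also have "\<dots> \<le> B z" using B0[of z] B1[of z] by (simp add: power2_eq_square mult_left_le)
    finally show ?thesis .
  qed
  have intB: "(\<integral>z. B z \<partial>MM) = (\<integral>x. \<bar>a x\<bar> \<partial>M)"
  proof -
    have *: "(\<integral>z. \<bar>a ((T ^^ u) (fst z))\<bar> \<partial>MM) = (\<integral>x. \<bar>a x\<bar> \<partial>M)" for u
      using integral_pair_mult[OF prob_space_axioms, of "\<lambda>x. \<bar>a ((T ^^ u) x)\<bar>" "\<lambda>_. 1"]
        integral_T_pow[of "\<lambda>x. \<bar>a x\<bar>" u] a_bound by (simp add: prob_space)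
    have "(\<integral>z. B z \<partial>MM) = (\<Sum>u<N. \<integral>z. \<bar>a ((T ^^ u) (fst z))\<bar> \<partial>MM) / real N"
      unfolding B_def
      by (subst integral_divide_zero, subst Bochner_Integration.integral_sum)
         (auto intro!: integrable_bounded[where c = 1] simp: a_bound)
    then show ?thesis using * assms(1) by simp
  qed
  have dl: "(K N 0 0 z - L z)\<^sup>2 \<le> (\<Sum>s<S. (K N s 0 z - K N 0 0 z)\<^sup>2) / real S" for z
  proof -
    have "L z - K N 0 0 z = (\<Sum>s<S. K N s 0 z - K N 0 0 z) / real S"
      using assms(2) by (simp add: L_def sum_subtractf diff_divide_distrib)
    then have "(K N 0 0 z - L z)\<^sup>2 = (\<Sum>s<S. K N s 0 z - K N 0 0 z)\<^sup>2 / (real S)\<^sup>2"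
      by (simp add: power2_commute power_divide)
    also have "\<dots> \<le> (real S * (\<Sum>s<S. (K N s 0 z - K N 0 0 z)\<^sup>2)) / (real S)\<^sup>2"
      using sum_squared_le_sum_of_squares[of "\<lambda>s. K N s 0 z - K N 0 0 z" "{..<S}"]
      by (intro divide_right_mono) (auto simp: mult.commute)
    finally show ?thesis using assms(2) by (simp add: power2_eq_square)
  qed
  have "(K N 0 0 z)\<^sup>2 \<le> 2 * ((\<Sum>s<S. (K N s 0 z - K N 0 0 z)\<^sup>2) / real S) + 2 * B z" for z
  proof -
    \<comment> \<open>The right side minus the left side is the square of
      \<open>K N 0 0 z - 2 * L z\<close>.\<close>
    have "(K N 0 0 z)\<^sup>2 \<le> 2 * (K N 0 0 z - L z)\<^sup>2 + 2 * (L z)\<^sup>2"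
      using sum_squares_ge_zero[of "K N 0 0 z - 2 * L z" 0]
      by (simp add: power2_eq_square algebra_simps)
    then show ?thesis using dl[of z] L2[of z] by linarith
  qed
  then have "q N \<le> (\<integral>z. 2 * ((\<Sum>s<S. (K N s 0 z - K N 0 0 z)\<^sup>2) / real S) + 2 * B z \<partial>MM)"
    unfolding q_def by (intro integral_mono) auto
  also have "\<dots> = 2 * ((\<Sum>s<S. (\<integral>z. (K N s 0 z - K N 0 0 z)\<^sup>2 \<partial>MM)) / real S) + 2 * (\<integral>x. \<bar>a x\<bar> \<partial>M)"
    by (simp add: intB)
  finally have *: "q N \<le> 2 * ((\<Sum>s<S. (\<integral>z. (K N s 0 z - K N 0 0 z)\<^sup>2 \<partial>MM)) / real S) + 2 * (\<integral>x. \<bar>a x\<bar> \<partial>M)" .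
  have "(\<Sum>s<S. (\<integral>z. (K N s 0 z - K N 0 0 z)\<^sup>2 \<partial>MM)) \<le> (\<Sum>s<S. (real S)\<^sup>2 * (8 * (q N - rho)))"
  proof (rule sum_mono)
    fix s assume "s \<in> {..<S}"
    have "(\<integral>z. (K N s 0 z - K N 0 0 z)\<^sup>2 \<partial>MM) \<le> (real s)\<^sup>2 * (8 * (q N - rho))"
      by (rule near_invariant_pow[OF assms(1) lim])
    also have "\<dots> \<le> (real S)\<^sup>2 * (8 * (q N - rho))"
      using \<open>s \<in> {..<S}\<close> rho_le_q[OF assms(1)] by (intro mult_right_mono power_mono) auto
    finally show "(\<integral>z. (K N s 0 z - K N 0 0 z)\<^sup>2 \<partial>MM) \<le> (real S)\<^sup>2 * (8 * (q N - rho))" .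
  qed
  then have "(\<Sum>s<S. (\<integral>z. (K N s 0 z - K N 0 0 z)\<^sup>2 \<partial>MM)) / real S \<le> (real S)\<^sup>2 * (8 * (q N - rho))"
    using assms(2) by (simp add: pos_divide_le_eq mult.commute)
  with * have "q N \<le> 16 * (real S)\<^sup>2 * (q N - rho) + 2 * (\<integral>x. \<bar>a x\<bar> \<partial>M)" by linarith
  then show ?thesis unfolding a_def .
qed

text \<open>The order of choices matters: first \<open>S\<close> from the ergodic averages, then
  \<open>N\<close> with \<open>q N - rho\<close> small relative to
  \<open>1 / (real S)\<^sup>2\<close>. This gives \<open>rho \<le> 0\<close>, and
  \<open>q_le_convex\<close> with uniform weights upgrades the infimum to a limit.\<close>

lemma q_tendsto_0:
  assumes lim: "\<And>u v. (\<lambda>n. psi (u + \<tau> n) v) \<longlonglongrightarrow> (psi u v + psi (u + 1) v) / 2"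
    and erg: "\<And>e. e > 0 \<Longrightarrow> \<exists>S>0. (\<integral>x. \<bar>(\<Sum>s<S. F ((T ^^ s) x)) / real S\<bar> \<partial>M) < e"
  shows "q \<longlonglongrightarrow> 0"
proof -
  have ne: "q ` {0<..} \<noteq> {}" and bb: "bdd_below (q ` {0<..})"
    by (auto intro!: bdd_belowI[where m = 0] simp: q_nonneg)
  have small: "\<exists>N>0. q N < rho + e" if "e > 0" for e
    using cINF_less_iff[OF _ bb, of "rho + e"] that by (auto simp: rho_def)
  have "rho \<le> 0"
  proof (rule field_le_epsilon)
    fix e :: real assume "e > 0"
    obtain S where S: "S > 0" "(\<integral>x. \<bar>(\<Sum>s<S. F ((T ^^ s) x)) / real S\<bar> \<partial>M) < e / 4"
      using erg[of "e / 4"] \<open>e > 0\<close> by auto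
    \<comment> \<open>The constant 32 makes the first term of \<open>q_le_ergodic\<close> at most
      \<open>e / 2\<close>; the second is below \<open>2 * (e / 4)\<close>.\<close>
    obtain N where N: "N > 0" "q N < rho + e / (32 * (real S)\<^sup>2)"
      using small[of "e / (32 * (real S)\<^sup>2)"] \<open>e > 0\<close> S by auto
    have "16 * (real S)\<^sup>2 * (q N - rho) \<le> 16 * (real S)\<^sup>2 * (e / (32 * (real S)\<^sup>2))"
      using N by (intro mult_left_mono) auto
    also have "\<dots> = e / 2" using S by simp
    finally have "q N \<le> e / 2 + 2 * (e / 4)"
      using q_le_ergodic[OF N(1) S(1) lim] S(2) by linarith
    then show "rho \<le> 0 + e" using rho_le_q[OF N(1)] by simp
  qed
  show ?thesis
  proof (rule LIMSEQ_I)
    fix e :: real assume "e > 0"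
    obtain N where N: "N > 0" "q N < e / 2" using small[of "e / 2"] \<open>rho \<le> 0\<close> \<open>e > 0\<close> by force
    have le: "q m \<le> q N + 4 * real N / real m" if "m > 0" for m
      using q_le_convex[of "\<lambda>_. 1 / real N" N m] N that by (simp add: q_def)
    have "(\<lambda>m. 4 * real N / real m) \<longlonglongrightarrow> 0" by real_asymp
    then have "eventually (\<lambda>m. 4 * real N / real m < e / 2) sequentially"
      using \<open>e > 0\<close> by (intro order_tendstoD) auto
    then have "eventually (\<lambda>m. norm (q m - 0) < e) sequentially"
      using eventually_gt_at_top[of 0]
    proof eventually_elim
      case (elim m)
      then show ?case using le[OF elim(2)] N(2) q_nonneg[of m] by simp
    qed
    then show "\<exists>no. \<forall>n\<ge>no. norm (q n - 0) < e" by (simp add: eventually_sequentially)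
  qed
qed

end

text \<open>A linearised Cauchy-Schwarz inequality: with \<open>d\<close> fixed, smallness of mean
  squares gives smallness of mean absolute values.\<close>

lemma abs_le_add_square_div:
  fixes d x :: real
  assumes "d > 0"
  shows "\<bar>x\<bar> \<le> d + x\<^sup>2 / d"
proof -
  have "2 * (d * \<bar>x\<bar>) \<le> d\<^sup>2 + x\<^sup>2"
    using sum_squares_bound[of d "\<bar>x\<bar>"] by (simp add: mult.assoc)
  moreover have "d * \<bar>x\<bar> \<ge> 0" using assms by simp
  ultimately have "d * \<bar>x\<bar> \<le> d\<^sup>2 + x\<^sup>2" by linarith
  then show ?thesis using assms by (simp add: field_simps power2_eq_square)
qed

section \<open>Weak mixing from a weak limit of powers and small ergodic averages\<close>

theorem weakly_mixing_criterion:
  fixes \<tau> h :: "nat \<Rightarrow> nat"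
  assumes "prob_space M" "measure_preserving_map M T"
    and lim: "\<And>A B. A \<in> sets M \<Longrightarrow> B \<in> sets M \<Longrightarrow>
      (\<lambda>n. measure M ((T ^^ \<tau> n) -` A \<inter> space M \<inter> B))
        \<longlonglongrightarrow> (measure M (A \<inter> B) + measure M (T -` A \<inter> space M \<inter> B)) / 2"
    and erg: "\<And>A e. A \<in> sets M \<Longrightarrow> e > 0 \<Longrightarrow>
      \<exists>S>0. (\<integral>x. \<bar>(\<Sum>t<S. indicator A ((T ^^ t) x)) / real S - measure M A\<bar> \<partial>M) < e"
  shows "weakly_mixing M T"
proof -
  interpret mpt M T using assms(1,2) by (simp add: mpt_def mpt_axioms_def)
  have "(\<lambda>N. (\<Sum>n<N. \<bar>prob ((T ^^ n) -` A \<inter> space M \<inter> B) - prob A * prob B\<bar>) / real N) \<longlonglongrightarrow> 0"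
    if A [measurable]: "A \<in> sets M" and B [measurable]: "B \<in> sets M" for A B
  proof -
    interpret mpt_set M T A by standard (rule A)
    have lim': "(\<lambda>n. psi (u + \<tau> n) v) \<longlonglongrightarrow> (psi u v + psi (u + 1) v) / 2" for u v
    proof -
      \<comment> \<open>The exponents \<open>u\<close> and \<open>v\<close> are absorbed into
        preimages of \<open>A\<close>, to which the hypothesis applies; subtracting the constant
        square of \<open>prob A\<close> commutes with taking the mean.\<close>
      define A' B' where "A' = (T ^^ u) -` A \<inter> space M" and "B' = (T ^^ v) -` A \<inter> space M"
      have "A' \<in> sets M" "B' \<in> sets M" unfolding A'_def B'_def by measurable
      from lim[OF this] have
        "(\<lambda>n. prob ((T ^^ \<tau> n) -` A' \<inter> space M \<inter> B') - (prob A)\<^sup>2) \<longlonglongrightarrow>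
          (prob (A' \<inter> B') + prob (T -` A' \<inter> space M \<inter> B')) / 2 - (prob A)\<^sup>2"
        by (intro tendsto_intros)
      moreover have pre: "(T ^^ t) -` A' \<inter> space M = (T ^^ (u + t)) -` A \<inter> space M" for t
        using measurable_space[OF T_pow_measurable] by (auto simp: A'_def funpow_add)
      moreover have "T -` A' \<inter> space M = (T ^^ (u + 1)) -` A \<inter> space M" using pre[of 1] by simp
      ultimately have "(\<lambda>n. psi (u + \<tau> n) v) \<longlonglongrightarrow>
          (prob ((T ^^ u) -` A \<inter> space M \<inter> B') + prob ((T ^^ (u + 1)) -` A \<inter> space M \<inter> B')) / 2 - (prob A)\<^sup>2"
        unfolding psi_eq by (simp only: A'_def B'_def)
      then show ?thesis
        unfolding psi_eq B'_def by (simp add: add_divide_distrib diff_divide_distrib)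
    qed
    have erg': "\<exists>S>0. (\<integral>x. \<bar>(\<Sum>s<S. F ((T ^^ s) x)) / real S\<bar> \<partial>M) < e" if e: "e > 0" for e
    proof -
      obtain S where S: "S > 0"
        "(\<integral>x. \<bar>(\<Sum>t<S. indicator A ((T ^^ t) x)) / real S - measure M A\<bar> \<partial>M) < e"
        using erg[OF A e] by auto
      have eq: "(\<Sum>s<S. F ((T ^^ s) x)) / real S = (\<Sum>t<S. indicator A ((T ^^ t) x)) / real S - measure M A" for x
        using S(1) by (simp add: F_def sum_subtractf diff_divide_distrib)
      show ?thesis using S by (intro exI[of _ S]) (simp only: eq)
    qed
    have q0: "q \<longlonglongrightarrow> 0" by (rule q_tendsto_0[OF lim' erg'])
    define \<phi> where "\<phi> n = prob ((T ^^ n) -` A \<inter> space M \<inter> B) - prob A * prob B" for n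
    have \<phi>_eq: "\<phi> n = (\<integral>x. F ((T ^^ n) x) * indicator B x \<partial>M)" for n
    proof -
      define A' where "A' = (T ^^ n) -` A \<inter> space M"
      have [measurable]: "A' \<in> sets M" unfolding A'_def by measurable
      have "(\<integral>x. F ((T ^^ n) x) * indicator B x \<partial>M) = (\<integral>x. indicator (A' \<inter> B) x - prob A * indicator B x \<partial>M)"
        by (rule Bochner_Integration.integral_cong) (auto simp: F_def A'_def indicator_def)
      also have "\<dots> = prob (A' \<inter> B) - prob A * prob B"
        by (simp add: emeasure_eq_measure)
      finally show ?thesis by (simp add: \<phi>_def A'_def)
    qed
    have \<phi>2: "(\<Sum>n<N. (\<phi> n)\<^sup>2) / real N \<le> e + q N / e" if "N > 0" "e > 0" for N e
    proof -
      \<comment> \<open>The square of an integral is an integral over the product space. This turns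
        the mean of the squares into a pairing of \<open>K N 0 0\<close> with the indicator of
        \<open>B \<times> B\<close>.\<close>
      have sq: "(\<phi> n)\<^sup>2 = (\<integral>z. G n n z * (indicator B (fst z) * indicator B (snd z)) \<partial>MM)" for n
      proof -
        have "(\<phi> n)\<^sup>2 = (\<integral>z. (F ((T ^^ n) (fst z)) * indicator B (fst z)) * (F ((T ^^ n) (snd z)) * indicator B (snd z)) \<partial>MM)"
          unfolding \<phi>_eq power2_eq_square
          by (rule integral_pair_mult[OF prob_space_axioms, symmetric])
             (auto simp: abs_mult F_bound intro!: mult_le_one)
        then show ?thesis by (simp add: G_def mult_ac)
      qed
      have "(\<Sum>n<N. (\<phi> n)\<^sup>2) / real N = (\<integral>z. K N 0 0 z * (indicator B (fst z) * indicator B (snd z)) \<partial>MM)"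
        unfolding sq V_def
        by (subst Bochner_Integration.integral_sum[symmetric])
           (auto simp: sum_distrib_right sum_divide_distrib abs_mult G_bound indicator_def
              intro!: integrable_bounded[where c = 1] simp flip: integral_divide_zero)
      also have "\<dots> \<le> (\<integral>z. e + (K N 0 0 z)\<^sup>2 / e \<partial>MM)"
      proof (rule integral_mono)
        show "integrable MM (\<lambda>z. K N 0 0 z * (indicat_real B (fst z) * indicat_real B (snd z)))"
          using K_bound[OF that(1), of 0 0]
          by (intro integrable_bounded[where c = 1]) (auto simp: indicator_def)
        fix z
        have "\<bar>K N 0 0 z\<bar> \<le> e + (K N 0 0 z)\<^sup>2 / e" by (rule abs_le_add_square_div) fact
        moreover have "K N 0 0 z * (indicat_real B (fst z) * indicat_real B (snd z)) \<le> \<bar>K N 0 0 z\<bar>"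
          by (auto simp: indicator_def)
        ultimately show "K N 0 0 z * (indicat_real B (fst z) * indicat_real B (snd z)) \<le> e + (K N 0 0 z)\<^sup>2 / e"
          by linarith
      qed simp
      also have "\<dots> = e + q N / e" by (simp add: q_def P.P.prob_space)
      finally show ?thesis .
    qed
    have bound: "(\<Sum>n<N. \<bar>\<phi> n\<bar>) / real N \<le> d + (d\<^sup>2 + q N / d\<^sup>2) / d" if "N > 0" "d > 0" for N d
    proof -
      have "\<bar>\<phi> n\<bar> \<le> d + (\<phi> n)\<^sup>2 / d" for n
        by (rule abs_le_add_square_div) fact
      then have "(\<Sum>n<N. \<bar>\<phi> n\<bar>) \<le> (\<Sum>n<N. d + (\<phi> n)\<^sup>2 / d)" by (intro sum_mono)
      then have "(\<Sum>n<N. \<bar>\<phi> n\<bar>) / real N \<le> (\<Sum>n<N. d + (\<phi> n)\<^sup>2 / d) / real N"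
        by (rule divide_right_mono) simp
      also have "\<dots> = d + ((\<Sum>n<N. (\<phi> n)\<^sup>2) / real N) / d"
        using that by (simp add: sum.distrib sum_divide_distrib[symmetric] add_divide_distrib)
      also have "\<dots> \<le> d + (d\<^sup>2 + q N / d\<^sup>2) / d"
        using \<phi>2[of N "d\<^sup>2"] that by (intro add_left_mono divide_right_mono) auto
      finally show ?thesis .
    qed
    show ?thesis unfolding \<phi>_def[symmetric]
    proof (rule LIMSEQ_I)
      fix e :: real assume "e > 0"
      \<comment> \<open>For fixed \<open>d\<close> the bound tends to \<open>2 * d = e / 2\<close>
        as \<open>N\<close> grows.\<close>
      define d where "d = e / 4"
      have d: "d > 0" using \<open>e > 0\<close> by (simp add: d_def)
      have "(\<lambda>N. d + (d\<^sup>2 + q N / d\<^sup>2) / d) \<longlonglongrightarrow> d + (d\<^sup>2 + 0 / d\<^sup>2) / d"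
        using d by (intro tendsto_intros q0) auto
      moreover have "d + (d\<^sup>2 + 0 / d\<^sup>2) / d < e"
        using d by (simp add: power2_eq_square d_def)
      ultimately have "eventually (\<lambda>N. d + (d\<^sup>2 + q N / d\<^sup>2) / d < e) sequentially"
        by (rule order_tendstoD)
      then have "eventually (\<lambda>N. norm ((\<Sum>n<N. \<bar>\<phi> n\<bar>) / real N - 0) < e) sequentially"
        using eventually_gt_at_top[of 0]
      proof eventually_elim
        case (elim N)
        have "(\<Sum>n<N. \<bar>\<phi> n\<bar>) / real N \<ge> 0" by (simp add: sum_nonneg)
        then show ?case using bound[OF elim(2) d] elim(1) by simp
      qed
      then show "\<exists>no. \<forall>n\<ge>no. norm ((\<Sum>n<n. \<bar>\<phi> n\<bar>) / real n - 0) < e"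
        by (simp add: eventually_sequentially)
    qed
  qed
  then show ?thesis using assms(1,2) by (simp add: weakly_mixing_def)
qed

section \<open>Words with two kinds of separators\<close>


primrec join :: "'a list \<Rightarrow> 'a list list \<Rightarrow> 'a list" where
  "join X [] = X"
| "join X (t # ts) = X @ t @ join X ts"

lemma join_append: "join X (ts @ t # us) = join X ts @ t @ join X us"
  by (induction ts) auto

lemma prefix_join: "prefix X (join X ts)"
  by (cases ts) auto

lemma join_replicate: "join X (replicate k t) = concat (replicate k (X @ t)) @ X"
  by (induction k) auto

text \<open>A word of length at most \<open>2 * length X\<close> that starts in some copy of
  \<open>X\<close>, or in the separator after it, ends before the next two copies are over. So it
  sees at most three consecutive copies and the two separators between them.\<close>

lemma sublist_join_local:
  assumes "length w \<le> 2 * length X" "sublist w (join X ts)" "length ts \<ge> 2"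
  shows "\<exists>i. Suc i < length ts \<and> sublist w (X @ ts ! i @ X @ ts ! Suc i @ X)"
  using assms(2,3)
proof (induction ts)
  case (Cons t1 ts)
  then obtain t2 us where ts: "ts = t2 # us" by (cases ts) auto
  show ?case
  proof (cases us)
    case Nil
    then show ?thesis using Cons.prems ts by auto
  next
    case us: (Cons t3 us')
    have "sublist w ((X @ t1) @ join X ts)" using Cons.prems by simp
    then consider "sublist w (X @ t1)" | "sublist w (join X ts)"
      | w1 w2 where "w = w1 @ w2" "suffix w1 (X @ t1)" "prefix w2 (join X ts)"
      unfolding sublist_append by blast
    then show ?thesis
    proof cases
      case 1
      then have "sublist w ((X @ t1) @ (X @ t2 @ X))" using sublist_append by blast
      then show ?thesis using ts by (intro exI[of _ 0]) simp
    next
      case 2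
      then obtain i where "Suc i < length ts" "sublist w (X @ ts ! i @ X @ ts ! Suc i @ X)"
        using Cons.IH ts us by auto
      then show ?thesis by (intro exI[of _ "Suc i"]) simp
    next
      case 3
      obtain Z where "join X us = X @ Z" using prefix_join[of X us] by (auto simp: prefix_def)
      then have "prefix w2 ((X @ t2 @ X) @ Z)" using 3(3) ts by simp
      moreover have "length w2 \<le> length (X @ t2 @ X)" using 3(1) assms(1) by simp
      ultimately have "prefix w2 (X @ t2 @ X)" using prefix_length_prefix prefixI by blast
      then have "sublist w ((X @ t1) @ (X @ t2 @ X))"
        unfolding sublist_append using 3(1,2) by blast
      then show ?thesis using ts by (intro exI[of _ 0]) simp
    qed
  qed
qed simp

text \<open>A separator of at most one letter has no interior, so a window contains it entirely or
  lies on one side of it. For \<open>S = []\<close> the third case just records a cut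
  position.\<close>

lemma sublist_separator_cases:
  assumes "length S \<le> 1" "sublist w (P @ S @ Q)"
  obtains "sublist w P" | "sublist w Q"
    | w1 w2 where "w = w1 @ S @ w2" "suffix w1 P" "prefix w2 Q"
proof -
  have pS: "v = [] \<or> (\<exists>w2. v = S @ w2 \<and> prefix w2 Q)" if "prefix v (S @ Q)" for v
    using assms(1) that by (cases S; cases v) auto
  consider "sublist w P" | "sublist w (S @ Q)"
    | w1 v where "w = w1 @ v" "suffix w1 P" "prefix v (S @ Q)"
    using assms(2) unfolding sublist_append[of _ P] by blast
  then show ?thesis
  proof cases
    case 2
    have "sublist w Q \<or> prefix w (S @ Q)"
      using 2 assms(1) by (cases S) (auto simp: sublist_Cons_right)
    then show ?thesis using pS[of w] that(2) that(3)[of "[]"] by (metis Nil_suffix append_Nil sublist_Nil_left)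
  next
    case 3
    from pS[OF 3(3)] show ?thesis
    proof
      assume "v = []"
      then show ?thesis using 3 that(1) by (simp add: suffix_imp_sublist)
    qed (use 3 that(3) in auto)
  qed (rule that(1))
qed

text \<open>\<open>S\<close> is the common separator and \<open>S'\<close> occurs only isolated.
  Starting and ending with \<open>S\<close> makes the property stable when two such words are joined
  by either separator; length 2 provides the three copies needed by
  \<open>sublist_join_local\<close>.\<close>

definition spaced :: "'a list \<Rightarrow> 'a list \<Rightarrow> 'a list \<Rightarrow> 'a list \<Rightarrow> bool" where
  "spaced X S S' W \<longleftrightarrow> (\<exists>ts. W = join X ts \<and> length ts \<ge> 2 \<and> hd ts = S \<and> last ts = S \<and>
     set ts \<subseteq> {S, S'} \<and> successively (\<lambda>a b. a = S \<or> b = S) ts)"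

lemma spaced_sep:
  assumes "spaced X S S' W1" "spaced X S S' W2" "t \<in> {S, S'}"
  shows "spaced X S S' (W1 @ t @ W2)"
proof -
  obtain ts1 ts2 where
    1: "W1 = join X ts1" "length ts1 \<ge> 2" "hd ts1 = S" "last ts1 = S" "set ts1 \<subseteq> {S, S'}"
       "successively (\<lambda>a b. a = S \<or> b = S) ts1" and
    2: "W2 = join X ts2" "length ts2 \<ge> 2" "hd ts2 = S" "last ts2 = S" "set ts2 \<subseteq> {S, S'}"
       "successively (\<lambda>a b. a = S \<or> b = S) ts2"
    using assms(1,2) unfolding spaced_def by blast
  have "ts1 \<noteq> []" "ts2 \<noteq> []" using 1 2 by auto
  then show ?thesis unfolding spaced_def
    using 1 2 assms(3)
    by (intro exI[of _ "ts1 @ t # ts2"]) (auto simp: join_append successively_append_iff successively_Cons)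
qed

lemma spaced_join:
  assumes "spaced X S S' W" "set us \<subseteq> {S, S'}"
  shows "spaced X S S' (join W us)"
  using assms(2) by (induction us) (auto intro!: spaced_sep assms(1))

lemma spaced_base:
  assumes "k \<ge> 2"
  shows "spaced X S S' (join X (replicate k S))"
proof -
  have "successively (\<lambda>a b. a = S \<or> b = S) (replicate k S)"
    by (induction k) (auto simp: successively_Cons)
  then show ?thesis
    unfolding spaced_def using assms by (intro exI[of _ "replicate k S"]) (auto simp: hd_replicate last_replicate)
qed

text \<open>Of two neighbouring separators at least one is \<open>S\<close>, so the word lies in
  \<open>Y @ S @ X\<close>, \<open>X @ S @ Y\<close> or \<open>X @ S @ X @ S @ X\<close>. As
  \<open>Y\<close> has \<open>X\<close> as prefix and as suffix, all end pieces can be measured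
  against the single word \<open>Y\<close>.\<close>

lemma sublist_spaced_cases:
  assumes S: "length S \<le> 1" and w: "length w \<le> 2 * length X" "sublist w W" "spaced X S S' W"
  defines "Y \<equiv> X @ S' @ X"
  obtains "sublist w Y"
    | w1 w2 where "w = w1 @ S @ w2" "suffix w1 Y" "prefix w2 Y"
    | w1 w2 where "w = w1 @ S @ X @ S @ w2" "suffix w1 Y" "prefix w2 Y"
proof -
  have XY: "prefix X Y" "suffix X Y" "sublist X Y" unfolding Y_def by (auto simp: suffix_def sublist_def)
  obtain ts where ts: "W = join X ts" "length ts \<ge> 2" "set ts \<subseteq> {S, S'}"
       "successively (\<lambda>a b. a = S \<or> b = S) ts"
    using w(3) unfolding spaced_def by blast
  obtain i where i: "Suc i < length ts" and sub: "sublist w (X @ ts ! i @ X @ ts ! Suc i @ X)"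
    using sublist_join_local[OF w(1)] w(2) ts by blast
  have "ts ! i = S \<or> ts ! Suc i = S" using ts(4) i successively_nth by fastforce
  moreover have "ts ! i \<in> {S, S'}" "ts ! Suc i \<in> {S, S'}" using ts(3) i nth_mem Suc_lessD by blast+
  ultimately consider "sublist w (Y @ S @ X)" | "sublist w (X @ S @ Y)" | "sublist w (X @ S @ (X @ S @ X))"
    using sub by (auto simp: Y_def)
  then show ?thesis
  proof cases
    case 1
    then show ?thesis
      by (rule sublist_separator_cases[OF S]) (use that XY in \<open>blast intro: sublist_order.order_trans prefix_order.trans\<close>)+
  next
    case 2
    then show ?thesis
      by (rule sublist_separator_cases[OF S]) (use that XY in \<open>blast intro: sublist_order.order_trans suffix_order.trans\<close>)+
  next
    case 3
    then show ?thesis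
    proof (rule sublist_separator_cases[OF S])
      assume "sublist w X"
      then show ?thesis using that(1) XY(3) sublist_order.order_trans by blast
    next
      assume "sublist w (X @ S @ X)"
      then show ?thesis
        by (rule sublist_separator_cases[OF S])
           (use that XY in \<open>blast intro: sublist_order.order_trans suffix_order.trans prefix_order.trans\<close>)+
    next
      fix w1 w2 assume a: "w = w1 @ S @ w2" "suffix w1 X" "prefix w2 (X @ S @ X)"
      have w1: "suffix w1 Y" using a(2) XY(2) suffix_order.trans by blast
      consider "prefix w2 X" | v where "w2 = X @ v" "prefix v (S @ X)"
        using a(3) unfolding prefix_append by blast
      then show ?thesis
      proof cases
        case 1
        then show ?thesis using that(2)[OF a(1) w1] XY(1) prefix_order.trans by blast
      next
        case 2
        have "v = [] \<or> (\<exists>v'. v = S @ v' \<and> prefix v' X)"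
          using 2(2) S by (cases S; cases v) auto
        then show ?thesis
        proof
          assume "v = []"
          then show ?thesis using that(2)[OF a(1) w1] XY(1) 2(1) by simp
        next
          assume "\<exists>v'. v = S @ v' \<and> prefix v' X"
          then show ?thesis using that(3)[OF _ w1] a(1) 2(1) XY(1) prefix_order.trans by fastforce
        qed
      qed
    qed
  qed
qed

lemma finite_sublists: "finite {w. length w = q \<and> sublist w Y}"
proof (rule finite_subset)
  show "{w. length w = q \<and> sublist w Y} \<subseteq> set (sublists Y)" by (auto simp: set_sublists_eq)
qed simp

text \<open>Suffixes and prefixes of the fixed word \<open>Y\<close> are determined by their
  lengths, and the total length is \<open>q\<close>. So one number, the length of the piece before
  the first \<open>S\<close>, determines the word in the last two cases.\<close>

lemma card_spaced_words:
  assumes S: "length S \<le> 1" and q: "q \<le> 2 * length X"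
    and U: "\<And>w. w \<in> U \<Longrightarrow> length w = q \<and> (\<exists>W. spaced X S S' W \<and> sublist w W)"
    and p: "card {w. length w = q \<and> sublist w (X @ S' @ X)} \<le> p"
  shows "finite U \<and> card U \<le> p + (q + 1) + (q + 1 - length X)"
proof -
  define Y where "Y = X @ S' @ X"
  define U0 where "U0 = {w. length w = q \<and> sublist w Y}"
  define U1 where "U1 = (\<lambda>k. drop (length Y - k) Y @ S @ take (q - length S - k) Y) ` {..q}"
  \<comment> \<open>A full \<open>X\<close> lies between the two separators, so the first piece has
    length at most \<open>q - length X\<close>; for \<open>q < length X\<close> truncated
    subtraction makes the range empty.\<close>
  define U2 where "U2 = (\<lambda>k. drop (length Y - k) Y @ S @ X @ S @ take (q - 2 * length S - length X - k) Y)
     ` {..<q + 1 - length X}"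
  have suf: "drop (length Y - length w1) Y = w1" if "suffix w1 Y" for w1
    using that by (auto simp: suffix_def)
  have pre: "take (length w2) Y = w2" if "prefix w2 Y" for w2
    using that by (auto simp: prefix_def)
  have "U \<subseteq> U0 \<union> U1 \<union> U2"
  proof
    fix w assume "w \<in> U"
    from U[OF this] obtain W where w: "length w = q" "spaced X S S' W" "sublist w W" by blast
    from w q have "length w \<le> 2 * length X" by simp
    then show "w \<in> U0 \<union> U1 \<union> U2"
    proof (rule sublist_spaced_cases[OF S _ w(3,2)])
      assume "sublist w (X @ S' @ X)"
      then show ?thesis using w(1) by (simp add: U0_def Y_def)
    next
      fix w1 w2 assume a: "w = w1 @ S @ w2" "suffix w1 (X @ S' @ X)" "prefix w2 (X @ S' @ X)"
      have "q - length S - length w1 = length w2" "length w1 \<le> q" using a(1) w(1) by auto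
      then have "w \<in> U1" unfolding U1_def
        by (intro image_eqI[of _ _ "length w1"]) (use a suf pre in \<open>auto simp: Y_def\<close>)
      then show ?thesis by simp
    next
      fix w1 w2 assume a: "w = w1 @ S @ X @ S @ w2" "suffix w1 (X @ S' @ X)" "prefix w2 (X @ S' @ X)"
      have "q - 2 * length S - length X - length w1 = length w2" "length w1 < q + 1 - length X"
        using a(1) w(1) by auto
      then have "w \<in> U2" unfolding U2_def
        by (intro image_eqI[of _ _ "length w1"]) (use a suf pre in \<open>auto simp: Y_def\<close>)
      then show ?thesis by simp
    qed
  qed
  moreover have fin: "finite U0" "finite U1" "finite U2"
    unfolding U0_def U1_def U2_def by (simp_all add: finite_sublists)
  ultimately have "finite U" "card U \<le> card (U0 \<union> U1 \<union> U2)"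
    by (auto intro: finite_subset card_mono)
  moreover have "card (U0 \<union> U1 \<union> U2) \<le> card U0 + card U1 + card U2"
    using card_Un_le[of "U0 \<union> U1" U2] card_Un_le[of U0 U1] by linarith
  moreover have "card U0 \<le> p" using p by (simp add: U0_def Y_def)
  moreover have "card U1 \<le> q + 1" unfolding U1_def using card_image_le[of "{..q}"] by fastforce
  moreover have "card U2 \<le> q + 1 - length X" unfolding U2_def using card_image_le[of "{..<q + 1 - length X}"] by fastforce
  ultimately show ?thesis by linarith
qed

section \<open>Periodic words and the language of the blocks\<close>

lemma nth_concat_replicate:
  "j < k * length u \<Longrightarrow> concat (replicate k u) ! j = u ! (j mod length u)"
proof (induction k arbitrary: j)
  case (Suc k)
  show ?case
  proof (cases "j < length u")
    case False
    then have "concat (replicate k u) ! (j - length u) = u ! ((j - length u) mod length u)"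
      using Suc.prems by (intro Suc.IH) auto
    then show ?thesis using False by (simp add: nth_append le_mod_geq)
  qed (simp add: nth_append)
qed simp

text \<open>A subword of a power of \<open>u\<close> is determined by its length and its starting
  phase modulo \<open>length u\<close>.\<close>

lemma card_periodic_words:
  assumes "u \<noteq> []"
  shows "card {w. length w = q \<and> sublist w (concat (replicate k u))} \<le> length u"
proof -
  have "{w. length w = q \<and> sublist w (concat (replicate k u))}
      \<subseteq> (\<lambda>a. map (\<lambda>i. u ! ((a + i) mod length u)) [0..<q]) ` {..<length u}" (is "?A \<subseteq> ?f ` _")
  proof
    fix w assume "w \<in> ?A"
    then obtain ps ss where w: "length w = q" "concat (replicate k u) = ps @ w @ ss"
      by (auto simp: sublist_def)
    have len: "k * length u = length ps + q + length ss"
      using arg_cong[OF w(2), of length] w(1) by (simp add: length_concat sum_list_replicate)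
    have "w = ?f (length ps mod length u)"
    proof (rule nth_equalityI)
      fix i assume "i < length w"
      then have "w ! i = concat (replicate k u) ! (length ps + i)"
        using w by (simp add: nth_append)
      also have "\<dots> = u ! ((length ps + i) mod length u)"
        using \<open>i < length w\<close> w(1) len by (intro nth_concat_replicate) simp
      finally show "w ! i = ?f (length ps mod length u) ! i"
        using \<open>i < length w\<close> w(1) by (simp add: mod_add_left_eq)
    qed (simp add: w(1))
    then show "w \<in> ?f ` {..<length u}" using assms by auto
  qed
  then have "card ?A \<le> card (?f ` {..<length u})" by (intro card_mono) auto
  also have "\<dots> \<le> length u" using card_image_le[of "{..<length u}"] by fastforce
  finally show ?thesis .
qed

text \<open>Every window of the subshift lies here, so upper bounds for the complexity can be proved
  on finite blocks.\<close>

definition rk_language :: "(nat \<Rightarrow> nat) \<Rightarrow> (nat \<Rightarrow> nat \<Rightarrow> nat) \<Rightarrow> nat \<Rightarrow> nat list set" where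
  "rk_language r s q = {w. length w = q \<and> (\<exists>N. sublist w (rk_word r s N))}"

lemma rk_complexity_le_language:
  assumes "finite (rk_language r s q)"
  shows "rk_complexity r s q \<le> card (rk_language r s q)"
  unfolding rk_complexity_def
  by (rule card_mono[OF assms]) (auto simp: rk_language_def rk_subshift_def window_def)

section \<open>Complexity of the construction\<close>

text \<open>Evenness allows the shift by half a group of copies, and \<open>c_ge_index\<close> makes
  \<open>c\<close> tend to infinity. The bound 4 yields enough separators and makes the total spacer
  length summable.\<close>

locale block_spacers =
  fixes c :: "nat \<Rightarrow> nat"
  assumes c_ge: "c n \<ge> 4" and c_even: "even (c n)" and c_ge_index: "c n \<ge> n"
begin

definition r :: "nat \<Rightarrow> nat" where "r n = c n * c n - 1"

text \<open>Copies are counted from 0, so copy \<open>i\<close> closes a group of \<open>c n\<close>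
  copies when \<open>c n\<close> divides \<open>Suc i\<close>. The second condition drops the spacer
  after the last group, so that a block begins and ends with the previous block.\<close>

definition s :: "nat \<Rightarrow> nat \<Rightarrow> nat" where
  "s n i = (if c n dvd Suc i \<and> Suc i < c n * c n then 1 else 0)"

abbreviation B :: "nat \<Rightarrow> nat list" where "B \<equiv> rk_word r s"

definition h :: "nat \<Rightarrow> nat" where "h n = length (B n)"

lemma cc_pos: "c n * c n > 0" using c_ge[of n] by simp

lemma Suc_r: "Suc (r n) = c n * c n" using cc_pos[of n] by (simp add: r_def)

lemma r_ge_1: "r n \<ge> 1"
  using mult_le_mono[OF c_ge[of n] c_ge[of n]] by (simp add: r_def)

lemma concat_map_const:
  "(\<And>i. k \<le> i \<Longrightarrow> i < k + j \<Longrightarrow> f i = X) \<Longrightarrow> concat (map f [k..<k + j]) = concat (replicate j X)"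
proof (induction j)
  case (Suc j)
  then have "concat (map f [k..<k + Suc j]) = concat (replicate j X) @ X" by simp
  then show ?case by (metis append_Nil2 concat.simps concat_append replicate_append_same replicate_Suc)
qed simp

lemma B_Suc: "B (Suc n) = join (concat (replicate (c n) (B n))) (replicate (c n - 1) [1])"
proof -
  define f where "f i = B n @ replicate (s n i) 1" for i
  have c: "c n > 0" using c_ge[of n] by simp
  \<comment> \<open>Strictly inside a group no index is followed by a multiple of
    \<open>c n\<close>, so no spacer occurs.\<close>
  have block: "concat (map f [b * c n..<b * c n + (c n - 1)]) = concat (replicate (c n - 1) (B n))" for b
  proof (rule concat_map_const)
    fix i assume i: "b * c n \<le> i" "i < b * c n + (c n - 1)"
    have "\<not> c n dvd Suc i"
    proof
      assume "c n dvd Suc i"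
      then obtain m where m: "Suc i = m * c n" by (auto simp: dvd_def mult.commute)
      then have "b * c n < m * c n" "m * c n < Suc b * c n" using i by (simp_all only: m[symmetric]) auto
      then show False by (simp only: mult_less_cancel2) simp
    qed
    then show "f i = B n" by (simp add: f_def s_def)
  qed
  have full: "concat (map f [b * c n..<b * c n + c n]) =
      concat (replicate (c n) (B n)) @ (if Suc b < c n then [1] else [])" if "b < c n" for b
  proof -
    have "f (b * c n + (c n - 1)) = B n @ (if Suc b < c n then [1] else [])"
    proof -
      have "Suc (b * c n + (c n - 1)) = Suc b * c n" using c by simp
      then show ?thesis by (simp add: f_def s_def del: mult_Suc)
    qed
    moreover have "[b * c n..<b * c n + c n] = [b * c n..<b * c n + (c n - 1)] @ [b * c n + (c n - 1)]"
      using c by (cases "c n") auto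
    moreover have "concat (replicate (c n) (B n)) = concat (replicate (c n - 1) (B n)) @ B n"
      using c by (cases "c n") (auto simp flip: replicate_append_same)
    ultimately show ?thesis using block[of b] by simp
  qed
  have steps: "concat (map f [0..<k * c n]) = concat (replicate k (concat (replicate (c n) (B n)) @ [1]))"
    if "k < c n" for k
    using that
  proof (induction k)
    case (Suc k)
    have "[0..<Suc k * c n] = [0..<k * c n] @ [k * c n..<k * c n + c n]"
      using upt_add_eq_append[of 0 "k * c n" "c n"] by (simp add: add.commute)
    then show ?case using Suc full[of k] by (simp flip: replicate_append_same)
  qed simp
  have "B (Suc n) = concat (map f [0..<c n * c n])"
    by (simp add: f_def[abs_def] Suc_r del: upt_Suc)
  also have "[0..<c n * c n] = [0..<(c n - 1) * c n] @ [(c n - 1) * c n..<(c n - 1) * c n + c n]"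
    using upt_add_eq_append[of 0 "(c n - 1) * c n" "c n"] c
    by (metis (no_types, lifting) Suc_diff_1 add.commute le0 mult_Suc)
  finally show ?thesis
    using steps[of "c n - 1"] full[of "c n - 1"] c by (simp add: join_replicate)
qed

lemma h_0: "h 0 = 1" by (simp add: h_def)

lemma h_Suc: "h (Suc n) = c n * (c n * h n) + (c n - 1)"
proof -
  have "h (Suc n) = (c n - 1) * (c n * h n + 1) + c n * h n"
    unfolding h_def B_Suc join_replicate by (simp add: length_concat sum_list_replicate)
  also have "\<dots> = c n * (c n * h n) + (c n - 1)"
    using c_ge[of n] by (cases "c n") auto
  finally show ?thesis .
qed

lemma h_pos: "h n > 0"
proof (cases n)
  case (Suc m)
  then show ?thesis using c_ge[of m] by (simp add: h_Suc)
qed (simp add: h_0)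

lemma concat_replicate_eq_join:
  "k > 0 \<Longrightarrow> concat (replicate k X) = join X (replicate (k - 1) [])"
  by (cases k) (auto simp: join_replicate simp flip: replicate_append_same)

lemma prefix_B: "prefix (B n) (B (n + k))"
proof (induction k)
  case (Suc k)
  have "prefix (B m) (B (Suc m))" for m
  proof -
    have "prefix (B m) (concat (replicate (c m) (B m)))"
      using c_ge[of m] by (cases "c m") auto
    then show ?thesis unfolding B_Suc using prefix_join prefix_order.trans by blast
  qed
  then show ?case using Suc prefix_order.trans by fastforce
qed simp

text \<open>The next block joins copies of the present one first by \<open>[]\<close>, then by
  \<open>[1]\<close>. Both are admissible separators, so a description at the scale of
  \<open>X\<close> persists in all later blocks.\<close>

lemma spaced_step:
  assumes "spaced X S S' (B n)" "{S, S'} = {[], [1]}"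
  shows "spaced X S S' (B (Suc n))"
proof -
  have us: "set (replicate k []) \<subseteq> {S, S'}" "set (replicate k [1]) \<subseteq> {S, S'}" for k
    unfolding assms(2) by auto
  have "spaced X S S' (concat (replicate (c n) (B n)))"
    using c_ge[of n] spaced_join[OF assms(1) us(1)] by (simp add: concat_replicate_eq_join)
  then show ?thesis unfolding B_Suc using us(2) by (rule spaced_join)
qed

lemma spaced_add:
  assumes "spaced X S S' (B n)" "{S, S'} = {[], [1]}"
  shows "spaced X S S' (B (n + k))"
proof (induction k)
  case (Suc k)
  then show ?case using spaced_step[OF _ assms(2)] by simp
qed (simp add: assms(1))

lemma language_spaced:
  assumes "spaced X S S' (B n)" "{S, S'} = {[], [1]}" "w \<in> rk_language r s q"
  shows "length w = q \<and> (\<exists>W. spaced X S S' W \<and> sublist w W)"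
proof -
  obtain N where "sublist w (B N)" and q: "length w = q" using assms(3) by (auto simp: rk_language_def)
  then have "sublist w (B (N + n))"
    using prefix_B[of N n] prefix_imp_sublist sublist_order.order_trans by blast
  then show ?thesis using spaced_add[OF assms(1,2), of N] q by (auto simp: add.commute)
qed

text \<open>The scale of \<open>B\<^sup>c\<close>: here \<open>[1]\<close> is the common separator
  and \<open>[]\<close> the isolated one. An isolated \<open>[]\<close> produces a power of
  \<open>B n\<close>, hence the period \<open>h n\<close>.\<close>

lemma complexity_le_I:
  assumes "q \<le> 2 * (c n * h n)"
  shows "rk_complexity r s q \<le> h n + (q + 1) + (q + 1 - c n * h n)"
proof -
  define X where "X = concat (replicate (c n) (B n))"
  have lX: "length X = c n * h n" by (simp add: X_def h_def length_concat sum_list_replicate)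
  have "spaced X [1] [] (B (Suc n))"
    unfolding B_Suc X_def[symmetric] using c_ge[of n] by (intro spaced_base) simp
  from language_spaced[OF this] have L: "w \<in> rk_language r s q \<Longrightarrow>
     length w = q \<and> (\<exists>W. spaced X [1] [] W \<and> sublist w W)" for w by auto
  have "X @ [] @ X = concat (replicate (c n + c n) (B n))"
    by (simp add: X_def replicate_add)
  moreover have "B n \<noteq> []" using h_pos[of n] by (auto simp: h_def)
  ultimately have "card {w. length w = q \<and> sublist w (X @ [] @ X)} \<le> h n"
    unfolding h_def using card_periodic_words by metis
  from card_spaced_words[OF _ _ L this] show ?thesis
    using assms rk_complexity_le_language[of r s q] lX by (fastforce intro: order_trans)
qed

text \<open>The scale of \<open>B (Suc n)\<close>: now \<open>[]\<close> is common and
  \<open>[1]\<close> isolated. An isolated \<open>[1]\<close> continues the repetition of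
  \<open>B\<^sup>c 1\<close>, hence the period \<open>c n * h n + 1\<close>.\<close>

lemma complexity_le_II:
  assumes "q \<le> 2 * h (Suc n)"
  shows "rk_complexity r s q \<le> (c n * h n + 1) + (q + 1) + (q + 1 - h (Suc n))"
proof -
  define X where "X = B (Suc n)"
  have lX: "length X = h (Suc n)" by (simp add: X_def h_def)
  have "spaced X [] [1] (concat (replicate (c (Suc n)) X))"
    using c_ge[of "Suc n"] by (subst concat_replicate_eq_join) (auto intro!: spaced_base)
  then have "spaced X [] [1] (B (Suc (Suc n)))"
    unfolding B_Suc[of "Suc n"] X_def[symmetric] by (intro spaced_join) auto
  from language_spaced[OF this] have L: "w \<in> rk_language r s q \<Longrightarrow>
     length w = q \<and> (\<exists>W. spaced X [] [1] W \<and> sublist w W)" for w by auto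
  define C where "C = concat (replicate (c n) (B n))"
  define D where "D = C @ [1]"
  have lD: "length D = c n * h n + 1"
    by (simp add: D_def C_def h_def length_concat sum_list_replicate)
  have XD: "X = concat (replicate (c n - 1) D) @ C"
    unfolding X_def B_Suc join_replicate C_def D_def by simp
  \<comment> \<open>The extra letter completes the last period, since \<open>X @ [1]\<close> is
    exactly \<open>c n\<close> copies of \<open>D\<close>.\<close>
  have "(X @ [1] @ X) @ [1] = concat (replicate (c n + c n) D)"
    using c_ge[of n] unfolding XD replicate_add
    by (cases "c n") (auto simp: D_def simp flip: replicate_append_same)
  then have "sublist (X @ [1] @ X) (concat (replicate (c n + c n) D))"
    by (metis prefixI prefix_imp_sublist)
  then have "{w. length w = q \<and> sublist w (X @ [1] @ X)} \<subseteq> {w. length w = q \<and> sublist w (concat (replicate (c n + c n) D))}"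
    using sublist_order.order_trans by blast
  then have "card {w. length w = q \<and> sublist w (X @ [1] @ X)} \<le> card {w. length w = q \<and> sublist w (concat (replicate (c n + c n) D))}"
    by (intro card_mono finite_sublists)
  also have "\<dots> \<le> c n * h n + 1"
    using card_periodic_words[of D] lD by (metis D_def Nil_is_append_conv not_Cons_self2)
  finally have "card {w. length w = q \<and> sublist w (X @ [1] @ X)} \<le> c n * h n + 1" .
  from card_spaced_words[OF _ _ L this] show ?thesis
    using assms rk_complexity_le_language[of r s q] lX by (fastforce intro: order_trans)
qed


text \<open>For \<open>q < l\<close> the last summand vanishes and \<open>p\<close> is about
  \<open>q / 2\<close> at most. For larger \<open>q\<close> the last summand is about
  \<open>q / 2\<close> at most because \<open>q \<le> 2 * l\<close>, while \<open>p\<close> is small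
  relative to \<open>l\<close>. The constant 3 absorbs rounding.\<close>

lemma complexity_ratio_aux:
  fixes P p q l :: nat
  assumes "P \<le> p + (q + 1) + (q + 1 - l)" "2 * p \<le> q + 2" "q \<le> 2 * l"
    and "real p \<le> \<delta> * real l" "\<delta> \<ge> 0" "\<delta> \<le> 1"
  shows "real P \<le> (3 / 2 + \<delta>) * real q + 3"
proof (cases "q + 1 \<le> l")
  case True
  then have "2 * P \<le> 3 * q + 4" using assms(1,2) by linarith
  then have "real P \<le> 3 / 2 * real q + 2" by linarith
  moreover have "\<delta> * real q \<ge> 0" using assms(5) by simp
  ultimately show ?thesis by (simp add: algebra_simps)
next
  case False
  then have "2 * P \<le> 3 * q + 4 + 2 * p" using assms(1,3) by linarith
  then have "real P \<le> 3 / 2 * real q + 2 + real p" by linarith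
  moreover have "real p \<le> \<delta> * (real q + 1)"
    using assms(4) mult_left_mono[of "real l" "real q + 1" \<delta>] assms(5) False by linarith
  ultimately show ?thesis using assms(6) by (simp add: algebra_simps)
qed

lemma h_growth: "h (Suc n) > h n"
proof -
  have "1 * h n \<le> (c n * c n) * h n" using cc_pos[of n] by (intro mult_le_mono1) simp
  then show ?thesis unfolding h_Suc mult.assoc using c_ge[of n] by linarith
qed

lemma h_ge: "n < h n"
proof (induction n)
  case (Suc n)
  then show ?case using h_growth[of n] by simp
qed (simp add: h_pos)

text \<open>The range is split at \<open>2 * (c n * h n)\<close>, where the first scale stops being
  valid and the period \<open>c n * h n + 1\<close> of the second scale has just become at most
  \<open>(q + 2) / 2\<close>.\<close>

lemma complexity_ratio:
  assumes "2 * h n \<le> q" "q \<le> 2 * h (Suc n)"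
  shows "real (rk_complexity r s q) \<le> (3 / 2 + 2 / real (c n)) * real q + 3"
proof -
  have c: "c n \<ge> 4" by (rule c_ge)
  show ?thesis
  proof (cases "q \<le> 2 * (c n * h n)")
    case True
    show ?thesis
      by (rule complexity_ratio_aux[OF complexity_le_I[OF True]])
         (use assms True c in \<open>auto simp: field_simps\<close>)
  next
    case False
    have "h n \<ge> 1" "c n * h n \<ge> 1" using h_pos[of n] c by (simp_all add: Suc_le_eq)
    have "c n * (c n * h n + 1) \<le> c n * (2 * (c n * h n))"
      using \<open>c n * h n \<ge> 1\<close> by (intro mult_le_mono) auto
    also have "\<dots> \<le> 2 * h (Suc n)" by (simp add: h_Suc)
    finally have "real (c n * (c n * h n + 1)) \<le> real (2 * h (Suc n))" by (rule of_nat_mono)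
    then have "real (c n * h n + 1) \<le> 2 / real (c n) * real (h (Suc n))"
      using c by (simp add: field_simps)
    moreover have "2 / real (c n) \<le> 1" using c by simp
    ultimately show ?thesis
      using complexity_ratio_aux[OF complexity_le_II[OF assms(2)], of "2 / real (c n)"] assms(2) False
      by simp
  qed
qed

lemma limsup_complexity:
  assumes "\<epsilon> > 0"
  shows "limsup (\<lambda>q. ereal (real (rk_complexity r s q) / real q)) < ereal (3 / 2 + \<epsilon>)"
proof -
  \<comment> \<open>From stage \<open>n0\<close> on,
    \<open>2 / real (c n) \<le> \<epsilon> / 4\<close>; likewise \<open>q > 12 / \<epsilon>\<close>
    makes the additive 3 at most \<open>\<epsilon> / 4 * real q\<close>.\<close>
  obtain n0 :: nat where n0: "real n0 > 8 / \<epsilon>" using reals_Archimedean2 by blast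
  have "eventually (\<lambda>q. ereal (real (rk_complexity r s q) / real q) \<le> ereal (3 / 2 + \<epsilon> / 2)) sequentially"
    using eventually_ge_at_top[of "2 * h n0"] eventually_gt_at_top[of "nat \<lceil>12 / \<epsilon>\<rceil>"]
  proof eventually_elim
    case (elim q)
    \<comment> \<open>The stage whose range contains \<open>q\<close>; the maximum exists because
      \<open>h\<close> grows at least linearly.\<close>
    define n where "n = (GREATEST n. 2 * h n \<le> q)"
    have bd: "k \<le> q" if "2 * h k \<le> q" for k using h_ge[of k] that by linarith
    have "2 * h n \<le> q" unfolding n_def
      by (rule GreatestI_nat[of _ n0 q]) (use elim bd in auto)
    moreover have "n0 \<le> n" unfolding n_def
      by (rule Greatest_le_nat[of _ n0 q]) (use elim bd in auto)
    moreover have "q \<le> 2 * h (Suc n)"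
    proof (rule ccontr)
      assume "\<not> q \<le> 2 * h (Suc n)"
      then have "Suc n \<le> (GREATEST n. 2 * h n \<le> q)"
        using bd by (intro Greatest_le_nat[of _ _ q]) auto
      then have "Suc n \<le> n" unfolding n_def[symmetric] .
      then show False by simp
    qed
    ultimately have le: "real (rk_complexity r s q) \<le> (3 / 2 + 2 / real (c n)) * real q + 3"
      by (intro complexity_ratio)
    have "real (c n) \<ge> real n0" using c_ge_index[of n] \<open>n0 \<le> n\<close> by linarith
    then have "8 / \<epsilon> < real (c n)" using n0 by linarith
    then have cn: "2 / real (c n) \<le> \<epsilon> / 4" "real (c n) > 0"
      using assms c_ge[of n] by (auto simp: field_simps)
    have q: "3 \<le> \<epsilon> / 4 * real q" "q > 0"
    proof -
      have "12 / \<epsilon> < real q" using elim(2) by linarith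
      then show "3 \<le> \<epsilon> / 4 * real q" using assms by (simp add: field_simps)
    qed (use elim(2) in simp)
    have "real (rk_complexity r s q) \<le> (3 / 2 + \<epsilon> / 4) * real q + \<epsilon> / 4 * real q"
    proof -
      have "(3 / 2 + 2 / real (c n)) * real q \<le> (3 / 2 + \<epsilon> / 4) * real q"
        using cn(1) by (intro mult_right_mono) auto
      then show ?thesis using le q(1) by linarith
    qed
    then have "real (rk_complexity r s q) / real q \<le> 3 / 2 + \<epsilon> / 2"
      using q(2) by (simp add: field_simps)
    then show ?case by simp
  qed
  then have "limsup (\<lambda>q. ereal (real (rk_complexity r s q) / real q)) \<le> ereal (3 / 2 + \<epsilon> / 2)"
    by (rule Limsup_bounded)
  also have "\<dots> < ereal (3 / 2 + \<epsilon>)" using assms by simp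
  finally show ?thesis .
qed

text \<open>At \<open>q = c n * h n\<close> the last summand of \<open>complexity_le_I\<close> is
  just 1, so the excess over \<open>q\<close> is \<open>h n + 2\<close>. This does not involve
  \<open>c n\<close>, so \<open>f\<close> can be made to exceed it by the choice of
  \<open>c n\<close>.\<close>

lemma complexity_infinitely_often:
  assumes "\<And>n. f (c n * h n) > real (h n + 2)"
  shows "\<exists>\<^sub>\<infinity> q. real (rk_complexity r s q) < real q + f q"
  unfolding INFM_nat_le
proof
  fix m
  have "c m * 1 \<le> c m * h m" using h_pos[of m] by (intro mult_le_mono2) simp
  then have "m \<le> c m * h m" using c_ge_index[of m] by linarith
  moreover have "rk_complexity r s (c m * h m) \<le> h m + (c m * h m + 1) + 1"
    using complexity_le_I[of "c m * h m" m] by simp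
  then have "real (rk_complexity r s (c m * h m)) < real (c m * h m) + f (c m * h m)"
    using assms[of m] by linarith
  ultimately show "\<exists>q\<ge>m. real (rk_complexity r s q) < real q + f q" by blast
qed

end

section \<open>Columns of a rank-one transformation\<close>


lemma nth_concat_map_upt:
  assumes "i < k" "l < length (F i)"
  shows "concat (map F [0..<k]) ! ((\<Sum>j<i. length (F j)) + l) = F i ! l"
proof -
  have len: "length (concat (map F [0..<m])) = (\<Sum>j<m. length (F j))" for m
    by (induction m) auto
  have "concat (map F [0..<k]) = concat (map F [0..<i]) @ F i @ concat (map F [Suc i..<k])"
  proof -
    have "[0..<k] = [0..<i] @ i # [Suc i..<k]"
      using assms(1) by (metis add_0 le_add_same_cancel1 less_imp_add_positive order_less_imp_le upt_add_eq_append upt_conv_Cons zero_le)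
    then show ?thesis by simp
  qed
  then show ?thesis using assms(2) by (simp add: nth_append len)
qed

lemma UN_consecutive_intervals:
  fixes \<sigma> :: "nat \<Rightarrow> nat"
  shows "(\<Union>i<m. {(\<Sum>j<i. \<sigma> j)..<(\<Sum>j<i. \<sigma> j) + \<sigma> i}) = {..<(\<Sum>j<m. \<sigma> j)}"
  by (induction m) (auto simp: lessThan_Suc)

lemma UN_equal_intervals:
  fixes a w :: real
  assumes "w > 0"
  shows "(\<Union>i<m. {a + real i * w..<a + real i * w + w}) = {a..<a + real m * w}"
proof (induction m)
  case (Suc m)
  have "{a..<a + real m * w} \<union> {a + real m * w..<a + real m * w + w} = {a..<a + real m * w + w}"
    using assms by (intro ivl_disj_un) auto
  then show ?case using Suc by (simp add: lessThan_Suc Un_commute algebra_simps)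
qed simp

locale rank_one =
  fixes r :: "nat \<Rightarrow> nat" and s :: "nat \<Rightarrow> nat \<Rightarrow> nat"
begin

abbreviation "W \<equiv> rk_width r"
abbreviation "used \<equiv> rk_used r s"
abbreviation "col \<equiv> rk_column r s"
abbreviation "T \<equiv> rk_map r s"
abbreviation "X \<equiv> rk_space r s"

declare rk_column.simps(2) [simp del]

definition H :: "nat \<Rightarrow> nat" where "H n = length (col n)"

text \<open>The height, within column \<open>n + 1\<close>, of the bottom of copy \<open>i\<close>
  of column \<open>n\<close>.\<close>

definition off :: "nat \<Rightarrow> nat \<Rightarrow> nat" where "off n i = i * H n + (\<Sum>j<i. s n j)"

lemma W_pos: "W n > 0"
  unfolding rk_width_def by (intro divide_pos_pos prod_pos) auto

lemma W_Suc: "W n = real (r n + 1) * W (Suc n)"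
  unfolding rk_width_def by simp

lemma sum_column_lengths:
  "(\<Sum>j<i. length (map (\<lambda>a. a + real j * W (Suc n)) (col n) @
      map (\<lambda>t. used n + real ((\<Sum>k<j. s n k) + t) * W (Suc n)) [0..<s n j])) = off n i"
  by (simp add: off_def H_def sum.distrib)

lemma H_Suc: "H (Suc n) = off n (Suc (r n))"
proof -
  have len: "length (concat (map F [0..<m])) = (\<Sum>j<m. length (F j))" for m and F :: "nat \<Rightarrow> real list"
    by (induction m) auto
  show ?thesis unfolding H_def rk_column.simps len sum_column_lengths ..
qed

lemma off_Suc: "off n (Suc i) = off n i + H n + s n i"
  by (simp add: off_def)

lemma off_mono: "i \<le> i' \<Longrightarrow> off n i \<le> off n i'"
  by (rule lift_Suc_mono_le) (auto simp: off_Suc)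

lemma off_less: "i < i' \<Longrightarrow> off n i + H n \<le> off n i'"
  using off_mono[of "Suc i" i' n] by (simp add: off_Suc)

lemma off_less_H: "i \<le> r n \<Longrightarrow> l < H n \<Longrightarrow> off n i + l < H (Suc n)"
  using off_less[of i "Suc (r n)" n] by (simp add: H_Suc)

lemma off_inj:
  assumes "off n i + l = off n i' + l'" "l < H n" "l' < H n"
  shows "i = i' \<and> l = l'"
  using assms off_less[of i i' n] off_less[of i' i n] by (cases i i' rule: linorder_cases) auto

lemma col_Suc_nth:
  assumes "i \<le> r n" "l < H n"
  shows "col (Suc n) ! (off n i + l) = col n ! l + real i * W (Suc n)"
proof -
  define F where "F i = map (\<lambda>a. a + real i * W (Suc n)) (col n) @
      map (\<lambda>t. used n + real ((\<Sum>k<i. s n k) + t) * W (Suc n)) [0..<s n i]" for i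
  have "col (Suc n) = concat (map F [0..<Suc (r n)])"
    unfolding rk_column.simps F_def ..
  moreover have "off n i = (\<Sum>j<i. length (F j))"
    unfolding F_def sum_column_lengths ..
  ultimately have "col (Suc n) ! (off n i + l) = F i ! l"
    using nth_concat_map_upt[of i "Suc (r n)" l F] assms by (simp add: F_def H_def del: upt_Suc)
  then show ?thesis using assms(2) by (simp add: F_def H_def nth_append)
qed

text \<open>Cutting refines the grid of endpoints, and new spacers extend it consecutively on the
  right. So the levels tile \<open>[0, used n)\<close> by a uniform grid, from which disjointness
  and the union of levels follow.\<close>

lemma col_set_used: "set (col n) = (\<lambda>k. real k * W n) ` {..<H n} \<and> used n = real (H n) * W n"
proof (induction n)
  case 0
  then show ?case by (simp add: H_def rk_width_def lessThan_Suc)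
next
  case (Suc n)
  define R where "R = Suc (r n)"
  define w where "w = W (Suc n)"
  define \<sigma> where "\<sigma> i = (\<Sum>j<i. s n j)" for i
  have W: "W n = real R * w" by (simp add: W_Suc[of n] R_def w_def)
  have H': "H (Suc n) = R * H n + \<sigma> R" by (simp add: H_Suc off_def R_def \<sigma>_def)
  have "set (col (Suc n)) = (\<Union>i<R. (\<lambda>a. a + real i * w) ` set (col n) \<union> (\<lambda>t. used n + real (\<sigma> i + t) * w) ` {..<s n i})"
    by (simp add: rk_column.simps(2) lessThan_atLeast0 R_def w_def \<sigma>_def del: upt_Suc)
  also have "\<dots> = (\<lambda>k. real k * w) ` ((\<Union>i<R. (\<lambda>j. j * R + i) ` {..<H n}) \<union> (\<Union>i<R. (\<lambda>t. R * H n + (\<sigma> i + t)) ` {..<s n i}))"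
    unfolding Suc[THEN conjunct1] Suc[THEN conjunct2] W image_UN image_Un image_image UN_Un_distrib
    by (simp add: algebra_simps)
  \<comment> \<open>Division with remainder: slice \<open>i\<close> of the \<open>j\<close>-th grid
    interval is the grid interval \<open>j * R + i\<close> of the refinement.\<close>
  also have "(\<Union>i<R. (\<lambda>j. j * R + i) ` {..<H n}) = {..<R * H n}"
  proof (intro equalityI subsetI)
    fix k assume "k \<in> (\<Union>i<R. (\<lambda>j. j * R + i) ` {..<H n})"
    then obtain i j where "i < R" "j < H n" "k = j * R + i" by auto
    then have "k < Suc j * R" by simp
    also have "\<dots> \<le> H n * R" using \<open>j < H n\<close> by (intro mult_le_mono1) simp
    finally show "k \<in> {..<R * H n}" by (simp add: mult.commute)
  next
    fix k assume "k \<in> {..<R * H n}"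
    then have "k div R < H n" by (simp add: less_mult_imp_div_less mult.commute)
    moreover have "k = k div R * R + k mod R" by (rule div_mult_mod_eq[symmetric])
    moreover have "k mod R < R" by (simp add: R_def)
    ultimately show "k \<in> (\<Union>i<R. (\<lambda>j. j * R + i) ` {..<H n})"
      by (intro UN_I[of "k mod R"] image_eqI[of _ _ "k div R"]) auto
  qed
  also have "(\<Union>i<R. (\<lambda>t. R * H n + (\<sigma> i + t)) ` {..<s n i}) = (+) (R * H n) ` {..<\<sigma> R}"
  proof -
    have "(\<lambda>t. R * H n + (\<sigma> i + t)) ` {..<s n i} = (+) (R * H n) ` {\<sigma> i..<\<sigma> i + s n i}" for i
    proof -
      have "{\<sigma> i..<\<sigma> i + s n i} = (+) (\<sigma> i) ` {..<s n i}"
        by (simp add: lessThan_atLeast0 image_add_atLeastLessThan add.commute)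
      then show ?thesis by (simp add: image_image)
    qed
    then show ?thesis
      unfolding UN_consecutive_intervals[of "s n" R, folded \<sigma>_def, symmetric] image_UN by simp
  qed
  also have "{..<R * H n} \<union> (+) (R * H n) ` {..<\<sigma> R} = {..<H (Suc n)}"
    unfolding H' by (auto simp: lessThan_atLeast0 image_add_atLeastLessThan)
  finally show ?case
    using Suc[THEN conjunct2] by (simp add: H' W w_def[symmetric] lessThan_Suc_atMost[symmetric] algebra_simps R_def[symmetric] \<sigma>_def del: sum.lessThan_Suc)
qed

lemmas used_eq = col_set_used[THEN conjunct2]

lemma distinct_col: "distinct (col n)"
proof (rule card_distinct)
  have "inj_on (\<lambda>k. real k * W n) {..<H n}" using W_pos[of n] by (auto intro: inj_onI)
  then show "card (set (col n)) = length (col n)"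
    by (simp add: col_set_used card_image H_def[symmetric])
qed

definition lev :: "nat \<Rightarrow> nat \<Rightarrow> real set" where
  "lev n j = {col n ! j..<col n ! j + W n}"

lemma lev_disjoint:
  assumes "x \<in> lev n j" "x \<in> lev n j'" "j < H n" "j' < H n"
  shows "j = j'"
proof -
  have "col n ! j \<in> set (col n)" "col n ! j' \<in> set (col n)" using assms by (simp_all add: H_def)
  then obtain a b where ab: "col n ! j = real a * W n" "col n ! j' = real b * W n"
    by (auto simp: col_set_used)
  have "real a * W n < (real b + 1) * W n" "real b * W n < (real a + 1) * W n"
    using assms(1,2) ab by (auto simp: lev_def algebra_simps)
  then have "real a < real b + 1" "real b < real a + 1" using W_pos[of n] by simp_all
  then have "a = b" by linarith
  then have "col n ! j = col n ! j'" using ab by simp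
  then show ?thesis using distinct_col[of n] assms(3,4) by (simp add: H_def nth_eq_iff_index_eq)
qed

lemma set_col: "set (col n) = (\<lambda>j. col n ! j) ` {..<H n}"
  by (auto simp: set_conv_nth H_def)

lemma UN_lev: "(\<Union>j<H n. lev n j) = {0..<used n}"
proof -
  have "(\<Union>j<H n. lev n j) = (\<Union>a\<in>set (col n). {a..<a + W n})"
    by (simp add: set_col lev_def)
  also have "\<dots> = (\<Union>k<H n. {0 + real k * W n..<0 + real k * W n + W n})"
    by (simp add: col_set_used)
  finally show ?thesis unfolding UN_equal_intervals[OF W_pos] by (simp add: used_eq)
qed

lemma X_eq: "X = (\<Union>n. {0..<used n})"
proof -
  have "(\<Union>a\<in>set (col n). {a..<a + W n}) = {0..<used n}" for n
    unfolding UN_lev[symmetric] by (simp add: set_col lev_def)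
  then show ?thesis by (simp add: rk_space_def)
qed

lemma lev_split:
  assumes "j < H n"
  shows "lev n j = (\<Union>i\<le>r n. lev (Suc n) (off n i + j))"
proof -
  have "(\<Union>i\<le>r n. lev (Suc n) (off n i + j)) =
      (\<Union>i<Suc (r n). {col n ! j + real i * W (Suc n)..<col n ! j + real i * W (Suc n) + W (Suc n)})"
    using assms by (auto simp: lev_def col_Suc_nth less_Suc_eq_le)
  also have "\<dots> = lev n j"
    unfolding UN_equal_intervals[OF W_pos] by (simp add: lev_def W_Suc[of n])
  finally show ?thesis ..
qed

text \<open>A non-top level and the one above it are sliced alike, and corresponding slices stay
  adjacent inside the same copy. So passing to a later column does not change the translation at
  \<open>x\<close>.\<close>

lemma jump_consistent:
  assumes "x \<in> lev n j" "Suc j < H n"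
  shows "\<exists>j'. x \<in> lev (n + k) j' \<and> Suc j' < H (n + k) \<and>
    col (n + k) ! Suc j' - col (n + k) ! j' = col n ! Suc j - col n ! j"
proof (induction k)
  case (Suc k)
  then obtain j' where j': "x \<in> lev (n + k) j'" "Suc j' < H (n + k)"
    "col (n + k) ! Suc j' - col (n + k) ! j' = col n ! Suc j - col n ! j" by blast
  obtain i where i: "i \<le> r (n + k)" "x \<in> lev (Suc (n + k)) (off (n + k) i + j')"
    using j' lev_split[of j' "n + k"] by auto
  have "Suc (off (n + k) i + j') < H (Suc (n + k))"
    using off_less_H[OF i(1) j'(2)] by simp
  moreover have "col (Suc (n + k)) ! Suc (off (n + k) i + j') - col (Suc (n + k)) ! (off (n + k) i + j')
      = col (n + k) ! Suc j' - col (n + k) ! j'"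
    using col_Suc_nth[OF i(1) j'(2)] col_Suc_nth[OF i(1), of j'] j'(2) by simp
  ultimately show ?case using i(2) j'(3) by (intro exI[of _ "off (n + k) i + j'"]) simp
qed (use assms in auto)

text \<open>Both jumps are compared in the common later column \<open>n + n'\<close>, where the
  level containing \<open>x\<close> is unique. This makes the choice in \<open>rk_map\<close>
  unambiguous.\<close>

lemma jump_unique:
  assumes "x \<in> lev n j" "Suc j < H n" "x \<in> lev n' j'" "Suc j' < H n'"
  shows "col n ! Suc j - col n ! j = col n' ! Suc j' - col n' ! j'"
proof -
  obtain a where a: "x \<in> lev (n + n') a" "Suc a < H (n + n')"
    "col (n + n') ! Suc a - col (n + n') ! a = col n ! Suc j - col n ! j"
    using jump_consistent[OF assms(1,2)] by blast
  obtain b where b: "x \<in> lev (n' + n) b" "Suc b < H (n' + n)"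
    "col (n' + n) ! Suc b - col (n' + n) ! b = col n' ! Suc j' - col n' ! j'"
    using jump_consistent[OF assms(3,4)] by blast
  have "a = b" using a b by (intro lev_disjoint[of x "n + n'"]) (auto simp: add.commute)
  then show ?thesis using a b by (simp add: add.commute)
qed

lemma T_eq:
  assumes "x \<in> lev n j" "Suc j < H n"
  shows "T x = x - col n ! j + col n ! Suc j"
proof -
  let ?P = "\<lambda>y. \<exists>n j. Suc j < length (col n) \<and> col n ! j \<le> x \<and> x < col n ! j + W n \<and>
               y = x - col n ! j + col n ! Suc j"
  have ex: "\<exists>n j. Suc j < length (col n) \<and> col n ! j \<le> x \<and> x < col n ! j + W n"
    using assms by (auto simp: lev_def H_def)
  have "(SOME y. ?P y) = x - col n ! j + col n ! Suc j"
  proof (rule some_equality)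
    show "?P (x - col n ! j + col n ! Suc j)" using assms by (auto simp: lev_def H_def)
  next
    fix y assume "?P y"
    then obtain n' j' where "x \<in> lev n' j'" "Suc j' < H n'" "y = x - col n' ! j' + col n' ! Suc j'"
      by (auto simp: lev_def H_def)
    then show "y = x - col n ! j + col n ! Suc j" using jump_unique[OF assms, of n' j'] by simp
  qed
  then show ?thesis using ex by (simp add: rk_map_def)
qed

lemma T_id:
  assumes "\<And>n j. Suc j < H n \<Longrightarrow> x \<notin> lev n j"
  shows "T x = x"
proof -
  have "\<not> (\<exists>n j. Suc j < length (col n) \<and> col n ! j \<le> x \<and> x < col n ! j + W n)"
    using assms by (auto simp: lev_def H_def)
  then show ?thesis unfolding rk_map_def by (rule if_not_P)
qed

lemma T_pow:
  assumes "x \<in> lev n j" "j + t < H n"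
  shows "(T ^^ t) x = x - col n ! j + col n ! (j + t) \<and> (T ^^ t) x \<in> lev n (j + t)"
  using assms(2)
proof (induction t)
  case (Suc t)
  then have "(T ^^ t) x = x - col n ! j + col n ! (j + t)" "(T ^^ t) x \<in> lev n (j + t)" by auto
  then show ?case using T_eq[of "(T ^^ t) x" n "j + t"] Suc.prems by (auto simp: lev_def)
qed (use assms(1) in auto)

lemma T_pow_lev: "x \<in> lev n j \<Longrightarrow> j + t < H n \<Longrightarrow> (T ^^ t) x \<in> lev n (j + t)"
  using T_pow by blast

lemma lev_Suc_subset:
  assumes "i \<le> r n" "l < H n" shows "lev (Suc n) (off n i + l) \<subseteq> lev n l"
  using assms lev_split by blast

end

section \<open>The measure and approximation by levels\<close>


text \<open>Bounded total length permits normalisation; vanishing width makes the levels generate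
  the measurable sets and the top level negligible.\<close>

locale finite_rank_one = rank_one +
  assumes used_bounded: "\<exists>K. \<forall>n. used n \<le> K"
    and W_tendsto_0: "W \<longlonglongrightarrow> 0"
begin

abbreviation "M \<equiv> rk_measure r s"

definition L :: real where "L = measure lborel X"

lemma lev_sets [measurable]: "lev n j \<in> sets borel"
  by (simp add: lev_def)

lemma X_sets [measurable]: "X \<in> sets borel"
  unfolding X_eq by measurable

lemma used_mono: "used n \<le> used (Suc n)"
  using W_pos[of "Suc n"] by (simp add: sum_nonneg)

lemma incseq_used: "incseq (\<lambda>n. {0..<used n})"
proof (rule incseq_SucI)
  show "{0..<used n} \<subseteq> {0..<used (Suc n)}" for n using used_mono[of n] by (intro ivl_subset[THEN iffD2]) auto
qed

lemma emeasure_X_finite: "emeasure lborel X < \<infinity>"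
proof -
  obtain K where "\<And>n. used n \<le> K" using used_bounded by blast
  then have "{0..<used n} \<subseteq> {0..K}" for n by (meson atLeastLessThan_subseteq_atLeastAtMost_iff order_refl)
  then have "X \<subseteq> {0..K}" unfolding X_eq by blast
  then have "emeasure lborel X \<le> emeasure lborel {0..K}" by (intro emeasure_mono) auto
  then show ?thesis by (auto simp: emeasure_lborel_Icc_eq intro: le_less_trans split: if_splits)
qed

lemma used_subset_X: "{0..<used n} \<subseteq> X"
  unfolding X_eq by blast

lemma L_ge_1: "L \<ge> 1"
proof -
  have "measure lborel {0..<used 0} \<le> measure lborel X"
    using emeasure_X_finite by (intro measure_mono_fmeasurable used_subset_X) (auto simp: fmeasurable_def)
  then show ?thesis by (simp add: L_def)
qed

lemma emeasure_X: "emeasure lborel X = ennreal L"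
  using emeasure_X_finite by (simp add: L_def emeasure_eq_ennreal_measure)

lemma sets_M: "sets M = sets (restrict_space lborel X)"
  by (simp add: rk_measure_def)

lemma sets_M_iff: "A \<in> sets M \<longleftrightarrow> A \<subseteq> X \<and> A \<in> sets borel"
  by (subst sets_M, subst sets_restrict_space_iff) auto

lemma space_M: "space M = X"
  by (simp add: rk_measure_def space_restrict_space)

lemma emeasure_M:
  assumes "A \<in> sets M"
  shows "emeasure M A = emeasure lborel A / emeasure lborel X"
proof -
  have "A \<subseteq> X" "A \<in> sets (restrict_space lborel X)" using assms sets_M_iff sets_M by auto
  moreover have "X \<in> sets (restrict_space lborel X)" by (subst sets_restrict_space_iff) auto
  ultimately show ?thesis
    unfolding rk_measure_def
    by (simp add: emeasure_uniform_measure Int_absorb1 emeasure_restrict_space)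
qed

lemma prob_space_M: "prob_space M"
proof
  have "X \<in> sets M" by (simp add: sets_M_iff)
  from emeasure_M[OF this] show "emeasure M (space M) = 1"
    using L_ge_1 by (simp add: space_M emeasure_X divide_ennreal)
qed

sublocale prob_space M by (rule prob_space_M)

lemma prob_Un_le:
  assumes "A \<in> sets M" "B \<in> sets M"
  shows "prob (A \<union> B) \<le> prob A + prob B"
  by (rule measure_subadditive) (use assms in auto)

lemma measure_M:
  assumes "A \<in> sets M"
  shows "measure M A = measure lborel A / L"
proof -
  have "A \<subseteq> X" using assms by (simp add: sets_M_iff)
  then have "emeasure lborel A \<le> emeasure lborel X" by (intro emeasure_mono) auto
  then have "emeasure lborel A < \<infinity>" using emeasure_X_finite by (rule le_less_trans)
  then have "emeasure lborel A \<noteq> \<infinity>" by simp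
  then have "emeasure M A = ennreal (measure lborel A / L)"
    using L_ge_1 by (simp add: emeasure_M[OF assms] emeasure_X emeasure_eq_ennreal_measure divide_ennreal)
  then show ?thesis using L_ge_1 by (simp add: measure_def)
qed

lemma prob_le:
  assumes "A \<in> sets M" "A \<subseteq> {a..<b}" "a \<le> b"
  shows "prob A \<le> b - a"
proof -
  have "measure lborel A \<le> measure lborel {a..<b}"
    using assms sets_M_iff by (intro measure_mono_fmeasurable) (auto simp: fmeasurable_def)
  then have "prob A \<le> (b - a) / L" using assms L_ge_1 by (simp add: measure_M divide_right_mono)
  also have "\<dots> \<le> b - a"
    using L_ge_1 mult_left_mono[of 1 L "b - a"] assms(3) by (simp add: divide_le_eq)
  finally show ?thesis .
qed

lemma lev_subset_used: "j < H n \<Longrightarrow> lev n j \<subseteq> {0..<used n}"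
  using UN_lev by blast

lemma lev_subset_X: "j < H n \<Longrightarrow> lev n j \<subseteq> X"
  using lev_subset_used used_subset_X order_trans by blast

lemma lev_sets_M [measurable]: "j < H n \<Longrightarrow> lev n j \<in> sets M"
  using lev_subset_X by (simp add: sets_M_iff)

lemma used_sets_M [measurable]: "{0..<used n} \<in> sets M"
  using used_subset_X by (simp add: sets_M_iff)

lemma prob_lev: "j < H n \<Longrightarrow> prob (lev n j) = W n / L"
  using W_pos[of n] by (simp add: measure_M lev_sets_M) (simp add: lev_def)

lemma prob_used: "prob {0..<used n} = real (H n) * W n / L"
  using W_pos[of n] by (simp add: measure_M used_sets_M) (simp add: used_eq)

lemma prob_used_tendsto: "(\<lambda>n. real (H n) * W n / L) \<longlonglongrightarrow> 1"
proof -
  have "(\<lambda>n. prob {0..<used n}) \<longlonglongrightarrow> prob (\<Union>n. {0..<used n})"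
    by (intro finite_Lim_measure_incseq incseq_used) (use used_sets_M in blast)
  also have "(\<Union>n. {0..<used n}) = space M" by (simp add: space_M X_eq)
  finally show ?thesis by (simp add: prob_used prob_space)
qed

definition lev_Un :: "nat \<Rightarrow> nat set \<Rightarrow> real set" where
  "lev_Un n J = (\<Union>j\<in>J. lev n j)"

lemma lev_Un_sets [measurable]: "J \<subseteq> {..<H n} \<Longrightarrow> lev_Un n J \<in> sets M"
  unfolding lev_Un_def using lev_sets_M finite_subset[of J "{..<H n}"] by (intro sets.finite_UN) auto

lemma prob_lev_Un:
  assumes "J \<subseteq> {..<H n}"
  shows "prob (lev_Un n J) = real (card J) * W n / L"
proof -
  have "finite J" using assms finite_subset by blast
  have "prob (lev_Un n J) = (\<Sum>j\<in>J. prob (lev n j))" unfolding lev_Un_def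
  proof (rule finite_measure_finite_Union[OF \<open>finite J\<close>])
    show "disjoint_family_on (lev n) J"
      unfolding disjoint_family_on_def
    proof (intro ballI impI)
      fix i j assume "i \<in> J" "j \<in> J" "i \<noteq> j"
      then show "lev n i \<inter> lev n j = {}" using assms lev_disjoint[of _ n i j] by blast
    qed
  qed (use assms in auto)
  also have "\<dots> = (\<Sum>j\<in>J. W n / L)" using assms by (intro sum.cong) (auto simp: prob_lev)
  finally show ?thesis by simp
qed

lemma lev_Un_subset_used: "J \<subseteq> {..<H n} \<Longrightarrow> lev_Un n J \<subseteq> {0..<used n}"
  unfolding lev_Un_def using lev_subset_used by blast

lemma lev_Un_iff:
  assumes "x \<in> lev n j" "j < H n" "J \<subseteq> {..<H n}"
  shows "x \<in> lev_Un n J \<longleftrightarrow> j \<in> J"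
  unfolding lev_Un_def using assms lev_disjoint[of x n j] by blast

lemma T_vimage_lev:
  assumes "Suc j < H n"
  shows "T -` A \<inter> lev n j = (\<lambda>x. (col n ! Suc j - col n ! j) + x) -` (A \<inter> lev n (Suc j))"
proof -
  have "x \<in> lev n j \<Longrightarrow> T x = (col n ! Suc j - col n ! j) + x" for x
    using T_eq[of x n j] assms by simp
  moreover have "(col n ! Suc j - col n ! j) + x \<in> lev n (Suc j) \<longleftrightarrow> x \<in> lev n j" for x
    by (auto simp: lev_def)
  ultimately show ?thesis by auto
qed

lemma emeasure_T_vimage_lev:
  assumes "Suc j < H n" "A \<in> sets borel"
  shows "T -` A \<inter> lev n j \<in> sets borel"
    and "measure lborel (T -` A \<inter> lev n j) = measure lborel (A \<inter> lev n (Suc j))"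
proof -
  define d where "d = col n ! Suc j - col n ! j"
  have [measurable]: "A \<in> sets borel" by fact
  have "(+) d -` (A \<inter> lev n (Suc j)) \<inter> space borel \<in> sets borel" by measurable
  then show "T -` A \<inter> lev n j \<in> sets borel" unfolding T_vimage_lev[OF assms(1)] d_def by simp
  have "measure lborel (A \<inter> lev n (Suc j)) = measure (distr lborel borel ((+) d)) (A \<inter> lev n (Suc j))"
    by (simp add: lborel_distr_plus)
  also have "\<dots> = measure lborel ((+) d -` (A \<inter> lev n (Suc j)))"
    by (subst measure_distr) auto
  finally show "measure lborel (T -` A \<inter> lev n j) = measure lborel (A \<inter> lev n (Suc j))"
    unfolding T_vimage_lev[OF assms(1)] d_def by simp
qed

lemma T_vimage_sets:
  assumes "A \<in> sets M"
  shows "T -` A \<inter> space M \<in> sets M"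
proof -
  have A: "A \<subseteq> X" and [measurable]: "A \<in> sets borel" using assms by (auto simp: sets_M_iff)
  define N where "N = (\<Union>n. \<Union>j\<in>{j. Suc j < H n}. lev n j)"
  have fin: "finite {j. Suc j < H n}" for n by (rule finite_subset[of _ "{..<H n}"]) auto
  have [measurable]: "N \<in> sets borel" unfolding N_def by (intro sets.countable_UN' sets.finite_UN fin) auto
  have NX: "N \<subseteq> X" unfolding N_def using lev_subset_X Suc_lessD by blast
  \<comment> \<open>On each non-top level \<open>T\<close> is a translation, and off their countable
    union \<open>N\<close> it is the identity.\<close>
  have "T -` A \<inter> X = (\<Union>n. \<Union>j\<in>{j. Suc j < H n}. T -` A \<inter> lev n j) \<union> (A - N)"
  proof (intro equalityI subsetI)
    fix x assume x: "x \<in> T -` A \<inter> X"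
    show "x \<in> (\<Union>n. \<Union>j\<in>{j. Suc j < H n}. T -` A \<inter> lev n j) \<union> (A - N)"
    proof (cases "x \<in> N")
      case False
      then have "T x = x" by (intro T_id) (auto simp: N_def)
      then show ?thesis using x False by auto
    qed (use x in \<open>auto simp: N_def\<close>)
  next
    fix x assume x: "x \<in> (\<Union>n. \<Union>j\<in>{j. Suc j < H n}. T -` A \<inter> lev n j) \<union> (A - N)"
    show "x \<in> T -` A \<inter> X"
    proof (cases "x \<in> N")
      case False
      then have "T x = x" by (intro T_id) (auto simp: N_def)
      then show ?thesis using x False A by (auto simp: N_def)
    qed (use x NX in auto)
  qed
  moreover have "(\<Union>n. \<Union>j\<in>{j. Suc j < H n}. T -` A \<inter> lev n j) \<in> sets borel"
  proof (rule sets.countable_UN'')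
    show "(\<Union>j\<in>{j. Suc j < H n}. T -` A \<inter> lev n j) \<in> sets borel" for n
      by (rule sets.finite_UN[OF fin], rule emeasure_T_vimage_lev(1)) auto
  qed simp
  ultimately have "T -` A \<inter> X \<in> sets borel" by simp
  then show ?thesis by (simp add: sets_M_iff space_M)
qed

lemma T_measurable: "T \<in> M \<rightarrow>\<^sub>M M"
proof (rule measurableI)
  fix x assume "x \<in> space M"
  show "T x \<in> space M"
  proof (cases "\<exists>n j. Suc j < H n \<and> x \<in> lev n j")
    case True
    then obtain n j where "Suc j < H n" "x \<in> lev n j" by blast
    then have "T x \<in> lev n (Suc j)" using T_pow_lev[of x n j 1] by simp
    then show ?thesis using lev_subset_X[OF \<open>Suc j < H n\<close>] by (auto simp: space_M)
  next
    case False
    then have "T x = x" by (intro T_id) auto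
    then show ?thesis using \<open>x \<in> space M\<close> by simp
  qed
qed (rule T_vimage_sets)

lemma card_non_top: "card {j. Suc j < H n} = H n - 1"
proof -
  have "{j. Suc j < H n} = {..<H n - 1}" by auto
  then show ?thesis by simp
qed

text \<open>In column \<open>n\<close>, \<open>T\<close> carries the non-top levels \<open>D\<close>
  onto the non-bottom levels \<open>D'\<close> by translations. So the two probabilities differ by
  at most the mass outside \<open>D\<close>, which tends to 0.\<close>

lemma prob_T_vimage:
  assumes A: "A \<in> sets M"
  shows "prob (T -` A \<inter> space M) = prob A"
proof -
  have Ab: "A \<in> sets borel" using A by (simp add: sets_M_iff)
  have le: "\<bar>prob (T -` A \<inter> space M) - prob A\<bar> \<le> 1 - (real (H n) * W n / L - W n)" for n
  proof -
    define J where "J = {j. Suc j < H n}"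
    have J: "J \<subseteq> {..<H n}" "finite J" "Suc ` J \<subseteq> {..<H n}"
      unfolding J_def by (auto intro: finite_subset[of _ "{..<H n}"])
    define D D' where "D = lev_Un n J" and "D' = lev_Un n (Suc ` J)"
    have [measurable]: "D \<in> sets M" "D' \<in> sets M" unfolding D_def D'_def using J by auto
    have TA [measurable]: "T -` A \<inter> space M \<in> sets M" by (rule T_vimage_sets[OF A])
    have pD: "prob D \<ge> real (H n) * W n / L - W n" "prob D' = prob D"
    proof -
      have "real (H n) * W n / L - W n / L \<le> real (H n - 1) * W n / L"
        using L_ge_1 W_pos[of n]
        by (cases "H n") (simp_all add: diff_divide_distrib[symmetric] divide_le_cancel algebra_simps)
      moreover have "W n / L \<le> W n"
        using L_ge_1 W_pos[of n] mult_left_mono[of 1 L "W n"] by (simp add: divide_le_eq)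
      ultimately show "prob D \<ge> real (H n) * W n / L - W n"
        unfolding D_def prob_lev_Un[OF J(1)] by (simp add: J_def card_non_top)
      show "prob D' = prob D" unfolding D_def D'_def
        using J by (simp add: prob_lev_Un card_image)
    qed
    have disj: "disjoint_family_on (\<lambda>j. T -` A \<inter> lev n j) J" "disjoint_family_on (\<lambda>j. A \<inter> lev n (Suc j)) J"
      unfolding disjoint_family_on_def J_def using lev_disjoint[of _ n] Suc_lessD by blast+
    have sub: "lev n j \<subseteq> space M" if "j < H n" for j
      using sets.sets_into_space[OF lev_sets_M[OF that]] .
    have TAj: "T -` A \<inter> lev n j \<in> sets M" if "j \<in> J" for j
    proof -
      have "T -` A \<inter> lev n j = (T -` A \<inter> space M) \<inter> lev n j" using sub[of j] that J by auto
      then show ?thesis using that J lev_sets_M by auto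
    qed
    have "prob ((T -` A \<inter> space M) \<inter> D) = prob (\<Union>j\<in>J. T -` A \<inter> lev n j)"
      using sub J by (intro arg_cong[where f = prob]) (auto simp: D_def lev_Un_def)
    also have "\<dots> = (\<Sum>j\<in>J. prob (T -` A \<inter> lev n j))"
      by (rule finite_measure_finite_Union) (use J disj TAj in auto)
    also have "\<dots> = (\<Sum>j\<in>J. prob (A \<inter> lev n (Suc j)))"
    proof (rule sum.cong)
      fix j assume j: "j \<in> J"
      then have "A \<inter> lev n (Suc j) \<in> sets M" using A by (auto simp: J_def)
      then show "prob (T -` A \<inter> lev n j) = prob (A \<inter> lev n (Suc j))"
        using TAj[OF j] emeasure_T_vimage_lev(2)[OF _ Ab, of j n] j by (simp add: measure_M J_def)
    qed simp
    also have "\<dots> = prob (\<Union>j\<in>J. A \<inter> lev n (Suc j))"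
      by (rule finite_measure_finite_Union[symmetric]) (use J disj A in \<open>auto simp: J_def\<close>)
    also have "(\<Union>j\<in>J. A \<inter> lev n (Suc j)) = A \<inter> D'" by (auto simp: D'_def lev_Un_def)
    finally have eq: "prob ((T -` A \<inter> space M) \<inter> D) = prob (A \<inter> D')" .
    have split: "prob C \<le> prob (C \<inter> E) + (1 - prob E)" "prob (C \<inter> E) \<le> prob C"
      if [measurable]: "C \<in> sets M" "E \<in> sets M" for C E
    proof -
      have "prob C = prob (C \<inter> E) + prob (C - E)"
        using finite_measure_Diff'[of C E] by simp
      moreover have "prob (C - E) \<le> prob (space M - E)"
        using sets.sets_into_space[OF that(1)] by (intro finite_measure_mono) auto
      ultimately show "prob C \<le> prob (C \<inter> E) + (1 - prob E)" by (simp add: prob_compl)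
      show "prob (C \<inter> E) \<le> prob C" by (intro finite_measure_mono) auto
    qed
    \<comment> \<open>\<open>A\<close> and its preimage each lose at most the mass of a complement,
      and \<open>D\<close>, \<open>D'\<close> have equal mass.\<close>
    show ?thesis
      using split[OF TA, of D] split[OF A, of D'] eq pD by (auto simp: abs_le_iff)
  qed
  have "(\<lambda>n. 1 - (real (H n) * W n / L - W n)) \<longlonglongrightarrow> 1 - (1 - 0)"
    by (intro tendsto_intros prob_used_tendsto W_tendsto_0)
  then have "\<bar>prob (T -` A \<inter> space M) - prob A\<bar> \<le> 1 - (1 - 0)"
    by (rule LIMSEQ_le_const) (use le in blast)
  then show ?thesis by simp
qed

lemma measure_preserving_T: "measure_preserving_map M T"
  unfolding measure_preserving_map_def
  using T_measurable prob_T_vimage by (simp add: emeasure_eq_measure)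

section \<open>Approximation of measurable sets by unions of levels, at all late stages so that
  several sets share one stage\<close>

definition approximable :: "real set \<Rightarrow> bool" where
  "approximable A \<longleftrightarrow> (\<forall>e>0. \<exists>m. \<forall>n\<ge>m. \<exists>J\<subseteq>{..<H n}. prob (sym_diff A (lev_Un n J)) < e)"

text \<open>Taking the levels entirely to the left of \<open>a\<close>, the error lies outside the
  column or within one width to the left of \<open>a\<close>.\<close>

lemma approximable_lessThan: "approximable ({..<a} \<inter> X)"
  unfolding approximable_def
proof (intro allI impI)
  fix e :: real assume "e > 0"
  have "(\<lambda>n. 1 - real (H n) * W n / L + W n) \<longlonglongrightarrow> 1 - 1 + 0"
    by (intro tendsto_intros prob_used_tendsto W_tendsto_0)
  then have "eventually (\<lambda>n. 1 - real (H n) * W n / L + W n < e) sequentially"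
    using \<open>e > 0\<close> by (intro order_tendstoD) auto
  then obtain m where m: "\<And>n. n \<ge> m \<Longrightarrow> 1 - real (H n) * W n / L + W n < e"
    by (auto simp: eventually_sequentially)
  show "\<exists>m. \<forall>n\<ge>m. \<exists>J\<subseteq>{..<H n}. prob (sym_diff ({..<a} \<inter> X) (lev_Un n J)) < e"
  proof (intro exI[of _ m] allI impI)
    fix n assume "n \<ge> m"
    define J where "J = {j. j < H n \<and> col n ! j + W n \<le> a}"
    have J: "J \<subseteq> {..<H n}" by (auto simp: J_def)
    define Z where "Z = {a - W n..<a} \<inter> X"
    have [measurable]: "Z \<in> sets M" by (simp add: Z_def sets_M_iff)
    have "sym_diff ({..<a} \<inter> X) (lev_Un n J) \<subseteq> (space M - {0..<used n}) \<union> Z"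
    proof
      fix x assume x: "x \<in> sym_diff ({..<a} \<inter> X) (lev_Un n J)"
      have "lev_Un n J \<subseteq> {..<a}" by (auto simp: lev_Un_def lev_def J_def)
      then have "lev_Un n J \<subseteq> {..<a} \<inter> X"
        using lev_Un_subset_used[OF J] used_subset_X[of n] by blast
      then have x: "x < a" "x \<in> X" "x \<notin> lev_Un n J" using x by auto
      show "x \<in> (space M - {0..<used n}) \<union> Z"
      proof (cases "x \<in> {0..<used n}")
        case True
        then obtain j where "j < H n" "x \<in> lev n j" using UN_lev by blast
        then have "j \<notin> J" using x(3) by (auto simp: lev_Un_def)
        then have "a < col n ! j + W n" using \<open>j < H n\<close> by (simp add: J_def)
        then show ?thesis using x \<open>x \<in> lev n j\<close> by (auto simp: lev_def Z_def)
      qed (use x in \<open>simp add: space_M\<close>)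
    qed
    then have "prob (sym_diff ({..<a} \<inter> X) (lev_Un n J)) \<le> prob ((space M - {0..<used n}) \<union> Z)"
      by (intro finite_measure_mono) auto
    also have "\<dots> \<le> prob (space M - {0..<used n}) + prob Z"
      by (intro prob_Un_le) auto
    also have "prob (space M - {0..<used n}) = 1 - real (H n) * W n / L"
      by (simp add: prob_compl prob_used)
    also have "prob Z \<le> a - (a - W n)"
      by (rule prob_le) (use W_pos[of n] in \<open>simp_all add: Z_def sets_M_iff\<close>)
    finally show "\<exists>J\<subseteq>{..<H n}. prob (sym_diff ({..<a} \<inter> X) (lev_Un n J)) < e"
      using m[OF \<open>n \<ge> m\<close>] J by (intro exI[of _ J] conjI) linarith+
  qed
qed

text \<open>Inside the column the complementary set of levels works equally well; the only new error
  is the mass outside the column.\<close>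

lemma approximable_compl:
  assumes A [measurable]: "A \<in> sets M" and "approximable A"
  shows "approximable (space M - A)"
  unfolding approximable_def
proof (intro allI impI)
  fix e :: real assume "e > 0"
  have "(\<lambda>n. 1 - real (H n) * W n / L) \<longlonglongrightarrow> 1 - 1"
    by (intro tendsto_intros prob_used_tendsto)
  then have "eventually (\<lambda>n. 1 - real (H n) * W n / L < e / 2) sequentially"
    using \<open>e > 0\<close> by (intro order_tendstoD) auto
  then obtain m where m: "\<And>n. n \<ge> m \<Longrightarrow> 1 - real (H n) * W n / L < e / 2"
    by (auto simp: eventually_sequentially)
  obtain m' where m': "\<And>n. n \<ge> m' \<Longrightarrow> \<exists>J\<subseteq>{..<H n}. prob (sym_diff A (lev_Un n J)) < e / 2"
    using assms(2) \<open>e > 0\<close> unfolding approximable_def by (meson half_gt_zero)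
  show "\<exists>m. \<forall>n\<ge>m. \<exists>J\<subseteq>{..<H n}. prob (sym_diff (space M - A) (lev_Un n J)) < e"
  proof (intro exI[of _ "max m m'"] allI impI)
    fix n assume n: "n \<ge> max m m'"
    then obtain J where J: "J \<subseteq> {..<H n}" "prob (sym_diff A (lev_Un n J)) < e / 2" using m' by auto
    define J' where "J' = {..<H n} - J"
    have [measurable]: "lev_Un n J \<in> sets M" "lev_Un n J' \<in> sets M" using J by (auto simp: J'_def)
    have "sym_diff (space M - A) (lev_Un n J') \<subseteq> sym_diff A (lev_Un n J) \<union> (space M - {0..<used n})"
    proof
      fix x assume x: "x \<in> sym_diff (space M - A) (lev_Un n J')"
      have "lev_Un n J' \<subseteq> space M" by (rule sets.sets_into_space) measurable
      then have xM: "x \<in> space M" using x by auto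
      show "x \<in> sym_diff A (lev_Un n J) \<union> (space M - {0..<used n})"
      proof (cases "x \<in> {0..<used n}")
        case True
        then obtain j where j: "j < H n" "x \<in> lev n j" using UN_lev by blast
        have "x \<in> lev_Un n J \<longleftrightarrow> x \<notin> lev_Un n J'"
          using lev_Un_iff[OF j(2,1) J(1)] lev_Un_iff[OF j(2,1), of J'] j by (auto simp: J'_def)
        then show ?thesis using x xM by auto
      qed (use xM in simp)
    qed
    then have "prob (sym_diff (space M - A) (lev_Un n J')) \<le> prob (sym_diff A (lev_Un n J) \<union> (space M - {0..<used n}))"
      by (intro finite_measure_mono) auto
    also have "\<dots> \<le> prob (sym_diff A (lev_Un n J)) + prob (space M - {0..<used n})"
      by (intro prob_Un_le) auto
    also have "prob (space M - {0..<used n}) = 1 - real (H n) * W n / L"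
      by (simp add: prob_compl prob_used)
    finally have "prob (sym_diff (space M - A) (lev_Un n J')) < e" using J(2) m[of n] n by linarith
    then show "\<exists>J\<subseteq>{..<H n}. prob (sym_diff (space M - A) (lev_Un n J)) < e"
      by (intro exI[of _ J']) (auto simp: J'_def)
  qed
qed

lemma approximable_Un:
  assumes [measurable]: "A \<in> sets M" "B \<in> sets M" and "approximable A" "approximable B"
  shows "approximable (A \<union> B)"
  unfolding approximable_def
proof (intro allI impI)
  fix e :: real assume "e > 0"
  obtain m where m: "\<And>n. n \<ge> m \<Longrightarrow> \<exists>J\<subseteq>{..<H n}. prob (sym_diff A (lev_Un n J)) < e / 2"
    using assms(3) \<open>e > 0\<close> unfolding approximable_def by (meson half_gt_zero)
  obtain m' where m': "\<And>n. n \<ge> m' \<Longrightarrow> \<exists>J\<subseteq>{..<H n}. prob (sym_diff B (lev_Un n J)) < e / 2"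
    using assms(4) \<open>e > 0\<close> unfolding approximable_def by (meson half_gt_zero)
  show "\<exists>m. \<forall>n\<ge>m. \<exists>J\<subseteq>{..<H n}. prob (sym_diff (A \<union> B) (lev_Un n J)) < e"
  proof (intro exI[of _ "max m m'"] allI impI)
    fix n assume n: "n \<ge> max m m'"
    obtain J where J: "J \<subseteq> {..<H n}" "prob (sym_diff A (lev_Un n J)) < e / 2" using m n by auto
    obtain J' where J': "J' \<subseteq> {..<H n}" "prob (sym_diff B (lev_Un n J')) < e / 2" using m' n by auto
    have [measurable]: "lev_Un n J \<in> sets M" "lev_Un n J' \<in> sets M" using J J' by auto
    have "lev_Un n (J \<union> J') = lev_Un n J \<union> lev_Un n J'" by (auto simp: lev_Un_def)
    then have "prob (sym_diff (A \<union> B) (lev_Un n (J \<union> J'))) \<le> prob (sym_diff A (lev_Un n J) \<union> sym_diff B (lev_Un n J'))"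
      by (intro finite_measure_mono) auto
    also have "\<dots> \<le> prob (sym_diff A (lev_Un n J)) + prob (sym_diff B (lev_Un n J'))"
      by (intro prob_Un_le) auto
    finally show "\<exists>J\<subseteq>{..<H n}. prob (sym_diff (A \<union> B) (lev_Un n J)) < e"
      using J J' by (intro exI[of _ "J \<union> J'"]) auto
  qed
qed

lemma approximable_incseq:
  assumes A: "range A \<subseteq> sets M" "incseq A" and "\<And>i. approximable (A i)"
  shows "approximable (\<Union>i. A i)"
  unfolding approximable_def
proof (intro allI impI)
  fix e :: real assume "e > 0"
  have U [measurable]: "(\<Union>i. A i) \<in> sets M" using A by auto
  have "(\<lambda>i. prob (A i)) \<longlonglongrightarrow> prob (\<Union>i. A i)"
    by (rule finite_Lim_measure_incseq[OF A])
  then have "eventually (\<lambda>i. prob (A i) > prob (\<Union>i. A i) - e / 2) sequentially"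
    using \<open>e > 0\<close> by (intro order_tendstoD) auto
  then obtain k where k: "prob (A k) > prob (\<Union>i. A i) - e / 2"
    by (auto simp: eventually_sequentially)
  have [measurable]: "A k \<in> sets M" using A by auto
  obtain m where m: "\<And>n. n \<ge> m \<Longrightarrow> \<exists>J\<subseteq>{..<H n}. prob (sym_diff (A k) (lev_Un n J)) < e / 2"
    using assms(3)[of k] \<open>e > 0\<close> unfolding approximable_def by (meson half_gt_zero)
  show "\<exists>m. \<forall>n\<ge>m. \<exists>J\<subseteq>{..<H n}. prob (sym_diff (\<Union>i. A i) (lev_Un n J)) < e"
  proof (intro exI[of _ m] allI impI)
    fix n assume "n \<ge> m"
    then obtain J where J: "J \<subseteq> {..<H n}" "prob (sym_diff (A k) (lev_Un n J)) < e / 2" using m by auto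
    have [measurable]: "lev_Un n J \<in> sets M" using J by auto
    have "prob (sym_diff (\<Union>i. A i) (lev_Un n J)) \<le> prob (((\<Union>i. A i) - A k) \<union> sym_diff (A k) (lev_Un n J))"
      by (intro finite_measure_mono) auto
    also have "\<dots> \<le> prob ((\<Union>i. A i) - A k) + prob (sym_diff (A k) (lev_Un n J))"
      by (intro prob_Un_le) auto
    also have "prob ((\<Union>i. A i) - A k) = prob (\<Union>i. A i) - prob (A k)"
      by (intro finite_measure_Diff) auto
    finally show "\<exists>J\<subseteq>{..<H n}. prob (sym_diff (\<Union>i. A i) (lev_Un n J)) < e"
      using J k by (intro exI[of _ J]) auto
  qed
qed

lemma approximable_sets:
  assumes "A \<in> sets M"
  shows "approximable A"
proof -
  have "B \<inter> X \<in> sets M \<and> approximable (B \<inter> X)" if "B \<in> sigma_sets UNIV (range lessThan)" for B :: "real set"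
    using that
  proof induction
    case Empty
    have "approximable {}" unfolding approximable_def
      by (intro allI impI exI[of _ 0] exI[of _ "{}"]) (auto simp: lev_Un_def)
    then show ?case by simp
  next
    case (Basic B)
    then show ?case using approximable_lessThan by (auto simp: sets_M_iff)
  next
    case (Compl B)
    have "(UNIV - B) \<inter> X = space M - B \<inter> X" by (auto simp: space_M)
    then show ?case using Compl approximable_compl by auto
  next
    case (Union B)
    \<comment> \<open>Partial unions reduce a countable union to finite unions and an increasing
      limit.\<close>
    define A where "A k = (\<Union>i<k. B i \<inter> X)" for k
    have A: "A k \<in> sets M \<and> approximable (A k)" for k
    proof (induction k)
      case 0
      have "approximable {}" unfolding approximable_def
        by (intro allI impI exI[of _ 0] exI[of _ "{}"]) (auto simp: lev_Un_def)
      then show ?case by (simp add: A_def)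
    next
      case (Suc k)
      have "A (Suc k) = B k \<inter> X \<union> A k" by (auto simp: A_def lessThan_Suc)
      then show ?case using Suc Union.IH[of k] approximable_Un[of "B k \<inter> X" "A k"] by auto
    qed
    have "incseq A" unfolding A_def by (intro incseq_SucI) (auto simp: lessThan_Suc)
    moreover have "(\<Union>i. B i) \<inter> X = (\<Union>k. A k)" by (auto simp: A_def)
    ultimately show ?case using approximable_incseq[of A] A by auto
  qed
  moreover have "A \<in> sigma_sets UNIV (range lessThan)"
    using assms by (simp add: sets_M_iff borel_Iio)
  ultimately have "approximable (A \<inter> X)" by blast
  moreover have "A \<inter> X = A" using assms by (auto simp: sets_M_iff)
  ultimately show ?thesis by simp
qed

end


lemma (in prob_space) prob_diff_le:
  assumes [measurable]: "A \<in> sets M" "B \<in> sets M"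
  shows "\<bar>prob A - prob B\<bar> \<le> prob (sym_diff A B)"
proof -
  have le: "prob C \<le> prob D + prob (sym_diff C D)" if [measurable]: "C \<in> sets M" "D \<in> sets M" for C D
  proof -
    have "prob C \<le> prob (D \<union> sym_diff C D)" by (intro finite_measure_mono) auto
    also have "\<dots> \<le> prob D + prob (sym_diff C D)" by (rule measure_subadditive) auto
    finally show ?thesis .
  qed
  show ?thesis using le[of A B] le[of B A] by (simp add: Un_commute abs_le_iff)
qed

text \<open>By invariance the error does not depend on \<open>t\<close>, so one approximation serves
  for all powers at once.\<close>

lemma (in mpt) prob_vimage_diff_le:
  assumes [measurable]: "A \<in> sets M" "A' \<in> sets M" "B \<in> sets M" "B' \<in> sets M"
  shows "\<bar>prob ((T ^^ t) -` A \<inter> space M \<inter> B) - prob ((T ^^ t) -` A' \<inter> space M \<inter> B')\<bar>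
     \<le> prob (sym_diff A A') + prob (sym_diff B B')"
proof -
  have "\<bar>prob ((T ^^ t) -` A \<inter> space M \<inter> B) - prob ((T ^^ t) -` A' \<inter> space M \<inter> B')\<bar>
     \<le> prob (sym_diff ((T ^^ t) -` A \<inter> space M \<inter> B) ((T ^^ t) -` A' \<inter> space M \<inter> B'))"
    by (rule prob_diff_le) measurable
  also have "\<dots> \<le> prob (((T ^^ t) -` (sym_diff A A') \<inter> space M) \<union> sym_diff B B')"
    by (intro finite_measure_mono) (auto, measurable)
  also have "\<dots> \<le> prob ((T ^^ t) -` (sym_diff A A') \<inter> space M) + prob (sym_diff B B')"
    by (rule measure_subadditive) (auto, measurable)
  also have "prob ((T ^^ t) -` (sym_diff A A') \<inter> space M) = prob (sym_diff A A')"
    by (rule prob_T_pow) measurable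
  finally show ?thesis .
qed

lemma abs_diff_mean_le:
  fixes x b d d' p q :: real
  assumes "\<bar>x - (b + d) / 2\<bar> \<le> p" "\<bar>d' - d\<bar> \<le> q"
  shows "\<bar>x - (b + d') / 2\<bar> \<le> p + q"
proof -
  have "x - (b + d') / 2 = (x - (b + d) / 2) - (d' - d) / 2" by (simp add: field_simps)
  then have "\<bar>x - (b + d') / 2\<bar> \<le> \<bar>x - (b + d) / 2\<bar> + \<bar>d' - d\<bar> / 2"
    using abs_triangle_ineq4[of "x - (b + d) / 2" "(d' - d) / 2"] by simp
  also have "\<dots> \<le> p + q"
  proof (rule add_mono[OF assms(1)])
    have "\<bar>d' - d\<bar> / 2 \<le> \<bar>d' - d\<bar>" by simp
    then show "\<bar>d' - d\<bar> / 2 \<le> q" using assms(2) by (rule order_trans)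
  qed
  finally show ?thesis .
qed

lemma card_mod_in:
  assumes "B \<subseteq> {..<c}"
  shows "card {i. i < m * c \<and> i mod c \<in> B} = m * card B"
proof -
  have "{i. i < m * c \<and> i mod c \<in> B} = (\<lambda>(a, b). a * c + b) ` ({..<m} \<times> B)"
  proof (intro equalityI subsetI)
    fix i assume i: "i \<in> {i. i < m * c \<and> i mod c \<in> B}"
    then show "i \<in> (\<lambda>(a, b). a * c + b) ` ({..<m} \<times> B)"
      by (intro image_eqI[of _ _ "(i div c, i mod c)"]) (auto simp: less_mult_imp_div_less)
  next
    fix i assume "i \<in> (\<lambda>(a, b). a * c + b) ` ({..<m} \<times> B)"
    then obtain a b where ab: "i = a * c + b" "a < m" "b \<in> B" by auto
    then have "b < c" using assms by auto
    then have "i < Suc a * c" using ab by simp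
    also have "\<dots> \<le> m * c" using ab by (intro mult_le_mono1) simp
    finally show "i \<in> {i. i < m * c \<and> i mod c \<in> B}" using ab \<open>b < c\<close> by simp
  qed
  moreover have "inj_on (\<lambda>(a, b). a * c + b) ({..<m} \<times> B)"
  proof (rule inj_onI, clarify)
    fix a b a' b' assume *: "b \<in> B" "b' \<in> B" "a * c + b = a' * c + b'"
    then have "b < c" "b' < c" using assms by auto
    then have "(a * c + b) div c = a" "(a' * c + b') div c = a'" by auto
    then show "a = a' \<and> b = b'" using * by auto
  qed
  ultimately show ?thesis by (simp add: card_image card_cartesian_product)
qed

context finite_rank_one
begin

sublocale mpt M T
  using prob_space_M measure_preserving_T by (simp add: mpt_def mpt_axioms_def)

text \<open>Indices, in column \<open>n + 1\<close>, of the slices of the levels \<open>J\<close>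
  that belong to the copies \<open>I\<close>.\<close>

definition sub_levels :: "nat \<Rightarrow> nat set \<Rightarrow> nat set \<Rightarrow> nat set" where
  "sub_levels n I J = (\<lambda>(i, l). off n i + l) ` (I \<times> J)"

lemma sub_levels_subset:
  assumes "I \<subseteq> {..r n}" "J \<subseteq> {..<H n}"
  shows "sub_levels n I J \<subseteq> {..<H (Suc n)}"
  using assms off_less_H by (fastforce simp: sub_levels_def)

lemma card_sub_levels:
  assumes "J \<subseteq> {..<H n}"
  shows "card (sub_levels n I J) = card I * card J"
proof -
  have "inj_on (\<lambda>(i, l). off n i + l) (I \<times> J)"
  proof (rule inj_onI, clarify)
    fix i l i' l' assume "l \<in> J" "l' \<in> J" "off n i + l = off n i' + l'"
    then show "i = i' \<and> l = l'" using assms by (intro off_inj) auto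
  qed
  then show ?thesis by (simp add: sub_levels_def card_image card_cartesian_product)
qed

lemma mem_sub_levels:
  assumes "l < H n" "J \<subseteq> {..<H n}"
  shows "off n i + l \<in> sub_levels n I J \<longleftrightarrow> i \<in> I \<and> l \<in> J"
proof
  assume "off n i + l \<in> sub_levels n I J"
  then obtain i' l' where "off n i + l = off n i' + l'" "i' \<in> I" "l' \<in> J"
    by (auto simp: sub_levels_def)
  then show "i \<in> I \<and> l \<in> J" using off_inj[of n i l i' l'] assms by auto
qed (auto simp: sub_levels_def)

lemma lev_Un_memE:
  assumes "x \<in> lev_Un n J" "J \<subseteq> {..<H n}"
  obtains i l where "i \<le> r n" "l \<in> J" "l < H n" "x \<in> lev (Suc n) (off n i + l)" "x \<in> lev n l"
proof -
  obtain l where l: "l \<in> J" "x \<in> lev n l" using assms(1) by (auto simp: lev_Un_def)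
  then have "l < H n" using assms(2) by auto
  then show ?thesis using that l lev_split[of l n] by auto
qed

lemma prob_sub_levels:
  assumes "I \<subseteq> {..r n}" "J \<subseteq> {..<H n}"
  shows "prob (lev_Un (Suc n) (sub_levels n I J)) = real (card I) * (real (card J) * W n / L) / real (r n + 1)"
  using prob_lev_Un[OF sub_levels_subset[OF assms]] card_sub_levels[OF assms(2)]
  by (simp add: W_Suc[of n])

lemma H_W_le: "real (H n) * W n / L \<le> 1"
  using prob_le_1[of "{0..<used n}"] by (simp add: prob_used del: prob_le_1)

lemma H_pos: "H n > 0"
proof (induction n)
  case (Suc n)
  then show ?case by (simp add: H_Suc off_Suc)
qed (simp add: H_def)

end

section \<open>Weak mixing of the construction\<close>

context block_spacers
begin

sublocale rank_one r s .

text \<open>One spacer per completed group; the strict bound on \<open>i\<close> keeps the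
  suppressed final spacer out of the count.\<close>

lemma sum_s: "i < c n * c n \<Longrightarrow> (\<Sum>j<i. s n j) = i div c n"
  by (induction i) (auto simp: s_def div_Suc dvd_eq_mod_eq_0)

lemma off_eq: "i < c n * c n \<Longrightarrow> off n i = i * H n + i div c n"
  by (simp add: off_def sum_s)

lemma W_Suc_c: "W n = real (c n * c n) * W (Suc n)"
  using W_Suc[of n] Suc_r[of n] by (metis Suc_eq_plus1)

lemma c_W: "real (c n) * W (Suc n) \<le> W n / 4"
proof -
  have "4 * (real (c n) * W (Suc n)) \<le> real (c n) * (real (c n) * W (Suc n))"
    using c_ge[of n] W_pos[of "Suc n"] by (intro mult_right_mono) auto
  then show ?thesis using W_Suc_c[of n] by simp
qed

lemma W_Suc_le: "W (Suc n) \<le> W n / 2"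
proof -
  have "1 * W (Suc n) \<le> real (c n) * W (Suc n)"
    using c_ge[of n] W_pos[of "Suc n"] by (intro mult_right_mono) auto
  then show ?thesis using c_W[of n] W_pos[of n] by simp
qed

lemma W_le: "W n \<le> (1 / 2) ^ n"
proof (induction n)
  case (Suc n)
  then show ?case using W_Suc_le[of n] by simp
qed (simp add: rk_width_def)

text \<open>A stage adds at most \<open>c n * W (Suc n) \<le> W n / 4\<close>, which fits since
  \<open>W\<close> at least halves; the term \<open>- W n\<close> makes the induction close.\<close>

lemma used_le: "used n \<le> 2 - W n"
proof (induction n)
  case 0
  then show ?case by (simp add: rk_width_def)
next
  case (Suc n)
  have "(\<Sum>i\<le>r n. s n i) = (\<Sum>i<r n. s n i) + s n (r n)"
    by (simp add: lessThan_Suc_atMost[symmetric])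
  also have "s n (r n) = 0" by (simp add: s_def Suc_r)
  also have "(\<Sum>i<r n. s n i) + 0 = r n div c n" using sum_s[of "r n" n] Suc_r[of n] by simp
  also have "\<dots> \<le> c n"
  proof -
    have "r n div c n < c n" using Suc_r[of n] by (intro less_mult_imp_div_less) simp
    then show ?thesis by simp
  qed
  finally have "real (\<Sum>i\<le>r n. s n i) * W (Suc n) \<le> real (c n) * W (Suc n)"
    using W_pos[of "Suc n"] by (intro mult_right_mono of_nat_mono) auto
  then have "used (Suc n) \<le> used n + W n / 4" using c_W[of n] by simp
  then show ?case using Suc W_Suc_le[of n] W_pos[of n] by linarith
qed

sublocale finite_rank_one r s
proof
  have "used n \<le> 2" for n using used_le[of n] W_pos[of n] by simp
  then show "\<exists>K. \<forall>n. used n \<le> K" by blast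
  show "W \<longlonglongrightarrow> 0"
  proof (rule tendsto_sandwich[of "\<lambda>_. 0" _ _ "\<lambda>n. (1 / 2) ^ n"])
    show "(\<lambda>n. (1 / 2 :: real) ^ n) \<longlonglongrightarrow> 0" by (rule LIMSEQ_power_zero) simp
  qed (use W_le W_pos in \<open>auto intro!: always_eventually less_imp_le\<close>)
qed

definition e :: "nat \<Rightarrow> nat" where "e n = c n div 2"

lemma c_e: "c n = 2 * e n" using c_even[of n] by (simp add: e_def)

text \<open>The time to climb half a group of copies plus one step: the extra step is consumed by a
  spacer if one is crossed, and otherwise moves the point up one level.\<close>

definition \<tau> :: "nat \<Rightarrow> nat" where "\<tau> n = e n * H n + 1"

text \<open>Advancing half a group crosses exactly one group boundary when copy \<open>i\<close> is
  in the second half of its group, and none otherwise.\<close>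

lemma div_add_half:
  "(i + e n) div c n = i div c n + (if i mod c n < e n then 0 else 1)"
proof -
  have c: "c n > 0" using c_ge[of n] by simp
  have "i + e n = (i mod c n + e n) + i div c n * c n" using div_mult_mod_eq[of i "c n"] by linarith
  then have "(i + e n) div c n = i div c n + (i mod c n + e n) div c n"
    using c by (simp only: div_mult_self1)
  moreover have "(i mod c n + e n) div c n = (if i mod c n < e n then 0 else 1)"
  proof (cases "i mod c n < e n")
    case True
    then show ?thesis using c_e[of n] by simp
  next
    case False
    have "i mod c n < c n" using c by simp
    then show ?thesis using False c_e[of n] by (intro div_nat_eqI) auto
  qed
  ultimately show ?thesis by simp
qed

lemma T_\<tau>:
  assumes "x \<in> lev (Suc n) (off n i + l)" "l < H n" "i + e n \<le> r n"
  shows "i mod c n < e n \<Longrightarrow> Suc l < H n \<Longrightarrow> (T ^^ \<tau> n) x \<in> lev n (Suc l)"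
    and "\<not> i mod c n < e n \<Longrightarrow> (T ^^ \<tau> n) x \<in> lev n l"
proof -
  have i: "i < c n * c n" "i + e n < c n * c n" using assms(3) Suc_r[of n] by auto
  have off: "off n (i + e n) = off n i + e n * H n + (if i mod c n < e n then 0 else 1)"
    unfolding off_eq[OF i(1)] off_eq[OF i(2)] div_add_half by (simp add: algebra_simps)
  show "(T ^^ \<tau> n) x \<in> lev n (Suc l)" if "i mod c n < e n" "Suc l < H n"
  proof -
    have eq: "off n i + l + \<tau> n = off n (i + e n) + Suc l" using off that by (simp add: \<tau>_def)
    have "(T ^^ \<tau> n) x \<in> lev (Suc n) (off n i + l + \<tau> n)"
      by (rule T_pow_lev[OF assms(1)]) (unfold eq, rule off_less_H[OF assms(3) that(2)])
    then have "(T ^^ \<tau> n) x \<in> lev (Suc n) (off n (i + e n) + Suc l)" unfolding eq .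
    then show ?thesis using lev_Suc_subset[OF assms(3) that(2)] by blast
  qed
  show "(T ^^ \<tau> n) x \<in> lev n l" if "\<not> i mod c n < e n"
  proof -
    have eq: "off n i + l + \<tau> n = off n (i + e n) + l" using off that by (simp add: \<tau>_def)
    have "(T ^^ \<tau> n) x \<in> lev (Suc n) (off n i + l + \<tau> n)"
      by (rule T_pow_lev[OF assms(1)]) (unfold eq, rule off_less_H[OF assms(3,2)])
    then have "(T ^^ \<tau> n) x \<in> lev (Suc n) (off n (i + e n) + l)" unfolding eq .
    then show ?thesis using lev_Suc_subset[OF assms(3,2)] by blast
  qed
qed

text \<open>Copies in the first half of a group act as \<open>T\<close>, those in the second half as
  the identity, and each kind carries half of every level. The exceptions are the top level and the
  last \<open>e n\<close> copies, from which half a group cannot be climbed.\<close>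

lemma weak_limit_levels:
  assumes J: "J \<subseteq> {..<H n}" and J': "J' \<subseteq> {..<H n}"
  defines "U \<equiv> lev_Un n J" and "U' \<equiv> lev_Un n J'"
  shows "\<bar>prob ((T ^^ \<tau> n) -` U \<inter> space M \<inter> U') - (prob (U \<inter> U') + prob (T -` U \<inter> space M \<inter> U')) / 2\<bar>
    \<le> 1 / real (c n) + 2 * W n"
proof -
  have U [measurable]: "U \<in> sets M" "U' \<in> sets M" unfolding U_def U'_def using J J' by auto
  have TU [measurable]: "T -` U \<inter> space M \<in> sets M" by (rule T_vimage_sets) measurable
  \<comment> \<open>\<open>J1\<close> describes the preimage of \<open>U\<close> under
    \<open>T\<close> within \<open>U'\<close>, up to the top level; \<open>J2\<close> describes
    \<open>U \<inter> U'\<close>.\<close>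
  define J1 J2 where "J1 = {l\<in>J'. Suc l < H n \<and> Suc l \<in> J}" and "J2 = J \<inter> J'"
  have J12: "J1 \<subseteq> {..<H n}" "J2 \<subseteq> {..<H n}" "finite J1" "finite J2"
    using J J' finite_subset[of _ "{..<H n}"] by (auto simp: J1_def J2_def)
  define Lo Hi Bd where "Lo = {i. i < c n * c n \<and> i mod c n \<in> {..<e n}}"
    and "Hi = {i. i < c n * c n \<and> i mod c n \<in> {e n..<c n}}"
    and "Bd = {i. i \<le> r n \<and> \<not> i + e n \<le> r n}"
  have I: "Lo \<subseteq> {..r n}" "Hi \<subseteq> {..r n}" "Bd \<subseteq> {..r n}"
    using Suc_r[of n] by (auto simp: Lo_def Hi_def Bd_def)
  have cardI: "card Lo = c n * e n" "card Hi = c n * e n"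
    unfolding Lo_def Hi_def using c_e[of n] by (subst card_mod_in; auto)+
  have cardBd: "card Bd \<le> e n"
  proof -
    have "Bd \<subseteq> {Suc (r n) - e n..r n}" by (auto simp: Bd_def)
    then have "card Bd \<le> card {Suc (r n) - e n..r n}" by (intro card_mono) auto
    then show ?thesis by simp
  qed
  \<comment> \<open>The predicted set: the preimage of \<open>U\<close> under
    \<open>T ^^ \<tau> n\<close> within \<open>U'\<close>, up to the exceptional sets
    \<open>Z\<close> and \<open>top\<close>.\<close>
  define Y where "Y = lev_Un (Suc n) (sub_levels n Lo J1 \<union> sub_levels n Hi J2)"
  have subY: "sub_levels n Lo J1 \<union> sub_levels n Hi J2 \<subseteq> {..<H (Suc n)}"
    using sub_levels_subset I J12 by auto
  have [measurable]: "Y \<in> sets M" unfolding Y_def using subY by auto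
  have c0: "real (c n) > 0" using c_ge[of n] by simp
  have rc: "real (r n + 1) = real (c n) * real (c n)" using Suc_r[of n] by (metis Suc_eq_plus1 of_nat_mult)
  have half: "prob (lev_Un (Suc n) (sub_levels n Q Z)) = prob (lev_Un n Z) / 2"
    if "Q \<subseteq> {..r n}" "card Q = c n * e n" "Z \<subseteq> {..<H n}" for Q Z
    unfolding prob_sub_levels[OF that(1,3)] prob_lev_Un[OF that(3)] that(2) rc
    using c0 c_e[of n] by (simp add: field_simps)
  have "disjnt (sub_levels n Lo J1) (sub_levels n Hi J2)"
  proof -
    have "off n i + l \<noteq> off n i' + l'" if "i \<in> Lo" "l \<in> J1" "i' \<in> Hi" "l' \<in> J2" for i l i' l'
    proof
      assume eq: "off n i + l = off n i' + l'"
      have "l < H n" "l' < H n" using that J12 by auto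
      then have "i = i'" using off_inj[OF eq] by simp
      then show False using that by (simp add: Lo_def Hi_def)
    qed
    then show ?thesis by (auto simp: disjnt_def sub_levels_def)
  qed
  then have "prob Y = prob (lev_Un (Suc n) (sub_levels n Lo J1)) + prob (lev_Un (Suc n) (sub_levels n Hi J2))"
    unfolding Y_def using subY sub_levels_subset[OF I(1) J12(1)] sub_levels_subset[OF I(2) J12(2)]
    by (simp add: prob_lev_Un card_Un_disjnt finite_subset[of _ "{..<H (Suc n)}"] add_divide_distrib algebra_simps)
  then have prob_Y: "prob Y = (prob (lev_Un n J2) + prob (lev_Un n J1)) / 2"
    using half[OF I(1) cardI(1) J12(1)] half[OF I(2) cardI(2) J12(2)] by simp
  define top where "top = lev n (H n - 1)"
  have [measurable]: "top \<in> sets M" unfolding top_def using H_pos[of n] by simp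
  have WL: "W n / L \<le> W n" using L_ge_1 W_pos[of n] mult_left_mono[of 1 L "W n"] by (simp add: divide_le_eq)
  have prob_top: "prob top \<le> W n"
    unfolding top_def using H_pos[of n] WL by (simp add: prob_lev)
  define Z where "Z = lev_Un (Suc n) (sub_levels n Bd {..<H n})"
  have [measurable]: "Z \<in> sets M" unfolding Z_def using sub_levels_subset[OF I(3)] by auto
  have prob_Z: "prob Z \<le> 1 / real (c n)"
  proof -
    have "prob Z = real (card Bd) * (real (H n) * W n / L) / (real (c n) * real (c n))"
      unfolding Z_def using prob_sub_levels[OF I(3), of "{..<H n}"] rc by simp
    also have "\<dots> \<le> real (c n) * 1 / (real (c n) * real (c n))"
      using cardBd c_e[of n] H_W_le[of n] L_ge_1 W_pos[of n]
      by (intro divide_right_mono mult_mono) (auto intro!: divide_nonneg_nonneg)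
    also have "\<dots> = 1 / real (c n)" using c0 by simp
    finally show ?thesis .
  qed
  have inter: "U \<inter> U' = lev_Un n J2"
  proof (intro equalityI subsetI)
    fix x assume x: "x \<in> U \<inter> U'"
    then obtain l where "l \<in> J'" "x \<in> lev n l" by (auto simp: U'_def lev_Un_def)
    then show "x \<in> lev_Un n J2" using x lev_Un_iff[of x n l J] J J' by (auto simp: U_def J2_def lev_Un_def)
  qed (auto simp: U_def U'_def J2_def lev_Un_def)
  have T1: "\<bar>prob (T -` U \<inter> space M \<inter> U') - prob (lev_Un n J1)\<bar> \<le> W n"
  proof -
    have "sym_diff (T -` U \<inter> space M \<inter> U') (lev_Un n J1) \<subseteq> top"
    proof
      fix x assume x: "x \<in> sym_diff (T -` U \<inter> space M \<inter> U') (lev_Un n J1)"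
      have "x \<in> U'" using x by (auto simp: U'_def J1_def lev_Un_def)
      then obtain l where l: "l \<in> J'" "x \<in> lev n l" by (auto simp: U'_def lev_Un_def)
      then have lH: "l < H n" using J' by auto
      have xM: "x \<in> space M" using lev_subset_X[OF lH] l by (auto simp: space_M)
      show "x \<in> top"
      proof (cases "Suc l < H n")
        case True
        have "T x \<in> lev n (Suc l)" using T_pow_lev[OF l(2), of 1] True by simp
        then have "T x \<in> U \<longleftrightarrow> Suc l \<in> J" unfolding U_def using True J by (intro lev_Un_iff)
        moreover have "x \<in> lev_Un n J1 \<longleftrightarrow> l \<in> J1" using l lH J12 by (intro lev_Un_iff)
        ultimately show ?thesis using x xM \<open>x \<in> U'\<close> l True by (auto simp: J1_def)
      next
        case False
        then have "l = H n - 1" using lH by simp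
        then show ?thesis using l by (simp add: top_def)
      qed
    qed
    then have "prob (sym_diff (T -` U \<inter> space M \<inter> U') (lev_Un n J1)) \<le> prob top"
      by (intro finite_measure_mono) auto
    also note prob_top
    finally have "prob (sym_diff (T -` U \<inter> space M \<inter> U') (lev_Un n J1)) \<le> W n" .
    moreover have "\<bar>prob (T -` U \<inter> space M \<inter> U') - prob (lev_Un n J1)\<bar>
        \<le> prob (sym_diff (T -` U \<inter> space M \<inter> U') (lev_Un n J1))"
      by (rule prob_diff_le) (use lev_Un_sets[OF J12(1)] in measurable)
    ultimately show ?thesis by (rule order_trans[rotated])
  qed
  have T\<tau>: "\<bar>prob ((T ^^ \<tau> n) -` U \<inter> space M \<inter> U') - prob Y\<bar> \<le> 1 / real (c n) + W n"
  proof -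
    have "sym_diff ((T ^^ \<tau> n) -` U \<inter> space M \<inter> U') Y \<subseteq> Z \<union> top"
    proof
      fix x assume x: "x \<in> sym_diff ((T ^^ \<tau> n) -` U \<inter> space M \<inter> U') Y"
      have "Y \<subseteq> U'"
      proof
        fix y assume "y \<in> Y"
        then obtain i l where il: "y \<in> lev (Suc n) (off n i + l)" "i \<le> r n" "l \<in> J'"
          using I by (auto simp: Y_def lev_Un_def sub_levels_def J1_def J2_def)
        then show "y \<in> U'" using lev_Suc_subset[of i n l] J' by (auto simp: U'_def lev_Un_def)
      qed
      then have xU': "x \<in> U'" using x by auto
      then obtain i l where il: "i \<le> r n" "l \<in> J'" "l < H n" "x \<in> lev (Suc n) (off n i + l)" "x \<in> lev n l"
        unfolding U'_def using J' by (rule lev_Un_memE)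
      have xM: "x \<in> space M" using lev_subset_X[OF il(3)] il by (auto simp: space_M)
      have ic: "i < c n * c n" using il(1) Suc_r[of n] by simp
      have offH: "off n i + l < H (Suc n)" using il by (intro off_less_H)
      consider "\<not> i + e n \<le> r n" | "\<not> Suc l < H n" | "i + e n \<le> r n" "Suc l < H n" by blast
      then show "x \<in> Z \<union> top"
      proof cases
        case 1
        then have "off n i + l \<in> sub_levels n Bd {..<H n}" using il by (simp add: mem_sub_levels Bd_def)
        then show ?thesis using il by (auto simp: Z_def lev_Un_def)
      next
        case 2
        then have "l = H n - 1" using il by simp
        then show ?thesis using il by (simp add: top_def)
      next
        case 3
        have Y: "x \<in> Y \<longleftrightarrow> i \<in> Lo \<and> l \<in> J1 \<or> i \<in> Hi \<and> l \<in> J2"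
          unfolding Y_def using lev_Un_iff[OF il(4) offH subY] mem_sub_levels[OF il(3)] J12 by simp
        have "(T ^^ \<tau> n) x \<in> U \<longleftrightarrow> (if i mod c n < e n then Suc l \<in> J else l \<in> J)"
          using T_\<tau>[OF il(4,3) 3(1)] 3(2) lev_Un_iff[of "(T ^^ \<tau> n) x" n _ J] J il(3)
          by (auto simp: U_def)
        then have "x \<in> (T ^^ \<tau> n) -` U \<inter> space M \<inter> U' \<longleftrightarrow> x \<in> Y"
          unfolding Y using xM xU' ic il(2) 3(2) c_ge[of n]
          by (auto simp: Lo_def Hi_def J1_def J2_def)
        then show ?thesis using x by auto
      qed
    qed
    then have "prob (sym_diff ((T ^^ \<tau> n) -` U \<inter> space M \<inter> U') Y) \<le> prob (Z \<union> top)"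
      by (intro finite_measure_mono) auto
    also have "\<dots> \<le> prob Z + prob top" by (rule prob_Un_le) measurable
    also have "\<dots> \<le> 1 / real (c n) + W n" by (rule add_mono[OF prob_Z prob_top])
    finally have "prob (sym_diff ((T ^^ \<tau> n) -` U \<inter> space M \<inter> U') Y) \<le> 1 / real (c n) + W n" .
    moreover have "\<bar>prob ((T ^^ \<tau> n) -` U \<inter> space M \<inter> U') - prob Y\<bar>
        \<le> prob (sym_diff ((T ^^ \<tau> n) -` U \<inter> space M \<inter> U') Y)"
      by (rule prob_diff_le) measurable
    ultimately show ?thesis by (rule order_trans[rotated])
  qed
  show ?thesis using abs_diff_mean_le[OF T\<tau>[unfolded prob_Y] T1] unfolding inter by simp
qed


lemma weak_limit:
  assumes A [measurable]: "A \<in> sets M" and C [measurable]: "C \<in> sets M"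
  shows "(\<lambda>n. prob ((T ^^ \<tau> n) -` A \<inter> space M \<inter> C)) \<longlonglongrightarrow> (prob (A \<inter> C) + prob (T -` A \<inter> space M \<inter> C)) / 2"
proof (rule LIMSEQ_I)
  fix \<delta> :: real assume "\<delta> > 0"
  \<comment> \<open>Replacing both sets by levels costs less than \<open>\<delta> / 4\<close> in
    each of three probabilities, and the estimate for levels costs \<open>\<delta> / 8\<close>; the
    total is below \<open>\<delta>\<close>.\<close>
  have "\<delta> / 8 > 0" using \<open>\<delta> > 0\<close> by simp
  obtain m1 where m1: "\<And>n. n \<ge> m1 \<Longrightarrow> \<exists>J\<subseteq>{..<H n}. prob (sym_diff A (lev_Un n J)) < \<delta> / 8"
    using approximable_sets[OF A] \<open>\<delta> / 8 > 0\<close> unfolding approximable_def by blast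
  obtain m2 where m2: "\<And>n. n \<ge> m2 \<Longrightarrow> \<exists>J\<subseteq>{..<H n}. prob (sym_diff C (lev_Un n J)) < \<delta> / 8"
    using approximable_sets[OF C] \<open>\<delta> / 8 > 0\<close> unfolding approximable_def by blast
  have c_lim: "(\<lambda>n. 1 / real (c n) + 2 * W n) \<longlonglongrightarrow> 0 + 2 * 0"
  proof (intro tendsto_intros W_tendsto_0)
    have "filterlim (\<lambda>n. real (c n)) at_top sequentially"
      by (rule filterlim_at_top_mono[OF filterlim_real_sequentially]) (use c_ge_index in simp)
    then show "(\<lambda>n. 1 / real (c n)) \<longlonglongrightarrow> 0" by (rule tendsto_divide_0[OF tendsto_const filterlim_at_top_imp_at_infinity])
  qed
  then have "eventually (\<lambda>n. 1 / real (c n) + 2 * W n < \<delta> / 8) sequentially"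
    using \<open>\<delta> / 8 > 0\<close> by (intro order_tendstoD) auto
  then obtain m3 where m3: "\<And>n. n \<ge> m3 \<Longrightarrow> 1 / real (c n) + 2 * W n < \<delta> / 8"
    by (auto simp: eventually_sequentially)
  show "\<exists>no. \<forall>n\<ge>no. norm (prob ((T ^^ \<tau> n) -` A \<inter> space M \<inter> C)
      - (prob (A \<inter> C) + prob (T -` A \<inter> space M \<inter> C)) / 2) < \<delta>"
  proof (intro exI allI impI)
    fix n assume n: "n \<ge> max m1 (max m2 m3)"
    obtain J where J: "J \<subseteq> {..<H n}" "prob (sym_diff A (lev_Un n J)) < \<delta> / 8" using m1 n by auto
    obtain J' where J': "J' \<subseteq> {..<H n}" "prob (sym_diff C (lev_Un n J')) < \<delta> / 8" using m2 n by auto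
    define U U' where "U = lev_Un n J" and "U' = lev_Un n J'"
    have [measurable]: "U \<in> sets M" "U' \<in> sets M" unfolding U_def U'_def using J J' by auto
    have d: "\<bar>prob ((T ^^ t) -` A \<inter> space M \<inter> C) - prob ((T ^^ t) -` U \<inter> space M \<inter> U')\<bar> < \<delta> / 4" for t
    proof -
      have "\<bar>prob ((T ^^ t) -` A \<inter> space M \<inter> C) - prob ((T ^^ t) -` U \<inter> space M \<inter> U')\<bar>
          \<le> prob (sym_diff A U) + prob (sym_diff C U')"
        by (rule prob_vimage_diff_le) measurable
      then show ?thesis using J(2) J'(2) by (simp add: U_def U'_def)
    qed
    have "A \<subseteq> space M" "U \<subseteq> space M"
      using sets.sets_into_space[OF A] sets.sets_into_space[OF \<open>U \<in> sets M\<close>] .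
    then have d0: "\<bar>prob (A \<inter> C) - prob (U \<inter> U')\<bar> < \<delta> / 4"
      using d[of 0] by (simp add: Int_absorb2)
    have d1: "\<bar>prob (T -` A \<inter> space M \<inter> C) - prob (T -` U \<inter> space M \<inter> U')\<bar> < \<delta> / 4"
      using d[of 1] by simp
    have d2: "\<bar>prob ((T ^^ \<tau> n) -` U \<inter> space M \<inter> U') - (prob (U \<inter> U') + prob (T -` U \<inter> space M \<inter> U')) / 2\<bar> < \<delta> / 8"
      using weak_limit_levels[OF J(1) J'(1)] m3[of n] n unfolding U_def U'_def by linarith
    have "\<bar>prob ((T ^^ \<tau> n) -` U \<inter> space M \<inter> U') - (prob (T -` A \<inter> space M \<inter> C) + prob (U \<inter> U')) / 2\<bar> \<le> \<delta> / 8 + \<delta> / 4"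
      using abs_diff_mean_le[OF less_imp_le[OF d2] less_imp_le[OF d1]] by (simp only: add.commute)
    from abs_diff_mean_le[OF this less_imp_le[OF d0]]
    have m: "\<bar>prob ((T ^^ \<tau> n) -` U \<inter> space M \<inter> U') - (prob (T -` A \<inter> space M \<inter> C) + prob (A \<inter> C)) / 2\<bar> \<le> \<delta> / 8 + \<delta> / 4 + \<delta> / 4" .
    have "\<bar>prob ((T ^^ \<tau> n) -` A \<inter> space M \<inter> C) - (prob (T -` A \<inter> space M \<inter> C) + prob (A \<inter> C)) / 2\<bar>
        \<le> \<bar>prob ((T ^^ \<tau> n) -` A \<inter> space M \<inter> C) - prob ((T ^^ \<tau> n) -` U \<inter> space M \<inter> U')\<bar>
          + \<bar>prob ((T ^^ \<tau> n) -` U \<inter> space M \<inter> U') - (prob (T -` A \<inter> space M \<inter> C) + prob (A \<inter> C)) / 2\<bar>"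
      using dist_triangle by (simp only: dist_real_def[symmetric])
    also have "\<dots> < \<delta> / 4 + (\<delta> / 8 + \<delta> / 4 + \<delta> / 4)" by (rule add_less_le_mono[OF d m])
    also have "\<dots> < \<delta>" using \<open>\<delta> > 0\<close> by simp
    finally show "norm (prob ((T ^^ \<tau> n) -` A \<inter> space M \<inter> C)
      - (prob (A \<inter> C) + prob (T -` A \<inter> space M \<inter> C)) / 2) < \<delta>"
      by (simp only: real_norm_def add.commute)
  qed
qed

text \<open>Points in copies that are not the last of their group, so that the next copy follows
  immediately without a spacer.\<close>

definition Good :: "nat \<Rightarrow> real set" where
  "Good n = lev_Un (Suc n) (sub_levels n {i. i < c n * c n \<and> i mod c n \<in> {..<c n - 1}} {..<H n})"

lemma Good_idx: "{i. i < c n * c n \<and> i mod c n \<in> {..<c n - 1}} \<subseteq> {..r n}"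
  using Suc_r[of n] by auto

lemma Good_sets [measurable]: "Good n \<in> sets M"
  unfolding Good_def using sub_levels_subset[OF Good_idx] by simp

lemma prob_Good: "prob (Good n) = (1 - 1 / real (c n)) * (real (H n) * W n / L)"
proof -
  have c: "c n > 0" using c_ge[of n] by simp
  have rc: "real (r n + 1) = real (c n) * real (c n)" using Suc_r[of n] by (metis Suc_eq_plus1 of_nat_mult)
  have "card {i. i < c n * c n \<and> i mod c n \<in> {..<c n - 1}} = c n * (c n - 1)"
    by (subst card_mod_in) auto
  then have "prob (Good n) = real (c n * (c n - 1)) * (real (H n) * W n / L) / (real (c n) * real (c n))"
    unfolding Good_def using prob_sub_levels[OF Good_idx, of "{..<H n}"] rc by simp
  also have "\<dots> = (real (c n - 1) / real (c n)) * (real (H n) * W n / L)"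
    using c by simp
  also have "real (c n - 1) / real (c n) = 1 - 1 / real (c n)"
    using c by (simp add: of_nat_diff diff_divide_distrib)
  finally show ?thesis .
qed

text \<open>On \<open>Good n\<close> the level index runs through one full period during \<open>H n\<close> steps.\<close>

lemma orbit_sum_Good:
  assumes "x \<in> Good n" and J: "J \<subseteq> {..<H n}"
  shows "(\<Sum>t<H n. indicator (lev_Un n J) ((T ^^ t) x)) = real (card J)"
proof -
  obtain i l where il: "i < c n * c n" "i mod c n < c n - 1" "l < H n" "x \<in> lev (Suc n) (off n i + l)"
    using assms(1) by (auto simp: Good_def lev_Un_def sub_levels_def)
  have ir: "i \<le> r n" using il(1) Suc_r[of n] by simp
  have c: "c n > 0" using c_ge[of n] by simp
  \<comment> \<open>The last copy of the column closes a group, so a copy that does not close its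
    group has a successor.\<close>
  have "Suc i \<noteq> c n * c n"
  proof
    assume "Suc i = c n * c n"
    then have "i = (c n - 1) * c n + (c n - 1)"
      using c by (cases "c n") auto
    then have "i mod c n = c n - 1" using c by (metis Suc_diff_1 lessI mod_less mod_mult_self3)
    then show False using il(2) by simp
  qed
  then have i1: "Suc i < c n * c n" "Suc i \<le> r n" using il(1) Suc_r[of n] by auto
  have "Suc (i mod c n) \<noteq> c n" using il(2) by simp
  then have "Suc i div c n = i div c n" by (simp add: div_Suc mod_Suc)
  then have off1: "off n (Suc i) = off n i + H n"
    unfolding off_eq[OF il(1)] off_eq[OF i1(1)] by simp
  have lev: "(T ^^ t) x \<in> lev n ((l + t) mod H n)" if t: "t < H n" for t
  proof (cases "l + t < H n")
    case True
    have "(T ^^ t) x \<in> lev (Suc n) (off n i + l + t)"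
      using off_less_H[OF ir True] by (intro T_pow_lev[OF il(4)]) (simp add: add.assoc)
    then show ?thesis using lev_Suc_subset[OF ir True] True by (auto simp: add.assoc)
  next
    case False
    define l' where "l' = l + t - H n"
    have l': "l' < H n" "(l + t) mod H n = l'"
      using False t il(3) by (auto simp: l'_def le_mod_geq)
    have eq: "off n i + l + t = off n (Suc i) + l'" using False off1 by (simp add: l'_def)
    have "(T ^^ t) x \<in> lev (Suc n) (off n i + l + t)"
      by (rule T_pow_lev[OF il(4)]) (unfold eq, rule off_less_H[OF i1(2) l'(1)])
    then show ?thesis unfolding eq l'(2) using lev_Suc_subset[OF i1(2) l'(1)] by blast
  qed
  have "(\<Sum>t<H n. indicator (lev_Un n J) ((T ^^ t) x)) = (\<Sum>t<H n. (indicator J ((l + t) mod H n) :: real))"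
    using lev lev_Un_iff[OF lev _ J] H_pos[of n] by (intro sum.cong) (auto simp: indicator_def)
  also have "\<dots> = (\<Sum>k<H n. indicator J k)"
  \<comment> \<open>Rotation by \<open>l\<close> modulo \<open>H n\<close> permutes the levels, so
    each level is visited exactly once.\<close>
  proof (rule sum.reindex_bij_betw)
    have inj: "inj_on (\<lambda>t. (l + t) mod H n) {..<H n}"
    proof (rule linorder_inj_onI')
      fix t t' assume a: "t \<in> {..<H n}" "t' \<in> {..<H n}" "t < t'"
      have "\<not> H n dvd t' - t" using a by (intro nat_dvd_not_less) auto
      then show "(l + t) mod H n \<noteq> (l + t') mod H n"
        using mod_eq_dvd_iff_nat[of "l + t" "l + t'" "H n"] a by auto
    qed
    moreover have "(\<lambda>t. (l + t) mod H n) ` {..<H n} \<subseteq> {..<H n}" using H_pos[of n] by auto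
    ultimately show "bij_betw (\<lambda>t. (l + t) mod H n) {..<H n} {..<H n}"
      unfolding bij_betw_def using endo_inj_surj[of "{..<H n}"] by blast
  qed
  also have "\<dots> = real (card J)"
    using J by (simp add: indicator_def sum.If_cases Int_absorb1)
  finally show ?thesis .
qed

text \<open>Replacing \<open>A\<close> by \<open>U\<close> costs the average of \<open>D\<close>,
  whose integral is \<open>prob D\<close> by invariance, plus \<open>prob D\<close> for the mean. On
  \<open>Good n\<close> the average of \<open>U\<close> is constant and differs from
  \<open>prob U\<close> by at most the mass \<open>\<kappa>\<close> outside the column; elsewhere
  the trivial bound 1 is used.\<close>

lemma ergodic_levels:
  assumes J: "J \<subseteq> {..<H n}"
  defines "U \<equiv> lev_Un n J"
  assumes A [measurable]: "A \<in> sets M"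
  shows "(\<integral>x. \<bar>(\<Sum>t<H n. indicator A ((T ^^ t) x)) / real (H n) - prob A\<bar> \<partial>M)
    \<le> 2 * prob (sym_diff A U) + 2 * (1 - real (H n) * W n / L) + 1 / real (c n)"
proof -
  define D where "D = sym_diff A U"
  have [measurable]: "U \<in> sets M" unfolding U_def using J by simp
  have [measurable]: "D \<in> sets M" unfolding D_def by measurable
  define \<kappa> where "\<kappa> = 1 - real (H n) * W n / L"
  have \<kappa>: "\<kappa> \<ge> 0" using H_W_le[of n] by (simp add: \<kappa>_def)
  have h: "real (H n) > 0" using H_pos[of n] by simp
  define avg where "avg C x = (\<Sum>t<H n. indicator C ((T ^^ t) x)) / real (H n)" for C :: "real set" and x
  have avg_meas [measurable]: "avg C \<in> borel_measurable M" if "C \<in> sets M" for C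
    using that unfolding avg_def by measurable
  have avg01: "0 \<le> avg C x" "avg C x \<le> 1" for C x
  proof -
    show "0 \<le> avg C x" unfolding avg_def by (intro divide_nonneg_nonneg sum_nonneg) auto
    have "(\<Sum>t<H n. indicator C ((T ^^ t) x)) \<le> (\<Sum>t<H n. (1::real))"
      by (rule sum_mono) (simp add: indicator_def)
    then show "avg C x \<le> 1" using h by (simp add: avg_def)
  qed
  have int: "integrable M (avg C)" if [measurable]: "C \<in> sets M" for C
    by (rule integrable_const_bound[where B = 1]) (use avg01 in auto)
  have int_avg: "(\<integral>x. avg C x \<partial>M) = prob C" if [measurable]: "C \<in> sets M" for C
  proof -
    have each: "(\<integral>x. indicator C ((T ^^ t) x) \<partial>M) = prob C" for t
      using integral_T_pow[of "indicator C" t] by (simp add: emeasure_eq_measure)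
    have "(\<integral>x. avg C x \<partial>M) = (\<Sum>t<H n. \<integral>x. indicator C ((T ^^ t) x) \<partial>M) / real (H n)"
      unfolding avg_def
      by (subst integral_divide_zero, subst Bochner_Integration.integral_sum)
         (auto intro!: integrable_const_bound[where B = 1])
    then show ?thesis using h by (simp add: each)
  qed
  have muU: "\<bar>prob A - prob U\<bar> \<le> prob D" unfolding D_def by (rule prob_diff_le) measurable
  have cardJ: "real (card J) / real (H n) \<le> 1"
    using J h card_mono[of "{..<H n}" J] by simp
  have pU: "prob U = real (card J) / real (H n) * (1 - \<kappa>)"
    unfolding U_def prob_lev_Un[OF J] \<kappa>_def using h by simp
  have key: "\<bar>avg A x - prob A\<bar> \<le> avg D x + indicator (space M - Good n) x + \<kappa> + prob D" if "x \<in> space M" for x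
  proof -
    have "\<bar>avg A x - avg U x\<bar> \<le> avg D x"
    proof -
      have "\<bar>(\<Sum>t<H n. indicator A ((T ^^ t) x)) - (\<Sum>t<H n. indicator U ((T ^^ t) x))\<bar>
          \<le> (\<Sum>t<H n. \<bar>indicator A ((T ^^ t) x) - indicat_real U ((T ^^ t) x)\<bar>)"
        unfolding sum_subtractf[symmetric] by (rule sum_abs)
      also have "\<dots> = (\<Sum>t<H n. indicator D ((T ^^ t) x))"
        by (rule sum.cong) (auto simp: D_def indicator_def)
      finally show ?thesis
        using h by (simp add: avg_def diff_divide_distrib[symmetric] divide_right_mono)
    qed
    moreover have "\<bar>avg U x - prob U\<bar> \<le> indicator (space M - Good n) x + \<kappa>"
    proof (cases "x \<in> Good n")
      case True
      then have "avg U x = real (card J) / real (H n)"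
        unfolding avg_def U_def by (simp add: orbit_sum_Good[OF _ J])
      then have "avg U x - prob U = real (card J) / real (H n) * \<kappa>" by (simp add: pU right_diff_distrib)
      moreover have "0 \<le> real (card J) / real (H n) * \<kappa>" using \<kappa> by simp
      moreover have "real (card J) / real (H n) * \<kappa> \<le> 1 * \<kappa>"
        using cardJ \<kappa> by (intro mult_right_mono)
      ultimately show ?thesis using True by simp
    next
      case False
      then have "indicator (space M - Good n) x = (1::real)" using that by simp
      then show ?thesis using avg01[of U x] prob_le_1[of U] measure_nonneg[of M U] \<kappa> by linarith
    qed
    ultimately show ?thesis using muU by linarith
  qed
  have "(\<integral>x. \<bar>avg A x - prob A\<bar> \<partial>M) \<le> (\<integral>x. avg D x + indicator (space M - Good n) x + \<kappa> + prob D \<partial>M)"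
    by (rule integral_mono) (use key int in \<open>auto simp: emeasure_eq_measure\<close>)
  also have "\<dots> = prob D + prob (space M - Good n) + \<kappa> + prob D"
    using int_avg[of D] int[of D] by (simp add: emeasure_eq_measure prob_space)
  also have "prob (space M - Good n) = 1 - prob (Good n)" by (simp add: prob_compl)
  also have "1 - prob (Good n) \<le> \<kappa> + 1 / real (c n)"
  proof -
    have "1 - prob (Good n) = \<kappa> + 1 / real (c n) * (real (H n) * W n / L)"
    proof -
      have "1 - (1 - a) * y = (1 - y) + a * y" for a y :: real by (simp add: algebra_simps)
      then show ?thesis unfolding prob_Good \<kappa>_def .
    qed
    also have "\<dots> \<le> \<kappa> + 1 / real (c n) * 1"
      using H_W_le[of n] by (intro add_left_mono mult_left_mono) auto
    finally show ?thesis by simp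
  qed
  finally have "(\<integral>x. \<bar>avg A x - prob A\<bar> \<partial>M) \<le> 2 * prob D + 2 * \<kappa> + 1 / real (c n)" by simp
  then show ?thesis unfolding avg_def D_def \<kappa>_def .
qed

lemma ergodic_averages:
  assumes A: "A \<in> sets M" and "\<delta> > 0"
  shows "\<exists>S>0. (\<integral>x. \<bar>(\<Sum>t<S. indicator A ((T ^^ t) x)) / real S - prob A\<bar> \<partial>M) < \<delta>"
proof -
  have "\<delta> / 4 > 0" using \<open>\<delta> > 0\<close> by simp
  obtain m1 where m1: "\<And>n. n \<ge> m1 \<Longrightarrow> \<exists>J\<subseteq>{..<H n}. prob (sym_diff A (lev_Un n J)) < \<delta> / 4"
    using approximable_sets[OF A] \<open>\<delta> / 4 > 0\<close> unfolding approximable_def by blast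
  have "filterlim (\<lambda>n. real (c n)) at_top sequentially"
    by (rule filterlim_at_top_mono[OF filterlim_real_sequentially]) (use c_ge_index in simp)
  then have "(\<lambda>n. 1 / real (c n)) \<longlonglongrightarrow> 0"
    by (rule tendsto_divide_0[OF tendsto_const filterlim_at_top_imp_at_infinity])
  then have "(\<lambda>n. 2 * (1 - real (H n) * W n / L) + 1 / real (c n)) \<longlonglongrightarrow> 2 * (1 - 1) + 0"
    by (intro tendsto_intros prob_used_tendsto)
  then have "eventually (\<lambda>n. 2 * (1 - real (H n) * W n / L) + 1 / real (c n) < \<delta> / 4) sequentially"
    using \<open>\<delta> / 4 > 0\<close> by (intro order_tendstoD) auto
  then obtain m2 where m2: "\<And>n. n \<ge> m2 \<Longrightarrow> 2 * (1 - real (H n) * W n / L) + 1 / real (c n) < \<delta> / 4"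
    by (auto simp: eventually_sequentially)
  define n where "n = max m1 m2"
  obtain J where J: "J \<subseteq> {..<H n}" "prob (sym_diff A (lev_Un n J)) < \<delta> / 4"
    using m1[of n] by (auto simp: n_def)
  have "(\<integral>x. \<bar>(\<Sum>t<H n. indicator A ((T ^^ t) x)) / real (H n) - prob A\<bar> \<partial>M) < \<delta>"
    using ergodic_levels[OF J(1) A] J(2) m2[of n] \<open>\<delta> > 0\<close> unfolding n_def by linarith
  then show ?thesis using H_pos[of n] by blast
qed

lemma weakly_mixing_T: "weakly_mixing M T"
  by (rule weakly_mixing_criterion[of M T \<tau>])
     (use prob_space_M measure_preserving_T weak_limit ergodic_averages in auto)

end

section \<open>Recursive choice of the cutting parameters\<close>

theorem theorem4:
  fixes \<epsilon> :: real and f :: "nat \<Rightarrow> real"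
  assumes "\<epsilon> > 0" and "filterlim f at_top sequentially"
  shows "\<exists>(r :: nat \<Rightarrow> nat) (s :: nat \<Rightarrow> nat \<Rightarrow> nat).
           (\<forall>n. r n \<ge> 1) \<and>
           emeasure lborel (rk_space r s) < \<infinity> \<and>
           weakly_mixing (rk_measure r s) (rk_map r s) \<and>
           limsup (\<lambda>q. ereal (real (rk_complexity r s q) / real q)) < ereal (3/2 + \<epsilon>) \<and>
           (\<exists>\<^sub>\<infinity> q. real (rk_complexity r s q) < real q + f q)"
proof -
  define good where "good n c h \<longleftrightarrow> c \<ge> 4 \<and> even c \<and> c \<ge> n \<and> h > 0 \<and> f (c * h) > real (h + 2)"
    for n c h :: nat
  have ex: "\<exists>c. good n c h" if "h > 0" for n h
  proof -
    obtain Q where Q: "\<And>q. q \<ge> Q \<Longrightarrow> f q > real (h + 2)"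
      using assms(2) unfolding filterlim_at_top_dense eventually_sequentially by blast
    \<comment> \<open>Even, at least 4 and \<open>n\<close>, and so large that
      \<open>c * h \<ge> Q\<close>, where \<open>f\<close> already exceeds
      \<open>real (h + 2)\<close>.\<close>
    define c where "c = 2 * (Q + n + 2)"
    have "c * 1 \<le> c * h" using that by (intro mult_le_mono2) simp
    then have "c * h \<ge> Q" by (simp add: c_def)
    then show ?thesis using Q that by (intro exI[of _ c]) (simp add: good_def c_def)
  qed
  \<comment> \<open>The pairs are \<open>(c n, h n)\<close>: the cut parameter is chosen after the
    height, and the next height depends on both. The clause for \<open>n = 0\<close> carries the
    initial height through the dependent choice.\<close>
  have "\<exists>g. \<forall>n. (good n (fst (g n)) (snd (g n)) \<and> (n = 0 \<longrightarrow> snd (g n) = 1)) \<and>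
      snd (g (Suc n)) = fst (g n) * (fst (g n) * snd (g n)) + (fst (g n) - 1)"
  proof (rule dependent_nat_choice)
    show "\<exists>x. good 0 (fst x) (snd x) \<and> (0 = (0::nat) \<longrightarrow> snd x = 1)"
      using ex[of 1 0] by auto
  next
    fix x :: "nat \<times> nat" and n :: nat
    assume x: "good n (fst x) (snd x) \<and> (n = 0 \<longrightarrow> snd x = 1)"
    define h' where "h' = fst x * (fst x * snd x) + (fst x - 1)"
    have "h' > 0" using x by (simp add: h'_def good_def)
    then obtain c' where "good (Suc n) c' h'" using ex by blast
    then show "\<exists>y. (good (Suc n) (fst y) (snd y) \<and> (Suc n = 0 \<longrightarrow> snd y = 1)) \<and>
        snd y = fst x * (fst x * snd x) + (fst x - 1)"
      by (intro exI[of _ "(c', h')"]) (simp add: h'_def)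
  qed
  then obtain g where g: "\<And>n. good n (fst (g n)) (snd (g n))" "snd (g 0) = 1"
      "\<And>n. snd (g (Suc n)) = fst (g n) * (fst (g n) * snd (g n)) + (fst (g n) - 1)"
    by blast
  define c where "c n = fst (g n)" for n
  interpret block_spacers c
    by standard (use g(1) in \<open>auto simp: c_def good_def\<close>)
  have c: "c n = fst (g n)" for n by (simp add: c_def)
  \<comment> \<open>The heights postulated in the recursion are the actual block lengths, as both
    satisfy \<open>h_Suc\<close> with the same start.\<close>
  have h: "h n = snd (g n)" for n
  proof (induction n)
    case (Suc n)
    show ?case unfolding h_Suc Suc g(3) unfolding c ..
  qed (simp only: h_0 g(2))
  have f_large: "f (c n * h n) > real (h n + 2)" for n
    using g(1)[of n] unfolding good_def h by (simp add: c)
  show ?thesis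
    using r_ge_1 emeasure_X_finite weakly_mixing_T limsup_complexity[OF assms(1)]
      complexity_infinitely_often[OF f_large] by (intro exI[of _ r] exI[of _ s] conjI allI)
qed

end
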